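(* If $G$ is a finitely presented group with $G/G'\cong\mathbb{Z}^\mu$, then the following conditions are equivalent. (1) $\mathcal{E}_{\mu-1}=0$, where $\mathcal{E}_k$ denotes the $k$-th elementary (Alexander) ideal of $G$. (2) For each integer $q\ge1$, the $q$-th Chen group of $G$ satisfies $Q(G;q)\cong Q(F(\mu);q)$, where $F(\mu)$ is a free group of rank $\mu$. Further, if $G=G_L$ is the link group of a virtual link $L$ with $\mu$ components, then (1) and (2) are equivalent to: (3) The longitudes of $L$ are in $G(\infty)$.
   Context: Notation: $G'=[G,G]$, $G''=[G',G']$; the lower central series is $G_1=G$, $G_n=[G,G_{n-1}]$. The Chen groups of $G$ are $Q(G;q)=G_qG''/(G_{q+1}G'')$, and $G(\infty)=\bigcap_{n=1}^\infty G_nG''$. Elementary ideals: let $\alpha:G\to\mathbb{Z}^\mu$ be the abelianization and extend it to $\mathbb{Z}[G]\to\mathbb{Z}[\mathbb{Z}^\mu]=\mathbb{Z}[t_1^{\pm1},\dots,t_\mu^{\pm1}]$. For a finite presentation $\langle a_1,\dots,a_N\mid r_1,\dots,r_m\rangle$ of $G$, the Alexander matrix is $A=\big(\alpha(\partial r_i/\partial a_j)\big)$ (Fox derivatives), and $\mathcal{E}_k$ is the ideal generated by all $(N-k)\times(N-k)$ minors of $A$ ($0\le k\le N-1$), with $\mathcal{E}_k$ the unit ideal for $k\ge N$ (and $\mathcal{E}_k=0$ if $A$ has fewer than $N-k$ rows). It does not depend on the presentation. Virtual links are represented by virtual link diagrams (oriented immersed planar curves with classical and virtual crossings) modulo classical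 Reidemeister moves and the detour move, or equivalently by links $L\subset\Sigma\times I$ with $\Sigma$ a closed connected oriented surface, up to stable equivalence. The link group $G_L$ of a virtual link: on the $i$-th component, which passes through $n_i$ undercrossings, label the arcs (running from classical undercrossing to classical undercrossing) consecutively $a_{i1},\dots,a_{in_i}$ (second index modulo $n_i$; a component without undercrossings contributes a single generator and no relation). Then $G_L=\langle a_{ij}\mid a_{i\,j+1}=a_{k\ell}^{-\varepsilon_{ij}}a_{ij}a_{k\ell}^{\varepsilon_{ij}}\rangle$, with one relation for each undercrossing, where $a_{ij},a_{i\,j+1}$ are the incoming and outgoing undercrossing arcs, $a_{k\ell}$ is the overcrossing arc and $\varepsilon_{ij}=\pm1$ is the crossing sign. Meridians and longitudes: for each $i$ choose one arc of the $i$-th component; the meridian $m_i$ is the corresponding generator. The longitude $\ell_i$ is obtained by following the $i$-th component along its orientation from the chosen arc, recording at each undercrossing the overcrossing arc generator raised to the sign of that crossing, and multiplying by a power of $m_i$ so that the total exponent sum in the generators of the $i$-th component is zero. *)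

theory Defs
  imports
    "HOL-Algebra.Free_Abelian_Groups"
    "HOL-Algebra.Generated_Groups"
    "HOL-Algebra.Ideal"
    "HOL-Analysis.Derivative"
    "Jordan_Normal_Form.Determinant"
    "Jordan_Normal_Form.DL_Submatrix"
begin

section \<open>Chen groups\<close>

definition commutator_subgroup :: "('a, 'b) monoid_scheme \<Rightarrow> 'a set \<Rightarrow> 'a set \<Rightarrow> 'a set" where
  "commutator_subgroup G H K =
     generate G (\<Union>h\<in>H. \<Union>k\<in>K. {h \<otimes>\<^bsub>G\<^esub> k \<otimes>\<^bsub>G\<^esub> inv\<^bsub>G\<^esub> h \<otimes>\<^bsub>G\<^esub> inv\<^bsub>G\<^esub> k})"

abbreviation derived1 :: "('a, 'b) monoid_scheme \<Rightarrow> 'a set" where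
  "derived1 G \<equiv> derived G (carrier G)"

abbreviation derived2 :: "('a, 'b) monoid_scheme \<Rightarrow> 'a set" where
  "derived2 G \<equiv> derived G (derived1 G)"

text \<open>Indexed from 1, with first term \<open>G\<close>; the value at 0 is a dummy.\<close>

fun lower_central :: "('a, 'b) monoid_scheme \<Rightarrow> nat \<Rightarrow> 'a set" where
  "lower_central G 0 = carrier G"
| "lower_central G (Suc 0) = carrier G"
| "lower_central G (Suc (Suc n)) = commutator_subgroup G (carrier G) (lower_central G (Suc n))"

definition lower_central_metab :: "('a, 'b) monoid_scheme \<Rightarrow> nat \<Rightarrow> 'a set" where
  "lower_central_metab G n = lower_central G n <#>\<^bsub>G\<^esub> derived2 G"

definition chen_group :: "('a, 'b) monoid_scheme \<Rightarrow> nat \<Rightarrow> 'a set monoid" where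
  "chen_group G q =
     (G\<lparr>carrier := lower_central_metab G q\<rparr>) Mod lower_central_metab G (q + 1)"

definition G_infinity :: "('a, 'b) monoid_scheme \<Rightarrow> 'a set" where
  "G_infinity G = (\<Inter>n\<in>{1..}. lower_central_metab G n)"


section \<open>Free groups and presentations\<close>

text \<open>The letter \<open>(x, True)\<close> stands for the generator \<open>x\<close>, and \<open>(x, False)\<close> for its inverse.
  Elements of a free group are the freely reduced words.\<close>

type_synonym 'x word = "('x \<times> bool) list"

definition reduced :: "'x word \<Rightarrow> bool" where
  "reduced w \<longleftrightarrow> successively (\<lambda>a b. \<not> (fst a = fst b \<and> snd a \<noteq> snd b)) w"

fun cancel_cons :: "'x \<times> bool \<Rightarrow> 'x word \<Rightarrow> 'x word" where
  "cancel_cons a [] = [a]"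
| "cancel_cons a (b # w) = (if fst a = fst b \<and> snd a \<noteq> snd b then w else a # b # w)"

definition free_group :: "'x set \<Rightarrow> 'x word monoid" where
  "free_group S =
     \<lparr>carrier = {w. fst ` set w \<subseteq> S \<and> reduced w},
      monoid.mult = (\<lambda>u v. foldr cancel_cons u v),
      one = []\<rparr>"

definition gen :: "'x \<Rightarrow> 'x word" where
  "gen x = [(x, True)]"

definition normal_closure :: "('a, 'b) monoid_scheme \<Rightarrow> 'a set \<Rightarrow> 'a set" where
  "normal_closure G R =
     generate G {g \<otimes>\<^bsub>G\<^esub> r \<otimes>\<^bsub>G\<^esub> inv\<^bsub>G\<^esub> g | g r. g \<in> carrier G \<and> r \<in> R}"

definition presented_group :: "'x set \<Rightarrow> 'x word set \<Rightarrow> 'x word set monoid" where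
  "presented_group S R = free_group S Mod normal_closure (free_group S) R"

definition word_class :: "'x set \<Rightarrow> 'x word set \<Rightarrow> 'x word \<Rightarrow> 'x word set" where
  "word_class S R w = normal_closure (free_group S) R #>\<^bsub>free_group S\<^esub> w"

text \<open>\<open>\<theta>\<close> identifies \<open>\<langle>a\<^sub>0, \<dots>, a\<^sub>N\<^sub>-\<^sub>1 | rs\<rangle>\<close> with \<open>G\<close>.\<close>

definition finite_presentation ::
    "('a, 'b) monoid_scheme \<Rightarrow> nat \<Rightarrow> nat word list \<Rightarrow> (nat word set \<Rightarrow> 'a) \<Rightarrow> bool" where
  "finite_presentation G N rs \<theta> \<longleftrightarrow>
     set rs \<subseteq> carrier (free_group {..<N}) \<and>
     \<theta> \<in> iso (presented_group {..<N} (set rs)) G"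


section \<open>Elementary ideals\<close>

text \<open>The group \<open>\<int>\<^sup>\<mu>\<close> is \<open>free_Abelian_group {..<\<mu>}\<close>. The multiplication of
  finitely supported functions is convolution, so \<open>(nat \<Rightarrow>\<^sub>0 int) \<Rightarrow>\<^sub>0 int\<close> is the
  ring of integral Laurent polynomials in countably many variables.\<close>

type_synonym laurent = "(nat \<Rightarrow>\<^sub>0 int) \<Rightarrow>\<^sub>0 int"

definition laurent_ring :: "nat \<Rightarrow> laurent ring" where
  "laurent_ring \<mu> =
     \<lparr>carrier = {p. Poly_Mapping.keys p \<subseteq> carrier (free_Abelian_group {..<\<mu>})},
      monoid.mult = (*), one = 1, zero = 0, add = (+)\<rparr>"

text \<open>The additive group of an integral group ring \<open>\<int>[H]\<close> consists of the elements of
  \<open>'h \<Rightarrow>\<^sub>0 int\<close> supported on \<open>H\<close>; the additive extension of a map of groups:\<close>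

definition group_ring_map :: "('g \<Rightarrow> 'h) \<Rightarrow> ('g \<Rightarrow>\<^sub>0 int) \<Rightarrow> ('h \<Rightarrow>\<^sub>0 int)" where
  "group_ring_map f = frag_extend (\<lambda>g. frag_of (f g))"

text \<open>Fox derivative, with values in the integral group ring of the free group, determined by
  \<open>\<partial>(uv) = \<partial>u + u \<partial>v\<close>; left multiplication by the letter \<open>a\<close> is \<open>group_ring_map (cancel_cons a)\<close>.\<close>

fun fox_letter :: "'x \<Rightarrow> 'x \<times> bool \<Rightarrow> ('x word \<Rightarrow>\<^sub>0 int)" where
  "fox_letter x (y, e) =
     (if y \<noteq> x then 0 else if e then frag_of [] else - frag_of [(x, False)])"

fun fox :: "'x \<Rightarrow> 'x word \<Rightarrow> ('x word \<Rightarrow>\<^sub>0 int)" where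
  "fox x [] = 0"
| "fox x (a # w) = fox_letter x a + group_ring_map (cancel_cons a) (fox x w)"

text \<open>The abelianization \<open>G \<rightarrow> G/G' \<rightarrow> \<int>\<^sup>\<mu>\<close> given by an isomorphism \<open>\<psi>\<close> from \<open>G/G'\<close>.\<close>

definition abelianization ::
    "('a, 'b) monoid_scheme \<Rightarrow> ('a set \<Rightarrow> (nat \<Rightarrow>\<^sub>0 int)) \<Rightarrow> 'a \<Rightarrow> (nat \<Rightarrow>\<^sub>0 int)" where
  "abelianization G \<psi> g = \<psi> (derived1 G #>\<^bsub>G\<^esub> g)"

definition alexander_matrix ::
    "('a, 'b) monoid_scheme \<Rightarrow> ('a set \<Rightarrow> (nat \<Rightarrow>\<^sub>0 int)) \<Rightarrow> nat \<Rightarrow> nat word list \<Rightarrow>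
       (nat word set \<Rightarrow> 'a) \<Rightarrow> laurent mat" where
  "alexander_matrix G \<psi> N rs \<theta> = mat (length rs) N
     (\<lambda>(i, j). group_ring_map
        (\<lambda>w. abelianization G \<psi> (\<theta> (word_class {..<N} (set rs) w))) (fox j (rs ! i)))"

text \<open>The index \<open>k\<close> is an integer because \<open>k = \<mu> - 1\<close> is negative when \<open>\<mu> = 0\<close>.
  For \<open>k < 0\<close> the matrix has too few columns to have a minor of size \<open>N - k\<close>, and the
  ideal is zero.\<close>

definition elementary_ideal ::
    "('a, 'b) monoid_scheme \<Rightarrow> nat \<Rightarrow> ('a set \<Rightarrow> (nat \<Rightarrow>\<^sub>0 int)) \<Rightarrow> nat \<Rightarrow> nat word list \<Rightarrow>
       (nat word set \<Rightarrow> 'a) \<Rightarrow> int \<Rightarrow> laurent set" where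
  "elementary_ideal G \<mu> \<psi> N rs \<theta> k =
     (if int N \<le> k then carrier (laurent_ring \<mu>)
      else Idl\<^bsub>laurent_ring \<mu>\<^esub>
        {Determinant.det (submatrix (alexander_matrix G \<psi> N rs \<theta>) I J) | I J.
           I \<subseteq> {..<length rs} \<and> J \<subseteq> {..<N} \<and>
           int (card I) = int N - k \<and> int (card J) = int N - k})"


section \<open>Virtual link diagrams\<close>

text \<open>Component \<open>i\<close> is a closed plane curve parametrized with period 1.
  A passage \<open>(i, t)\<close>, \<open>0 \<le> t < 1\<close>, is in \<open>unders\<close> when it is the lower passage through a
  classical crossing; double points neither of whose passages is in \<open>unders\<close> are
  the virtual crossings.\<close>

record virtual_diagram =
  ncomp :: nat
  curve :: "nat \<Rightarrow> real \<Rightarrow> complex"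
  unders :: "(nat \<times> real) set"

definition passages :: "virtual_diagram \<Rightarrow> (nat \<times> real) set" where
  "passages D = {(i, t). i < ncomp D \<and> 0 \<le> t \<and> t < 1}"

definition point :: "virtual_diagram \<Rightarrow> nat \<times> real \<Rightarrow> complex" where
  "point D p = curve D (fst p) (snd p)"

definition velocity :: "virtual_diagram \<Rightarrow> nat \<times> real \<Rightarrow> complex" where
  "velocity D p = vector_derivative (curve D (fst p)) (at (snd p))"

definition cross_at :: "virtual_diagram \<Rightarrow> nat \<times> real \<Rightarrow> nat \<times> real \<Rightarrow> bool" where
  "cross_at D p q \<longleftrightarrow>
     p \<in> passages D \<and> q \<in> passages D \<and> p \<noteq> q \<and> point D p = point D q"

text \<open>For plane vectors, \<open>Im (cnj v * w)\<close> is the determinant of the pair \<open>(v, w)\<close>.\<close>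

definition virtual_link_diagram :: "virtual_diagram \<Rightarrow> bool" where
  "virtual_link_diagram D \<longleftrightarrow>
     (\<forall>i<ncomp D. curve D i C1_differentiable_on UNIV \<and>
        (\<forall>t. curve D i (t + 1) = curve D i t \<and> vector_derivative (curve D i) (at t) \<noteq> 0)) \<and>
     finite {p. \<exists>q. cross_at D p q} \<and>
     (\<forall>p q r. cross_at D p q \<and> cross_at D p r \<longrightarrow> q = r) \<and>
     (\<forall>p q. cross_at D p q \<longrightarrow> Im (cnj (velocity D p) * velocity D q) \<noteq> 0) \<and>
     (\<forall>p\<in>unders D. \<exists>q. cross_at D p q \<and> q \<notin> unders D)"

definition over :: "virtual_diagram \<Rightarrow> nat \<times> real \<Rightarrow> nat \<times> real" where
  "over D p = (THE q. cross_at D p q)"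

text \<open>A crossing is positive when (over direction, under direction) is a positive basis.\<close>

definition crossing_sign :: "virtual_diagram \<Rightarrow> nat \<times> real \<Rightarrow> int" where
  "crossing_sign D p = (if Im (cnj (velocity D (over D p)) * velocity D p) > 0 then 1 else -1)"

definition under_times :: "virtual_diagram \<Rightarrow> nat \<Rightarrow> real set" where
  "under_times D i = {t. (i, t) \<in> unders D}"

definition n_under :: "virtual_diagram \<Rightarrow> nat \<Rightarrow> nat" where
  "n_under D i = card (under_times D i)"

definition undercrossing :: "virtual_diagram \<Rightarrow> nat \<Rightarrow> nat \<Rightarrow> nat \<times> real" where
  "undercrossing D i j = (i, sorted_list_of_set (under_times D i) ! j)"

text \<open>Arc \<open>(i, j)\<close> ends at \<open>undercrossing D i j\<close>; arc \<open>(i, 0)\<close> starts at the last undercrossing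
  of the component. A component without undercrossings is the single arc \<open>(i, 0)\<close>.\<close>

definition arcs :: "virtual_diagram \<Rightarrow> (nat \<times> nat) set" where
  "arcs D = {(i, j). i < ncomp D \<and> j < max 1 (n_under D i)}"

definition arc_of :: "virtual_diagram \<Rightarrow> nat \<times> real \<Rightarrow> nat \<times> nat" where
  "arc_of D p = (fst p, card {u \<in> under_times D (fst p). u < snd p} mod n_under D (fst p))"

definition over_letter :: "virtual_diagram \<Rightarrow> nat \<Rightarrow> nat \<Rightarrow> (nat \<times> nat) word" where
  "over_letter D i j =
     (let p = undercrossing D i j
      in gen (arc_of D (over D p)) [^]\<^bsub>free_group (arcs D)\<^esub> crossing_sign D p)"

definition link_relator :: "virtual_diagram \<Rightarrow> nat \<Rightarrow> nat \<Rightarrow> (nat \<times> nat) word" where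
  "link_relator D i j =
     (let F = free_group (arcs D); c = over_letter D i j
      in inv\<^bsub>F\<^esub> c \<otimes>\<^bsub>F\<^esub> gen (i, j) \<otimes>\<^bsub>F\<^esub> c \<otimes>\<^bsub>F\<^esub> inv\<^bsub>F\<^esub> gen (i, (j + 1) mod n_under D i))"

definition link_relators :: "virtual_diagram \<Rightarrow> (nat \<times> nat) word set" where
  "link_relators D = {link_relator D i j | i j. i < ncomp D \<and> j < n_under D i}"

definition link_group :: "virtual_diagram \<Rightarrow> (nat \<times> nat) word set monoid" where
  "link_group D = presented_group (arcs D) (link_relators D)"

definition exponent_sum :: "nat \<Rightarrow> (nat \<times> nat) word \<Rightarrow> int" where
  "exponent_sum i w = (\<Sum>(x, e)\<leftarrow>w. if fst x = i then (if e then 1 else -1) else 0)"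

text \<open>The longitude of component \<open>i\<close> when its meridian is the generator of the arc \<open>(i, b)\<close>.\<close>

definition longitude_word :: "virtual_diagram \<Rightarrow> nat \<Rightarrow> nat \<Rightarrow> (nat \<times> nat) word" where
  "longitude_word D i b =
     (let F = free_group (arcs D);
          w = foldr (\<lambda>r v. over_letter D i ((b + r) mod n_under D i) \<otimes>\<^bsub>F\<^esub> v) [0..<n_under D i] \<one>\<^bsub>F\<^esub>
      in w \<otimes>\<^bsub>F\<^esub> (gen (i, b) [^]\<^bsub>F\<^esub> (- exponent_sum i w)))"

definition longitude :: "virtual_diagram \<Rightarrow> nat \<Rightarrow> nat \<Rightarrow> (nat \<times> nat) word set" where
  "longitude D i b = word_class (arcs D) (link_relators D) (longitude_word D i b)"

end

theory Submission
  imports Defs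
begin

text \<open>Let \<open>\<Lambda>\<close> be the Laurent polynomial ring with augmentation ideal \<open>I\<close>. Fox derivatives represent the free
  group \<open>F = F(\<mu>)\<close> by crossed homomorphisms into \<open>\<Lambda>\<^sup>\<mu>\<close>, and a word lies in \<open>F\<^sub>q\<^sub>+\<^sub>1F''\<close> exactly when its
  derivatives lie in \<open>I\<^sup>q\<close>. In particular the Chen groups of \<open>F\<close> embed into some \<open>\<int>\<^sup>k\<close>, so they are Hopfian, and
  (2) says that the map \<open>F/F\<^sub>qF'' \<rightarrow> G/G\<^sub>qG''\<close> given by any lift of the generators of \<open>G/G'\<close> is injective for
  all \<open>q\<close>. Modulo \<open>I\<close> the Alexander matrix \<open>A\<close> presents \<open>\<int>\<^sup>\<mu>\<close>, so after inverting a determinant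
  \<open>\<delta> \<in> 1 + I\<close> there is only one candidate \<open>U/\<delta>\<close> for a matrix of crossed homomorphisms on \<open>G\<close> extending the Fox
  derivatives of \<open>F\<close>. It is one iff \<open>AU = 0\<close>, which is equivalent to the vanishing of the minors by a rank count;
  injectivity for \<open>q\<close> gives \<open>AU \<equiv> 0\<close> modulo \<open>I\<^sup>q\<^sup>-\<^sup>1\<close>, and \<open>\<Inter>I\<^sup>q = 0\<close>. For links, (3) yields by Milnor's argument
  an inverse of \<open>F/F\<^sub>qF'' \<rightarrow> G/G\<^sub>qG''\<close> inductively; conversely a longitude commutes with its meridian, and the
  Fox derivatives of the corresponding commutator in \<open>F\<close> push it ever deeper.\<close>

section \<open>The augmentation filtration of the Laurent polynomial ring\<close>

text \<open>The isomorphisms in (2) are abstract: they need not come from a homomorphism of groups,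
  nor fit together for different q. The Hopfian argument removes this obstacle one q at a time, by
  comparing each of them with the one map at hand. A second obstacle is that F \<rightarrow> G is
  onto only modulo each term of the series, so crossed homomorphisms on G have to be built on a
  presentation. There a matrix V of values on the generators descends to G iff AV = 0, and it
  restricts to the Fox derivatives of F iff CV = 1, where C consists of the derivatives of words for
  the lifts. An integral combination of these rows that is the identity modulo I turns both
  conditions into YV = \<alpha> with det Y = \<delta>, and U is the adjugate of Y times \<alpha>.
  Scaling by \<delta> instead of inverting it keeps everything in the domain \<Lambda>, and \<delta>
  can be cancelled in every power of I. For links, the step from q to q + 1 works because
  conjugators matter only modulo the q-th term when relations are read modulo the next one.\<close>

abbreviation lookup where "lookup \<equiv> Poly_Mapping.lookup"

abbreviation keys where "keys \<equiv> Poly_Mapping.keys"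

abbreviation tvar :: "nat \<Rightarrow> laurent" where
  "tvar i \<equiv> frag_of (frag_of i)"

lemma frag_of_mult: "frag_of a * frag_of b = (frag_of (a + b) :: 'a::comm_monoid_add \<Rightarrow>\<^sub>0 int)"
  by (simp add: mult_single)

lemma frag_of_zero: "frag_of (0::'a::comm_monoid_add) = 1"
  by (simp add: single_one)

lemma frag_cases [case_names zero one diff]:
  assumes "P 0" "\<And>x. P (frag_of x)" "\<And>a b. P a \<Longrightarrow> P b \<Longrightarrow> P (a - b)"
  shows "P (c :: 'a \<Rightarrow>\<^sub>0 int)"
  by (rule frag_induction[of c UNIV]) (use assms in auto)

text \<open>The coefficient of X^m in the power series (1 + X)^k, which for negative k has sign
  (-1)^m.\<close>

definition bin :: "nat \<Rightarrow> int \<Rightarrow> int" where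
  "bin m k = (if k \<ge> 0 then int (nat k choose m)
              else (-1) ^ m * int ((nat (- k) + m - 1) choose m))"

lemma bin_0 [simp]: "bin 0 k = 1"
  by (simp add: bin_def)

lemma bin_zero: "bin m 0 = (if m = 0 then 1 else 0)"
  by (simp add: bin_def)

text \<open>Pascal's rule, that is (1 + X)^(k+1) = (1 + X)^k + X(1 + X)^k. At k = -1 the two sides
  come from different branches of \<open>bin\<close>, hence the separate case.\<close>

lemma bin_Suc: "bin (Suc m) (k + 1) = bin (Suc m) k + bin m k"
proof -
  consider "k \<ge> 0" | "k = -1" | "k < -1" by linarith
  then show ?thesis
  proof cases
    case 1
    then have "nat (k + 1) = Suc (nat k)" by simp
    with 1 show ?thesis by (simp add: bin_def)
  next
    case 2
    then show ?thesis by (simp add: bin_def)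
  next
    case 3
    define n where "n = nat (- k) - 1"
    have k: "k = - int n - 1" "n \<ge> 1" using 3 by (auto simp: n_def)
    have "nat (- k) = Suc n" "nat (- (k + 1)) = n" using k by auto
    then have "bin (Suc m) (k + 1) = (-1) ^ Suc m * int ((n + m) choose Suc m)"
      "bin (Suc m) k = (-1) ^ Suc m * int ((n + Suc m) choose Suc m)"
      "bin m k = (-1) ^ m * int ((n + m) choose m)"
      using k unfolding bin_def by auto
    then show ?thesis by (simp add: algebra_simps)
  qed
qed

text \<open>The multiset m stands for the monomial X^m, and this is its coefficient in the expansion
  of t^v as a product of powers of the 1 + X_i.\<close>

definition mcoef :: "nat multiset \<Rightarrow> (nat \<Rightarrow>\<^sub>0 int) \<Rightarrow> int" where
  "mcoef m v = (\<Prod>i\<in>set_mset m. bin (count m i) (lookup v i))"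

lemma mcoef_superset:
  assumes "finite S" "set_mset m \<subseteq> S"
  shows "mcoef m v = (\<Prod>i\<in>S. bin (count m i) (lookup v i))"
  unfolding mcoef_def
  by (rule prod.mono_neutral_left) (use assms in \<open>auto simp: not_in_iff\<close>)

lemma mcoef_shift:
  "mcoef m (v + frag_of i) = mcoef m v + (if i \<in># m then mcoef (m - {#i#}) v else 0)"
proof (cases "i \<in># m")
  case False
  then have "mcoef m (v + frag_of i) = mcoef m v"
    unfolding mcoef_def by (intro prod.cong) (auto simp: lookup_add)
  with False show ?thesis by simp
next
  case True
  define S where "S = set_mset m - {i}"
  have S: "set_mset m = insert i S" "i \<notin> S" "finite S" using True by (auto simp: S_def)
  obtain c where c: "count m i = Suc c" using True by (metis count_eq_zero_iff not0_implies_Suc)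
  have *: "mcoef (m - {#i#}) v = (\<Prod>j\<in>insert i S. bin (count (m - {#i#}) j) (lookup v j))"
    by (rule mcoef_superset) (use S in \<open>auto simp flip: S(1) dest: in_diffD\<close>)
  have a: "(\<Prod>j\<in>S. bin (count m j) (lookup (v + frag_of i) j)) = (\<Prod>j\<in>S. bin (count m j) (lookup v j))"
    by (intro prod.cong) (use S in \<open>auto simp: lookup_add\<close>)
  have b: "(\<Prod>j\<in>S. bin (count (m - {#i#}) j) (lookup v j)) = (\<Prod>j\<in>S. bin (count m j) (lookup v j))"
    by (intro prod.cong) (use S in \<open>auto\<close>)
  have e: "bin (Suc c) (lookup v i + 1) = bin (Suc c) (lookup v i) + bin c (lookup v i)"
    by (rule bin_Suc)
  have 1: "mcoef m (v + frag_of i)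
      = bin (Suc c) (lookup v i + 1) * (\<Prod>j\<in>S. bin (count m j) (lookup v j))"
    unfolding mcoef_def S(1) prod.insert[OF S(3,2)] a c by (simp add: lookup_add)
  have 2: "mcoef m v = bin (Suc c) (lookup v i) * (\<Prod>j\<in>S. bin (count m j) (lookup v j))"
    unfolding mcoef_def S(1) prod.insert[OF S(3,2)] c ..
  have 3: "mcoef (m - {#i#}) v = bin c (lookup v i) * (\<Prod>j\<in>S. bin (count m j) (lookup v j))"
    unfolding * prod.insert[OF S(3,2)] b by (simp add: c)
  show ?thesis using True unfolding 1 2 3 e by (simp add: distrib_right)
qed

text \<open>Writing \<open>t\<^sub>i = 1 + X\<^sub>i\<close>, the functional \<open>Dm m\<close> reads off the coefficient of the
  monomial \<open>X\<^sup>m\<close>.\<close>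

definition Dm :: "nat multiset \<Rightarrow> laurent \<Rightarrow> int" where
  "Dm m f = (\<Sum>v\<in>keys f. lookup f v * mcoef m v)"

lemma Dm_superset:
  assumes "finite S" "keys f \<subseteq> S"
  shows "Dm m f = (\<Sum>v\<in>S. lookup f v * mcoef m v)"
  unfolding Dm_def
  by (rule sum.mono_neutral_left) (use assms in \<open>auto simp: in_keys_iff\<close>)

lemma Dm_0 [simp]: "Dm m 0 = 0"
  by (simp add: Dm_def)

lemma Dm_frag_of [simp]: "Dm m (frag_of v) = mcoef m v"
  by (simp add: Dm_def)

lemma Dm_add: "Dm m (f + g) = Dm m f + Dm m g"
proof -
  have "keys (f + g) \<subseteq> keys f \<union> keys g" by (rule keys_add)
  then show ?thesis
    by (simp add: Dm_superset[of "keys f \<union> keys g"] lookup_add algebra_simps sum.distrib)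
qed

lemma Dm_diff: "Dm m (f - g) = Dm m f - Dm m g"
  by (metis Dm_add add_diff_cancel diff_add_cancel)

lemma Dm_uminus: "Dm m (- f) = - Dm m f"
  using Dm_diff[of m 0 f] by simp

lemma Dm_sum: "Dm m (sum f A) = (\<Sum>a\<in>A. Dm m (f a))"
  by (induction A rule: infinite_finite_induct) (auto simp: Dm_add)

lemma Dm_tvar_mult:
  "Dm m (tvar i * f) = Dm m f + (if i \<in># m then Dm (m - {#i#}) f else 0)"
proof (induction f rule: frag_cases)
  case (one v)
  then show ?case by (simp add: frag_of_mult add.commute[of _ v] mcoef_shift)
qed (auto simp: Dm_diff algebra_simps)

lemma Dm_X_mult: "Dm (add_mset i m) ((tvar i - 1) * f) = Dm m f"
  using Dm_tvar_mult[of "add_mset i m" i f] by (simp add: algebra_simps Dm_diff)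

text \<open>This is the n-th power of the augmentation ideal. Describing it by vanishing Taylor
  coefficients at t = 1 rather than by products lets cancellation be proved coefficient by
  coefficient.\<close>

definition aug_fil :: "nat \<Rightarrow> laurent set" where
  "aug_fil n = {f. \<forall>m. size m < n \<longrightarrow> Dm m f = 0}"

lemma aug_fil_0 [simp]: "f \<in> aug_fil 0"
  by (simp add: aug_fil_def)

lemma zero_aug_fil [simp]: "0 \<in> aug_fil n"
  by (simp add: aug_fil_def)

lemma aug_fil_add: "f \<in> aug_fil n \<Longrightarrow> g \<in> aug_fil n \<Longrightarrow> f + g \<in> aug_fil n"
  by (simp add: aug_fil_def Dm_add)

lemma aug_fil_diff: "f \<in> aug_fil n \<Longrightarrow> g \<in> aug_fil n \<Longrightarrow> f - g \<in> aug_fil n"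
  by (simp add: aug_fil_def Dm_diff)

lemma aug_fil_uminus: "f \<in> aug_fil n \<Longrightarrow> - f \<in> aug_fil n"
  by (simp add: aug_fil_def Dm_uminus)

lemma aug_fil_sum: "(\<And>a. a \<in> A \<Longrightarrow> f a \<in> aug_fil n) \<Longrightarrow> sum f A \<in> aug_fil n"
  by (simp add: aug_fil_def Dm_sum)

lemma aug_fil_antimono: "f \<in> aug_fil n \<Longrightarrow> m \<le> n \<Longrightarrow> f \<in> aug_fil m"
  by (simp add: aug_fil_def)

lemma aug_fil_1_iff: "f \<in> aug_fil (Suc 0) \<longleftrightarrow> Dm {#} f = 0"
  by (simp add: aug_fil_def)

lemma aug_fil_tvar: "f \<in> aug_fil n \<Longrightarrow> tvar i * f \<in> aug_fil n"
  by (auto simp: aug_fil_def Dm_tvar_mult size_Diff_submset dest!: multi_member_split)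

text \<open>By induction on the degree: \<open>Dm_tvar_mult\<close> expresses \<open>Dm m f\<close>
  through a coefficient of the product and a coefficient of f of lower degree.\<close>

lemma aug_fil_tvar_cancel:
  assumes "tvar i * f \<in> aug_fil n" shows "f \<in> aug_fil n"
proof -
  have "size m < n \<Longrightarrow> Dm m f = 0" for m
  proof (induction "size m" arbitrary: m rule: less_induct)
    case less
    have "Dm m (tvar i * f) = 0" using assms less.prems by (simp add: aug_fil_def)
    moreover have "i \<in># m \<Longrightarrow> Dm (m - {#i#}) f = 0"
      by (rule less.hyps) (use less.prems in \<open>auto dest!: multi_member_split\<close>)
    ultimately show ?case by (auto simp: Dm_tvar_mult split: if_splits)
  qed
  then show ?thesis by (simp add: aug_fil_def)
qed

text \<open>Multiplication by \<open>X\<^sub>i\<close> merely shifts Taylor coefficients, so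
  division by it costs exactly one degree. Divided differences and the argument for longitudes both
  rest on this.\<close>

lemma aug_fil_X_cancel: "(tvar i - 1) * f \<in> aug_fil (Suc n) \<Longrightarrow> f \<in> aug_fil n"
  using Dm_X_mult[of i _ f] by (auto simp: aug_fil_def) (metis Suc_less_eq size_add_mset)

lemma aug_fil_X_mult: "f \<in> aug_fil n \<Longrightarrow> (tvar i - 1) * f \<in> aug_fil (Suc n)"
  by (auto simp: aug_fil_def Dm_diff Dm_tvar_mult left_diff_distrib dest!: multi_member_split)

lemma frag_of_mult_cancel: "frag_of (v + w) * f = frag_of v * (frag_of w * (f :: 'a::comm_monoid_add \<Rightarrow>\<^sub>0 int))"
  by (simp add: frag_of_mult mult.assoc[symmetric])

text \<open>The three claims are proved together since the induction over v passes through
  differences a - b: inverse monomials are needed, and t^(a-b) - 1 = t^(-b)((t^a - 1) - (t^b -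
  1)).\<close>

lemma aug_fil_frag_of_aux:
  "\<forall>n. \<forall>f\<in>aug_fil n. frag_of v * f \<in> aug_fil n \<and> frag_of (- v) * f \<in> aug_fil n \<and> (frag_of v - 1) * f \<in> aug_fil (Suc n)"
proof (induction v rule: frag_cases)
  case zero
  then show ?case by (simp add: frag_of_zero)
next
  case (one i)
  have "frag_of (- frag_of i) * f \<in> aug_fil n" if "f \<in> aug_fil n" for f n
    by (rule aug_fil_tvar_cancel[of i]) (use that in \<open>simp add: mult.assoc[symmetric] frag_of_mult frag_of_zero\<close>)
  then show ?case by (auto intro: aug_fil_tvar aug_fil_X_mult)
next
  case (diff a b)
  show ?case
  proof (intro allI ballI conjI)
    fix n f assume f: "f \<in> aug_fil n"
    have 1: "frag_of (a - b) * f = frag_of (- b) * (frag_of a * f)"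
      by (simp add: frag_of_mult_cancel[symmetric])
    show "frag_of (a - b) * f \<in> aug_fil n" unfolding 1 using diff f by blast
    have "frag_of (- (a - b)) = frag_of b * frag_of (- a)"
      by (simp add: frag_of_mult)
    then have 2: "frag_of (- (a - b)) * f = frag_of b * (frag_of (- a) * f)"
      by (simp only: mult.assoc)
    show "frag_of (- (a - b)) * f \<in> aug_fil n" unfolding 2 using diff f by blast
    have "frag_of (- b) * ((frag_of a - 1) * f) - frag_of (- b) * ((frag_of b - 1) * f)
        = (frag_of (- b) * frag_of a - frag_of (- b) * frag_of b) * f"
      by (simp add: algebra_simps)
    also have "\<dots> = (frag_of (a - b) - 1) * f"
      by (simp add: frag_of_mult frag_of_zero)
    finally show "(frag_of (a - b) - 1) * f \<in> aug_fil (Suc n)"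
      using diff f by (metis aug_fil_diff)
  qed
qed

lemma aug_fil_frag_of: "f \<in> aug_fil n \<Longrightarrow> frag_of v * f \<in> aug_fil n"
  using aug_fil_frag_of_aux by blast

lemma aug_fil_frag_of_diff: "f \<in> aug_fil n \<Longrightarrow> (frag_of v - 1) * f \<in> aug_fil (Suc n)"
  using aug_fil_frag_of_aux by blast

lemma aug_fil_mult: "f \<in> aug_fil n \<Longrightarrow> g * f \<in> aug_fil n"
  by (induction g rule: frag_cases) (auto simp: aug_fil_frag_of left_diff_distrib aug_fil_diff)

lemma aug_fil_aug: "f \<in> aug_fil n \<Longrightarrow> (g - of_int (Dm {#} g)) * f \<in> aug_fil (Suc n)"
proof (induction g rule: frag_cases)
  case (one x)
  then show ?case using aug_fil_frag_of_diff[of f n x] by (simp add: mcoef_def)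
next
  case (diff a b)
  have "(a - b - of_int (Dm {#} (a - b))) * f
      = (a - of_int (Dm {#} a)) * f - (b - of_int (Dm {#} b)) * f"
    by (simp add: Dm_diff algebra_simps)
  then show ?case using diff by (simp add: aug_fil_diff)
qed auto

lemma aug_fil_1_mult: "g \<in> aug_fil (Suc 0) \<Longrightarrow> f \<in> aug_fil n \<Longrightarrow> g * f \<in> aug_fil (Suc n)"
  using aug_fil_aug[of f n g] by (simp add: aug_fil_1_iff)

text \<open>\<delta> is a unit modulo every power of the augmentation ideal; writing f = \<delta>f -
  (\<delta> - 1)f gains one level at a time until level n.\<close>

lemma aug_fil_unit_cancel:
  assumes "\<delta> - 1 \<in> aug_fil (Suc 0)" "\<delta> * f \<in> aug_fil n"
  shows "f \<in> aug_fil n"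
proof -
  have "k \<le> n \<Longrightarrow> f \<in> aug_fil k" for k
  proof (induction k)
    case (Suc k)
    have "f = \<delta> * f - (\<delta> - 1) * f" by (simp add: algebra_simps)
    moreover have "\<delta> * f \<in> aug_fil (Suc k)" using assms Suc.prems by (blast intro: aug_fil_antimono)
    moreover have "(\<delta> - 1) * f \<in> aug_fil (Suc k)" using assms Suc by (auto intro: aug_fil_1_mult)
    ultimately show ?case by (metis aug_fil_diff)
  qed simp
  then show ?thesis by blast
qed

section \<open>Intersection of the powers of the augmentation ideal\<close>

lemma bin_eq_0: "0 \<le> k \<Longrightarrow> k < int m \<Longrightarrow> bin m k = 0"
  by (simp add: bin_def binomial_eq_0 nat_less_iff)

lemma bin_self: "0 \<le> k \<Longrightarrow> bin (nat k) k = 1"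
  by (simp add: bin_def)

text \<open>If \<open>f\<close> has no negative exponents and \<open>m\<close> is the exponent of a term of maximal degree, then
  \<open>Dm m f\<close> is the coefficient of this term.\<close>

lemma aug_fil_Inter_aux:
  assumes nn: "\<And>v i. v \<in> keys f \<Longrightarrow> lookup v i \<ge> 0" and f: "\<And>n. f \<in> aug_fil n"
  shows "f = 0"
proof (rule ccontr)
  assume "f \<noteq> 0"
  then have ne: "keys f \<noteq> {}" by simp
  define V where "V = (\<Union>v\<in>keys f. keys v)"
  have V: "finite V" by (simp add: V_def)
  define deg where "deg v = (\<Sum>i\<in>V. lookup v i)" for v :: "nat \<Rightarrow>\<^sub>0 int"
  obtain v where v: "v \<in> keys f" "\<And>w. w \<in> keys f \<Longrightarrow> deg w \<le> deg v"
    using Max_in[of "deg ` keys f"] Max_ge[of "deg ` keys f"] ne by (metis (no_types, lifting) finite_imageI finite_keys image_iff image_is_empty)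
  define m where "m = (\<Sum>i\<in>V. replicate_mset (nat (lookup v i)) i)"
  have cm: "count m i = nat (lookup v i)" for i
  proof -
    have "count m i = (\<Sum>j\<in>V. if j = i then nat (lookup v i) else 0)"
      unfolding m_def count_sum by (intro sum.cong) auto
    also have "\<dots> = nat (lookup v i)"
      using V v(1) by (auto simp: V_def in_keys_iff)
    finally show ?thesis .
  qed
  have mV: "set_mset m \<subseteq> V"
    using cm v(1) by (auto simp: V_def in_keys_iff count_greater_zero_iff[symmetric])
  have "lookup f w * mcoef m w = 0" if w: "w \<in> keys f" "w \<noteq> v" for w
  proof (rule ccontr)
    assume "lookup f w * mcoef m w \<noteq> 0"
    then have nz: "mcoef m w \<noteq> 0" by simp
    \<comment> \<open>A nonzero \<open>mcoef m w\<close> forces w to dominate v in every coordinate,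
      since \<open>bin\<close> vanishes when the exponent lies between 0 and the lower index; as the
      degree of v is maximal, this leaves only w = v.\<close>
    have ge: "lookup w i \<ge> lookup v i" if "i \<in> V" for i
    proof (rule ccontr)
      assume "\<not> lookup w i \<ge> lookup v i"
      then have "bin (count m i) (lookup w i) = 0"
        by (intro bin_eq_0) (use nn w v in \<open>auto simp: cm\<close>)
      then have "mcoef m w = 0"
        using V mV that by (auto simp: mcoef_superset[of V])
      with nz show False by simp
    qed
    moreover have "deg w \<le> deg v" by (rule v(2)) fact
    ultimately have "lookup w i = lookup v i" if "i \<in> V" for i
    proof -
      have "\<not> lookup v i < lookup w i"
        using sum_strict_mono_ex1[of V "lookup v" "lookup w"] ge V that \<open>deg w \<le> deg v\<close>
        unfolding deg_def by force
      with ge[OF that] show ?thesis by simp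
    qed
    moreover have "lookup w i = lookup v i" if "i \<notin> V" for i
      using that w(1) v(1) by (auto simp: V_def in_keys_iff)
    ultimately have "w = v" by (metis poly_mapping_eqI)
    with w show False by simp
  qed
  then have "(\<Sum>w\<in>keys f - {v}. lookup f w * mcoef m w) = 0"
    by (intro sum.neutral) blast
  then have "Dm m f = lookup f v * mcoef m v"
    using v(1) by (simp add: Dm_def sum.remove[of _ v])
  also have "mcoef m v = 1"
    unfolding mcoef_def using nn[OF v(1)] by (intro prod.neutral) (auto simp: cm bin_self)
  finally have "Dm m f \<noteq> 0" using v(1) by (simp add: in_keys_iff)
  then show False using f[of "Suc (size m)"] by (simp add: aug_fil_def)
qed

lemma lookup_frag_of_mult: "lookup (frag_of u * f) (v::nat \<Rightarrow>\<^sub>0 int) = lookup f (v - u)"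
  by (induction f rule: frag_cases) (auto simp: frag_of_mult algebra_simps lookup_minus)

text \<open>Multiplication by a monomial is invertible and preserves the filtration, so negative
  exponents can be shifted away first. The sum c of all absolute values of exponents is a crude
  bound for the shift.\<close>

lemma aug_fil_Inter:
  assumes "\<And>n. f \<in> aug_fil n"
  shows "f = 0"
proof -
  define V where "V = (\<Union>v\<in>keys f. keys v)"
  have V: "finite V" by (simp add: V_def)
  define c where "c = (\<Sum>v\<in>keys f. \<Sum>i\<in>V. \<bar>lookup v i\<bar>)"
  define u where "u = (\<Sum>i\<in>V. frag_cmul c (frag_of i))"
  have u: "lookup u i = (if i \<in> V then c else 0)" for i
  proof -
    have "lookup u i = (\<Sum>j\<in>V. if j = i then c else 0)"
      unfolding u_def lookup_sum by (intro sum.cong) auto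
    then show ?thesis using V by simp
  qed
  have "frag_of u * f = 0"
  proof (rule aug_fil_Inter_aux)
    fix v i assume "v \<in> keys (frag_of u * f)"
    then have vu: "v - u \<in> keys f" by (simp add: in_keys_iff lookup_frag_of_mult)
    show "0 \<le> lookup v i"
    proof (cases "i \<in> V")
      case True
      have "\<bar>lookup (v - u) i\<bar> \<le> (\<Sum>i\<in>V. \<bar>lookup (v - u) i\<bar>)"
        using V True by (intro member_le_sum) auto
      also have "\<dots> \<le> c" unfolding c_def
        by (rule member_le_sum) (use vu in \<open>auto intro: sum_nonneg\<close>)
      finally show ?thesis using True by (simp add: lookup_minus u)
    next
      case False
      then have "lookup (v - u) i = 0" using vu by (auto simp: V_def in_keys_iff)
      then show ?thesis using False by (simp add: lookup_minus u)
    qed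
  next
    show "frag_of u * f \<in> aug_fil n" for n using assms aug_fil_frag_of by blast
  qed
  then have "frag_of (- u) * (frag_of u * f) = 0" by simp
  then show ?thesis by (simp add: mult.assoc[symmetric] frag_of_mult frag_of_zero)
qed

section \<open>Truncation of exponents and divided differences\<close>

definition trunc :: "nat \<Rightarrow> (nat \<Rightarrow>\<^sub>0 int) \<Rightarrow> (nat \<Rightarrow>\<^sub>0 int)" where
  "trunc k v = (\<Sum>i<k. frag_cmul (lookup v i) (frag_of i))"

lemma lookup_trunc: "lookup (trunc k v) i = (if i < k then lookup v i else 0)"
proof -
  have "lookup (trunc k v) i = (\<Sum>j<k. if j = i then lookup v i else 0)"
    unfolding trunc_def lookup_sum by (intro sum.cong) auto
  then show ?thesis by simp
qed

lemma trunc_Suc: "trunc (Suc k) v = trunc k v + frag_cmul (lookup v k) (frag_of k)"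
  by (simp add: trunc_def add.commute)

lemma mcoef_trunc: "mcoef m (trunc k v) = (if set_mset m \<subseteq> {..<k} then mcoef m v else 0)"
proof (cases "set_mset m \<subseteq> {..<k}")
  case True
  then show ?thesis by (auto simp: mcoef_def lookup_trunc intro!: prod.cong)
next
  case False
  then obtain i where "i \<in># m" "\<not> i < k" by auto
  then show ?thesis using False
    by (auto simp: mcoef_def lookup_trunc bin_zero intro!: prod_zero bexI[of _ i])
qed

lemma group_ring_map_0 [simp]: "group_ring_map h 0 = 0"
  by (simp add: group_ring_map_def)

lemma group_ring_map_frag_of [simp]: "group_ring_map h (frag_of x) = frag_of (h x)"
  by (simp add: group_ring_map_def)

lemma group_ring_map_add: "group_ring_map h (a + b) = group_ring_map h a + group_ring_map h b"
  by (simp add: group_ring_map_def frag_extend_add)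

lemma group_ring_map_diff: "group_ring_map h (a - b) = group_ring_map h a - group_ring_map h b"
  by (simp add: group_ring_map_def frag_extend_diff)

lemma group_ring_map_uminus: "group_ring_map h (- a) = - group_ring_map h a"
  by (simp add: group_ring_map_def frag_extend_minus)

lemma Dm_trunc: "Dm m (group_ring_map (trunc k) f) = (if set_mset m \<subseteq> {..<k} then Dm m f else 0)"
  by (induction f rule: frag_cases) (auto simp: group_ring_map_diff Dm_diff mcoef_trunc)

lemma aug_fil_trunc: "f \<in> aug_fil n \<Longrightarrow> group_ring_map (trunc k) f \<in> aug_fil n"
  by (simp add: aug_fil_def Dm_trunc)

text \<open>The quotient \<open>(t\<^sub>k\<^sup>n - 1) / (t\<^sub>k - 1)\<close>, written out as a
  Laurent polynomial for either sign of n.\<close>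

definition geo :: "nat \<Rightarrow> int \<Rightarrow> laurent" where
  "geo k n = (if n \<ge> 0 then \<Sum>j<nat n. frag_of (frag_cmul (int j) (frag_of k))
              else - (\<Sum>j<nat (- n). frag_of (frag_cmul (n + int j) (frag_of k))))"

lemma frag_of_cmul_Suc: "tvar k * frag_of (frag_cmul n (frag_of k)) = frag_of (frag_cmul (n + 1) (frag_of k))"
  by (simp add: frag_of_mult frag_cmul_distrib add.commute)

lemma X_geo: "(tvar k - 1) * geo k n = frag_of (frag_cmul n (frag_of k)) - 1"
proof -
  define p where "p n = (frag_of (frag_cmul n (frag_of k)) :: laurent)" for n
  have p: "tvar k * p n = p (n + 1)" for n by (simp add: p_def frag_of_cmul_Suc)
  have p0: "p 0 = 1" by (simp add: p_def frag_of_zero)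
  have *: "(tvar k - 1) * (\<Sum>j<l. p (a + int j)) = p (a + int l) - p a" for a l
    by (induction l) (auto simp: algebra_simps p)
  show ?thesis
    using *[of 0 "nat n"] *[of n "nat (- n)"]
    by (auto simp: geo_def p_def[symmetric] p0)
qed

lemma tvar_neq_1: "tvar k - 1 \<noteq> 0"
proof
  assume "tvar k - 1 = 0"
  then have "tvar k = frag_of 0" by (simp add: frag_of_zero)
  then show False unfolding frag_of_eq by simp
qed

lemma geo_0 [simp]: "geo k 0 = 0"
  by (simp add: geo_def)

lemma geo_Suc: "geo k (n + 1) = tvar k * geo k n + 1"
proof -
  have "(tvar k - 1) * geo k (n + 1) = (tvar k - 1) * (tvar k * geo k n + 1)"
  proof -
    have "(tvar k - 1) * (tvar k * geo k n + 1) = tvar k * ((tvar k - 1) * geo k n) + (tvar k - 1)"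
      by (simp add: algebra_simps)
    then show ?thesis by (simp add: X_geo right_diff_distrib frag_of_cmul_Suc)
  qed
  then show ?thesis using tvar_neq_1 mult_left_cancel by blast
qed

text \<open>The difference between f truncated to k + 1 and to k variables, divided by
  \<open>X\<^sub>k\<close> (see \<open>X_Delta\<close>). Telescoping in
  \<open>trunc_eq_sum_Delta\<close> then makes explicit that I^(n+1) is the sum of the
  \<open>X\<^sub>k\<close> I^n.\<close>

definition Delta :: "nat \<Rightarrow> laurent \<Rightarrow> laurent" where
  "Delta k = frag_extend (\<lambda>v. frag_of (trunc k v) * geo k (lookup v k))"

lemma Delta_0 [simp]: "Delta k 0 = 0"
  by (simp add: Delta_def)

lemma Delta_frag_of: "Delta k (frag_of v) = frag_of (trunc k v) * geo k (lookup v k)"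
  by (simp add: Delta_def)

lemma Delta_diff: "Delta k (f - g) = Delta k f - Delta k g"
  by (simp add: Delta_def frag_extend_diff)

lemma X_Delta:
  "(tvar k - 1) * Delta k f = group_ring_map (trunc (Suc k)) f - group_ring_map (trunc k) f"
proof (induction f rule: frag_cases)
  case (one v)
  have "(tvar k - 1) * Delta k (frag_of v) = frag_of (trunc k v) * ((tvar k - 1) * geo k (lookup v k))"
    by (simp add: Delta_frag_of)
  also have "\<dots> = frag_of (trunc (Suc k) v) - frag_of (trunc k v)"
    by (simp add: X_geo right_diff_distrib frag_of_mult trunc_Suc)
  finally show ?case by simp
qed (auto simp: Delta_diff group_ring_map_diff right_diff_distrib)

lemma aug_fil_Delta: "f \<in> aug_fil (Suc n) \<Longrightarrow> Delta k f \<in> aug_fil n"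
  by (rule aug_fil_X_cancel[of k]) (simp add: X_Delta aug_fil_diff aug_fil_trunc)

lemma group_ring_map_trunc_0: "group_ring_map (trunc 0) f = of_int (Dm {#} f)"
  by (induction f rule: frag_cases)
    (auto simp: trunc_def frag_of_zero mcoef_def group_ring_map_diff Dm_diff)

lemma trunc_eq_sum_Delta:
  "group_ring_map (trunc n) f = of_int (Dm {#} f) + (\<Sum>k<n. (tvar k - 1) * Delta k f)"
  by (induction n) (auto simp: group_ring_map_trunc_0 X_Delta)

section \<open>Lower central series modulo the second derived subgroup\<close>

abbreviation lcs :: "('a, 'b) monoid_scheme \<Rightarrow> nat \<Rightarrow> 'a set" where
  "lcs \<equiv> lower_central_metab"

definition gcomm :: "('a, 'b) monoid_scheme \<Rightarrow> 'a \<Rightarrow> 'a \<Rightarrow> 'a" where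
  "gcomm G x y = x \<otimes>\<^bsub>G\<^esub> y \<otimes>\<^bsub>G\<^esub> inv\<^bsub>G\<^esub> x \<otimes>\<^bsub>G\<^esub> inv\<^bsub>G\<^esub> y"

lemma commutator_subgroup_gcomm:
  "commutator_subgroup G H K = generate G {gcomm G h k |h k. h \<in> H \<and> k \<in> K}"
  unfolding commutator_subgroup_def gcomm_def by (rule arg_cong[of _ _ "generate G"]) blast

lemma derived_gcomm:
  "derived G H = generate G {gcomm G h k |h k. h \<in> H \<and> k \<in> H}"
  unfolding derived_def gcomm_def by (rule arg_cong[of _ _ "generate G"]) blast

lemma (in group) l_cancel_inv: "x \<in> carrier G \<Longrightarrow> y \<in> carrier G \<Longrightarrow> x \<otimes> (inv x \<otimes> y) = y"
  by (simp add: m_assoc[symmetric])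

lemma (in group) l_cancel_inv': "x \<in> carrier G \<Longrightarrow> y \<in> carrier G \<Longrightarrow> inv x \<otimes> (x \<otimes> y) = y"
  by (simp add: m_assoc[symmetric])

lemmas (in group) group_nf = m_assoc inv_mult_group l_cancel_inv l_cancel_inv'

lemma (in group) gcomm_closed [simp]:
  "x \<in> carrier G \<Longrightarrow> y \<in> carrier G \<Longrightarrow> gcomm G x y \<in> carrier G"
  by (simp add: gcomm_def)

lemma (in group) gcomm_conj:
  assumes "g \<in> carrier G" "x \<in> carrier G" "y \<in> carrier G"
  shows "g \<otimes> gcomm G x y \<otimes> inv g = gcomm G (g \<otimes> x \<otimes> inv g) (g \<otimes> y \<otimes> inv g)"
  using assms by (simp add: gcomm_def group_nf)

lemma (in group) gcomm_eq_one_iff: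
  assumes "x \<in> carrier G" "y \<in> carrier G"
  shows "gcomm G x y = \<one> \<longleftrightarrow> x \<otimes> y = y \<otimes> x"
  using assms unfolding gcomm_def
  by (metis inv_mult_group inv_solve_right' l_one m_assoc m_closed one_closed r_inv inv_closed)

lemma (in group_hom) hom_gcomm:
  "x \<in> carrier G \<Longrightarrow> y \<in> carrier G \<Longrightarrow> h (gcomm G x y) = gcomm H (h x) (h y)"
  by (simp add: gcomm_def)

lemma lower_central_Suc:
  "n \<ge> 1 \<Longrightarrow> lower_central G (Suc n) = commutator_subgroup G (carrier G) (lower_central G n)"
  by (cases n) auto

lemma (in group) normal_gcomm_mem:
  assumes "K \<lhd> G" "g \<in> carrier G" "x \<in> K"
  shows "gcomm G g x \<in> K" "gcomm G x g \<in> K"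
proof -
  interpret K: normal K G by fact
  have x: "x \<in> carrier G" using assms by auto
  show "gcomm G g x \<in> K"
    unfolding gcomm_def using assms x by (simp add: K.inv_op_closed2)
  have "gcomm G x g = x \<otimes> (g \<otimes> inv x \<otimes> inv g)"
    using assms x by (simp add: gcomm_def group_nf)
  then show "gcomm G x g \<in> K"
    using assms x by (simp add: K.inv_op_closed2)
qed


lemma (in group) commutator_subgroup_normal:
  assumes "H \<lhd> G" "K \<lhd> G"
  shows "commutator_subgroup G H K \<lhd> G"
  unfolding commutator_subgroup_gcomm
proof (rule normal_generateI)
  interpret H: normal H G by fact
  interpret K: normal K G by fact
  show "{gcomm G h k |h k. h \<in> H \<and> k \<in> K} \<subseteq> carrier G" by auto
  fix c g assume "c \<in> {gcomm G h k |h k. h \<in> H \<and> k \<in> K}" and g: "g \<in> carrier G"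
  then obtain h k where "h \<in> H" "k \<in> K" "c = gcomm G h k" by blast
  then have "g \<otimes> c \<otimes> inv g = gcomm G (g \<otimes> h \<otimes> inv g) (g \<otimes> k \<otimes> inv g)"
    "g \<otimes> h \<otimes> inv g \<in> H" "g \<otimes> k \<otimes> inv g \<in> K"
    using g by (auto simp: gcomm_conj H.inv_op_closed2 K.inv_op_closed2)
  then show "g \<otimes> c \<otimes> inv g \<in> {gcomm G h k |h k. h \<in> H \<and> k \<in> K}" by blast
qed

lemma (in group) lower_central_normal: "lower_central G n \<lhd> G"
proof (induction n)
  case (Suc n)
  then show ?case by (cases n) (auto simp: normal_self commutator_subgroup_normal)
qed (simp add: normal_self)

lemma (in group) derived2_normal: "derived2 G \<lhd> G"
  by (intro derived_is_normal normal_self)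

lemma (in group) set_mult_normal:
  assumes "H \<lhd> G" "K \<lhd> G"
  shows "H <#> K \<lhd> G"
proof (rule normal_invI)
  interpret H: normal H G by fact
  interpret K: normal K G by fact
  have mult: "(h \<otimes> k) \<otimes> (h' \<otimes> k') \<in> H <#> K" if "h \<in> H" "k \<in> K" "h' \<in> H" "k' \<in> K" for h k h' k'
  proof -
    have "(h \<otimes> k) \<otimes> (h' \<otimes> k') = (h \<otimes> h') \<otimes> ((inv h' \<otimes> k \<otimes> h') \<otimes> k')"
      using that by (simp add: group_nf)
    moreover have "(inv h' \<otimes> k \<otimes> h') \<otimes> k' \<in> K" using that by (simp add: K.inv_op_closed1)
    moreover have "h \<otimes> h' \<in> H" using that by simp
    ultimately show ?thesis by (auto simp: set_mult_def)
  qed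
  show "subgroup (H <#> K) G"
  proof (rule subgroupI)
    show "H <#> K \<subseteq> carrier G" by (auto simp: set_mult_def)
    show "H <#> K \<noteq> {}" using H.one_closed K.one_closed unfolding set_mult_def by blast
    show "inv a \<in> H <#> K" if "a \<in> H <#> K" for a
    proof -
      obtain h k where a: "h \<in> H" "k \<in> K" "a = h \<otimes> k" using \<open>a \<in> H <#> K\<close> by (auto simp: set_mult_def)
      have "inv a = inv h \<otimes> (h \<otimes> inv k \<otimes> inv h)" using a by (simp add: group_nf)
      moreover have "h \<otimes> inv k \<otimes> inv h \<in> K" using a by (simp add: K.inv_op_closed2)
      moreover have "inv h \<in> H" using a by simp
      ultimately show ?thesis by (auto simp: set_mult_def)
    qed
    show "a \<otimes> b \<in> H <#> K" if "a \<in> H <#> K" "b \<in> H <#> K" for a b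
      using that mult by (fastforce simp: set_mult_def)
  qed
  fix x h assume x: "x \<in> carrier G" and "h \<in> H <#> K"
  then obtain a b where a: "a \<in> H" "b \<in> K" "h = a \<otimes> b" by (auto simp: set_mult_def)
  have "x \<otimes> h \<otimes> inv x = (x \<otimes> a \<otimes> inv x) \<otimes> (x \<otimes> b \<otimes> inv x)"
    using a x by (simp add: group_nf)
  moreover have "x \<otimes> a \<otimes> inv x \<in> H" "x \<otimes> b \<otimes> inv x \<in> K"
    using a x by (auto simp: H.inv_op_closed2 K.inv_op_closed2)
  ultimately show "x \<otimes> h \<otimes> inv x \<in> H <#> K" by (auto simp: set_mult_def)
qed

context group
begin

lemma lcs_normal: "lcs G n \<lhd> G"
  unfolding lower_central_metab_def
  by (intro set_mult_normal lower_central_normal derived2_normal)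

lemma lcs_subgroup: "subgroup (lcs G n) G"
  by (rule normal_imp_subgroup[OF lcs_normal])

lemma lcs_in_carrier: "x \<in> lcs G n \<Longrightarrow> x \<in> carrier G"
  using subgroup.mem_carrier[OF lcs_subgroup] .

lemma lower_central_in_lcs: "x \<in> lower_central G n \<Longrightarrow> x \<in> lcs G n"
proof -
  assume x: "x \<in> lower_central G n"
  then have "x = x \<otimes> \<one>" using subgroup.mem_carrier[OF normal_imp_subgroup[OF lower_central_normal]] by (metis r_one)
  with x show ?thesis
    using subgroup.one_closed[OF normal_imp_subgroup[OF derived2_normal]]
    unfolding lower_central_metab_def set_mult_def by blast
qed

lemma derived2_in_lcs: "x \<in> derived2 G \<Longrightarrow> x \<in> lcs G n"
proof -
  assume x: "x \<in> derived2 G"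
  then have "x = \<one> \<otimes> x" using subgroup.mem_carrier[OF normal_imp_subgroup[OF derived2_normal]] by (metis l_one)
  with x show ?thesis
    using subgroup.one_closed[OF normal_imp_subgroup[OF lower_central_normal]]
    unfolding lower_central_metab_def set_mult_def by blast
qed

lemma lcs_gcomm:
  assumes "n \<ge> 1" "g \<in> carrier G" "x \<in> lcs G n"
  shows "gcomm G g x \<in> lcs G (Suc n)"
proof -
  interpret N: normal "lcs G (Suc n)" G by (rule lcs_normal)
  interpret L: normal "lower_central G n" G by (rule lower_central_normal)
  interpret D: normal "derived2 G" G by (rule derived2_normal)
  obtain a b where ab: "a \<in> lower_central G n" "b \<in> derived2 G" "x = a \<otimes> b"
    using assms by (auto simp: lower_central_metab_def set_mult_def)
  have "gcomm G g x = gcomm G g a \<otimes> (a \<otimes> gcomm G g b \<otimes> inv a)"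
    using ab assms by (simp add: gcomm_def group_nf)
  moreover have "gcomm G g a \<in> lcs G (Suc n)"
    by (rule lower_central_in_lcs)
      (use assms ab in \<open>auto simp: lower_central_Suc commutator_subgroup_gcomm intro!: generate.incl\<close>)
  moreover have "a \<otimes> gcomm G g b \<otimes> inv a \<in> lcs G (Suc n)"
    using ab assms normal_gcomm_mem[OF derived2_normal, of g b]
    by (auto intro!: derived2_in_lcs D.inv_op_closed2)
  ultimately show ?thesis by simp
qed

text \<open>Upper bounds for the series are proved by induction through this minimality, without
  returning to products of subgroups: for images, for \<open>magnus\<close> and for the graded
  pieces.\<close>

lemma lcs_Suc_least:
  assumes "subgroup K G" "n \<ge> 1"
    and "\<And>g x. g \<in> carrier G \<Longrightarrow> x \<in> lcs G n \<Longrightarrow> gcomm G g x \<in> K"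
    and "derived2 G \<subseteq> K"
  shows "lcs G (Suc n) \<subseteq> K"
proof -
  have "lower_central G (Suc n) \<subseteq> K"
    unfolding lower_central_Suc[OF assms(2)] commutator_subgroup_gcomm
    by (rule generate_subgroup_incl) (use assms lower_central_in_lcs in auto)
  then show ?thesis
    using assms(4) subgroup.m_closed[OF assms(1)] unfolding lower_central_metab_def set_mult_def by blast
qed

lemma lcs_1: "lcs G (Suc 0) = carrier G"
  using lcs_in_carrier[of _ "Suc 0"] lower_central_in_lcs[of _ "Suc 0"] by auto

lemma derived2_subset: "derived2 G \<subseteq> derived1 G"
  by (rule derived_incl[OF subset_refl derived_is_subgroup[OF subset_refl]])

lemma lcs_2: "lcs G (Suc (Suc 0)) = derived1 G"
proof -
  have 1: "lower_central G (Suc (Suc 0)) = derived1 G"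
    by (simp add: commutator_subgroup_gcomm derived_gcomm)
  have "lcs G (Suc (Suc 0)) \<subseteq> derived1 G"
    unfolding lower_central_metab_def 1 set_mult_def
    using derived2_subset subgroup.m_closed[OF derived_is_subgroup[of "carrier G"]] by blast
  then show ?thesis using 1 lower_central_in_lcs[of _ "Suc (Suc 0)"] by auto
qed

lemma lcs_Suc_subset:
  assumes "n \<ge> 1" shows "lcs G (Suc n) \<subseteq> lcs G n"
  by (rule lcs_Suc_least)
    (use assms normal_gcomm_mem(1)[OF lcs_normal] derived2_in_lcs in \<open>auto intro: lcs_subgroup\<close>)

lemma lcs_antimono:
  assumes "1 \<le> m" "m \<le> n" shows "lcs G n \<subseteq> lcs G m"
  using assms(2)
proof (induction n rule: dec_induct)
  case (step n)
  then show ?case using assms(1) lcs_Suc_subset[of n] by auto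
qed simp

lemma lcs_subset_derived1:
  assumes "n \<ge> 2" shows "lcs G n \<subseteq> derived1 G"
  using lcs_antimono[of 2 n] assms lcs_2 by (simp add: numeral_2_eq_2)

lemma derived1_gcomm: "x \<in> carrier G \<Longrightarrow> y \<in> carrier G \<Longrightarrow> gcomm G x y \<in> derived1 G"
  by (auto simp: derived_gcomm intro!: generate.incl)

lemma derived2_gcomm: "x \<in> derived1 G \<Longrightarrow> y \<in> derived1 G \<Longrightarrow> gcomm G x y \<in> derived2 G"
  by (subst derived_gcomm) (auto intro!: generate.incl)

end

context group_hom
begin

lemma derived_mono_img:
  assumes "K \<subseteq> carrier G" "h ` K \<subseteq> L" shows "h ` derived G K \<subseteq> derived H L"
  using derived_img[OF assms(1)] H.mono_derived[OF assms(2)] by simp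

lemma derived2_img: "h ` derived2 G \<subseteq> derived2 H"
  by (intro derived_mono_img G.derived_in_carrier) auto

lemma vimage_subgroup:
  assumes "subgroup K H" shows "subgroup {x \<in> carrier G. h x \<in> K} G"
  using subgroup.one_closed[OF assms] subgroup.m_closed[OF assms] subgroup.m_inv_closed[OF assms]
  by (intro G.subgroupI) auto

lemma lcs_img:
  assumes "n \<ge> 1" "x \<in> lcs G n" shows "h x \<in> lcs H n"
proof -
  have "lcs G n \<subseteq> {x \<in> carrier G. h x \<in> lcs H n}"
    using assms(1)
  proof (induction n rule: dec_induct)
    case base
    then show ?case by (auto simp: G.lcs_1 H.lcs_1)
  next
    case (step n)
    show ?case
    proof (rule G.lcs_Suc_least)
      show "derived2 G \<subseteq> {x \<in> carrier G. h x \<in> lcs H (Suc n)}"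
        using derived2_img H.derived2_in_lcs normal_imp_subgroup[OF G.derived2_normal]
        by (auto dest: subgroup.mem_carrier)
    next
      fix g x assume "g \<in> carrier G" "x \<in> lcs G n"
      then have "x \<in> carrier G" "h x \<in> lcs H n" "h g \<in> carrier H"
        using step by auto
      then show "gcomm G g x \<in> {x \<in> carrier G. h x \<in> lcs H (Suc n)}"
        using step \<open>g \<in> carrier G\<close> by (simp add: hom_gcomm H.lcs_gcomm)
    qed (use step in \<open>auto intro!: vimage_subgroup H.lcs_subgroup\<close>)
  qed
  then show ?thesis using assms(2) by blast
qed

lemma lcs_img_surj:
  assumes "n \<ge> 1" "h ` carrier G = carrier H"
  shows "lcs H n \<subseteq> h ` lcs G n"
  using assms(1)
proof (induction n rule: dec_induct)
  case base
  then show ?case using assms by (auto simp: G.lcs_1 H.lcs_1)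
next
  case (step n)
  show ?case
  proof (rule H.lcs_Suc_least)
    show "subgroup (h ` lcs G (Suc n)) H"
      by (intro subgroup_img_is_subgroup G.lcs_subgroup)
  next
    have "derived2 H = derived H (h ` derived1 G)"
      using derived_img[of "carrier G"] assms by simp
    also have "\<dots> = h ` derived2 G" by (intro derived_img G.derived_in_carrier) simp
    finally show "derived2 H \<subseteq> h ` lcs G (Suc n)"
      using G.derived2_in_lcs by auto
  next
    fix g x assume "g \<in> carrier H" "x \<in> lcs H n"
    then obtain g' x' where "g' \<in> carrier G" "g = h g'" "x' \<in> lcs G n" "x = h x'"
      using step assms by blast
    then show "gcomm H g x \<in> h ` lcs G (Suc n)"
      using step G.lcs_in_carrier
      by (intro image_eqI[of _ _ "gcomm G g' x'"]) (auto simp: hom_gcomm intro!: G.lcs_gcomm)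
  qed (use step in auto)
qed

end

section \<open>Free groups\<close>

definition wletter :: "('a, 'b) monoid_scheme \<Rightarrow> ('x \<Rightarrow> 'a) \<Rightarrow> 'x \<times> bool \<Rightarrow> 'a" where
  "wletter G x a = (if snd a then x (fst a) else inv\<^bsub>G\<^esub> (x (fst a)))"

definition weval :: "('a, 'b) monoid_scheme \<Rightarrow> ('x \<Rightarrow> 'a) \<Rightarrow> 'x word \<Rightarrow> 'a" where
  "weval G x w = foldr (\<lambda>a g. wletter G x a \<otimes>\<^bsub>G\<^esub> g) w \<one>\<^bsub>G\<^esub>"

lemma weval_Nil [simp]: "weval G x [] = \<one>\<^bsub>G\<^esub>"
  by (simp add: weval_def)

lemma weval_Cons [simp]: "weval G x (a # w) = wletter G x a \<otimes>\<^bsub>G\<^esub> weval G x w"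
  by (simp add: weval_def)

lemma reduced_Nil [simp]: "reduced []"
  by (simp add: reduced_def)

lemma reduced_Cons:
  "reduced (a # w) \<longleftrightarrow> reduced w \<and> (w = [] \<or> \<not> (fst a = fst (hd w) \<and> snd a \<noteq> snd (hd w)))"
  by (cases w) (auto simp: reduced_def)

lemma reduced_cancel_cons: "reduced w \<Longrightarrow> reduced (cancel_cons a w)"
  by (cases w) (auto simp: reduced_Cons)

lemma reduced_foldr: "reduced w \<Longrightarrow> reduced (foldr cancel_cons u w)"
  by (induction u) (auto intro: reduced_cancel_cons)

lemma letters_cancel_cons: "set (cancel_cons a w) \<subseteq> insert a (set w)"
  by (cases w) auto

lemma letters_foldr: "set (foldr cancel_cons u w) \<subseteq> set u \<union> set w"
  by (induction u) (use letters_cancel_cons in fastforce)+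

lemma cancel_cons_reduced: "reduced (a # w) \<Longrightarrow> cancel_cons a w = a # w"
  by (cases w) (auto simp: reduced_Cons)

lemma cancel_cons_inverse: "reduced w \<Longrightarrow> cancel_cons (x, e) (cancel_cons (x, \<not> e) w) = w"
proof (cases w)
  case (Cons b w')
  assume "reduced w"
  then show ?thesis using Cons by (cases b; cases w') (auto simp: reduced_Cons)
qed simp

text \<open>Prefixing a letter with cancellation permutes the reduced words, with the inverse letter
  as inverse. Associativity follows from this action (van der Waerden's trick), without confluence
  of cancellation.\<close>

lemma foldr_cancel_cons:
  assumes "reduced w"
  shows "foldr cancel_cons (cancel_cons a v) w = cancel_cons a (foldr cancel_cons v w)"
proof (cases v)
  case (Cons b v')
  have r: "reduced (foldr cancel_cons v' w)" using assms by (rule reduced_foldr)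
  obtain x e y e' where "a = (x, e)" "b = (y, e')" by (cases a; cases b)
  then show ?thesis using Cons cancel_cons_inverse[OF r, of x e] by auto
qed simp

lemma foldr_cancel_assoc:
  "reduced w \<Longrightarrow> foldr cancel_cons (foldr cancel_cons u v) w = foldr cancel_cons u (foldr cancel_cons v w)"
  by (induction u) (auto simp: foldr_cancel_cons)

lemma carrier_free_group: "w \<in> carrier (free_group S) \<longleftrightarrow> fst ` set w \<subseteq> S \<and> reduced w"
  by (simp add: free_group_def)

lemma mult_free_group: "u \<otimes>\<^bsub>free_group S\<^esub> v = foldr cancel_cons u v"
  by (simp add: free_group_def)

lemma one_free_group: "\<one>\<^bsub>free_group S\<^esub> = []"
  by (simp add: free_group_def)

lemma group_free_group: "group (free_group S)"
proof (rule groupI)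
  have cl: "foldr cancel_cons u v \<in> carrier (free_group S)"
    if "fst ` set u \<subseteq> S" "v \<in> carrier (free_group S)" for u v
  proof -
    have "fst ` set (foldr cancel_cons u v) \<subseteq> fst ` set u \<union> fst ` set v"
      using letters_foldr[of u v] by blast
    then have "fst ` set (foldr cancel_cons u v) \<subseteq> S"
      using that unfolding carrier_free_group by blast
    then show ?thesis using that by (simp add: carrier_free_group reduced_foldr)
  qed
  show "u \<otimes>\<^bsub>free_group S\<^esub> v \<in> carrier (free_group S)"
    if "u \<in> carrier (free_group S)" "v \<in> carrier (free_group S)" for u v
    using that cl by (auto simp: mult_free_group carrier_free_group)
  fix w assume w: "w \<in> carrier (free_group S)"
  define u where "u = rev (map (\<lambda>a. (fst a, \<not> snd a)) w)"
  have u: "fst ` set u \<subseteq> S" using w by (auto simp: u_def carrier_free_group)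
  have *: "foldr cancel_cons (rev (map (\<lambda>a. (fst a, \<not> snd a)) w)) w = []" for w :: "'a word"
    by (induction w) auto
  have "foldr cancel_cons (foldr cancel_cons u []) w = []"
    using w * by (simp add: foldr_cancel_assoc carrier_free_group u_def)
  moreover have "foldr cancel_cons u [] \<in> carrier (free_group S)"
    by (rule cl[OF u]) (simp add: carrier_free_group)
  ultimately show "\<exists>v\<in>carrier (free_group S). v \<otimes>\<^bsub>free_group S\<^esub> w = \<one>\<^bsub>free_group S\<^esub>"
    by (auto simp: mult_free_group one_free_group)
qed (auto simp: one_free_group mult_free_group carrier_free_group foldr_cancel_assoc)

lemma gen_in_free_group [simp]: "gen x \<in> carrier (free_group S) \<longleftrightarrow> x \<in> S"
  by (simp add: gen_def carrier_free_group reduced_Cons)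

lemma inv_gen:
  assumes "x \<in> S" shows "inv\<^bsub>free_group S\<^esub> (gen x) = [(x, False)]"
proof -
  interpret F: group "free_group S" by (rule group_free_group)
  show ?thesis
    by (rule F.inv_equality)
      (use assms in \<open>auto simp: gen_def mult_free_group one_free_group carrier_free_group reduced_Cons\<close>)
qed

lemma wletter_gen:
  "fst a \<in> S \<Longrightarrow> wletter (free_group S) gen a = [a]"
  by (cases a) (auto simp: wletter_def inv_gen, simp add: gen_def)

lemma free_group_Cons:
  "(a # w) \<in> carrier (free_group S) \<Longrightarrow> a # w = [a] \<otimes>\<^bsub>free_group S\<^esub> w \<and> w \<in> carrier (free_group S) \<and> fst a \<in> S"
  by (auto simp: mult_free_group carrier_free_group cancel_cons_reduced) (simp add: reduced_Cons)

context group
begin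

lemma wletter_closed: "x (fst a) \<in> carrier G \<Longrightarrow> wletter G x a \<in> carrier G"
  by (simp add: wletter_def)

lemma weval_closed:
  "(\<And>y. y \<in> fst ` set w \<Longrightarrow> x y \<in> carrier G) \<Longrightarrow> weval G x w \<in> carrier G"
  by (induction w) (auto intro!: wletter_closed)

lemma weval_cong:
  "(\<And>y. y \<in> fst ` set w \<Longrightarrow> x y = x' y) \<Longrightarrow> weval G x w = weval G x' w"
  by (induction w) (auto simp: wletter_def)

lemma weval_append:
  assumes "\<And>y. y \<in> fst ` set (u @ v) \<Longrightarrow> x y \<in> carrier G"
  shows "weval G x (u @ v) = weval G x u \<otimes> weval G x v"
  using assms
proof (induction u)
  case Nil
  then show ?case by (simp add: weval_closed)
next
  case (Cons a u)
  then have "weval G x u \<in> carrier G" "weval G x v \<in> carrier G" "wletter G x a \<in> carrier G"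
    by (auto intro!: weval_closed wletter_closed)
  with Cons show ?case by (simp add: m_assoc)
qed

lemma weval_cancel_cons:
  assumes "x (fst a) \<in> carrier G" "\<And>y. y \<in> fst ` set w \<Longrightarrow> x y \<in> carrier G"
  shows "weval G x (cancel_cons a w) = wletter G x a \<otimes> weval G x w"
proof (cases w)
  case (Cons b w')
  then have "weval G x w' \<in> carrier G" "x (fst b) \<in> carrier G"
    using assms by (auto intro!: weval_closed)
  then show ?thesis using Cons by (auto simp: wletter_def l_cancel_inv l_cancel_inv')
qed simp

lemma weval_foldr:
  assumes "\<And>y. y \<in> fst ` set u \<union> fst ` set w \<Longrightarrow> x y \<in> carrier G"
  shows "weval G x (foldr cancel_cons u w) = weval G x u \<otimes> weval G x w"
  using assms
proof (induction u)
  case Nil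
  then show ?case by (simp add: weval_closed)
next
  case (Cons a u)
  have "fst ` set (foldr cancel_cons u w) \<subseteq> fst ` set u \<union> fst ` set w"
    using letters_foldr[of u w] by blast
  then have "weval G x (foldr cancel_cons (a # u) w) = wletter G x a \<otimes> weval G x (foldr cancel_cons u w)"
    using Cons.prems by (auto intro!: weval_cancel_cons)
  also have "weval G x (foldr cancel_cons u w) = weval G x u \<otimes> weval G x w"
    using Cons by auto
  also have "wletter G x a \<otimes> (weval G x u \<otimes> weval G x w) = weval G x (a # u) \<otimes> weval G x w"
    using Cons.prems by (simp add: m_assoc weval_closed wletter_closed)
  finally show ?case .
qed

lemma weval_hom:
  assumes "x \<in> S \<rightarrow> carrier G"
  shows "weval G x \<in> hom (free_group S) G"
proof (rule homI)
  show "weval G x w \<in> carrier G" if "w \<in> carrier (free_group S)" for w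
    using that assms by (intro weval_closed) (auto simp: carrier_free_group)
  show "weval G x (u \<otimes>\<^bsub>free_group S\<^esub> v) = weval G x u \<otimes> weval G x v"
    if "u \<in> carrier (free_group S)" "v \<in> carrier (free_group S)" for u v
    unfolding mult_free_group
    by (rule weval_foldr) (use that assms in \<open>auto simp: carrier_free_group\<close>)
qed

lemma weval_gen: "x y \<in> carrier G \<Longrightarrow> weval G x (gen y) = x y"
  by (simp add: gen_def wletter_def)

end

lemma (in group_hom) hom_weval:
  "(\<And>y. y \<in> fst ` set w \<Longrightarrow> x y \<in> carrier G) \<Longrightarrow> h (weval G x w) = weval H (h \<circ> x) w"
proof (induction w)
  case (Cons a w)
  then have "weval G x w \<in> carrier G" "x (fst a) \<in> carrier G"
    by (auto intro!: G.weval_closed)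
  then show ?case using Cons by (auto simp: wletter_def)
qed simp

lemma weval_free_group_gen:
  assumes "w \<in> carrier (free_group S)" shows "weval (free_group S) gen w = w"
  using assms
proof (induction w)
  case (Cons a w)
  have *: "a # w = [a] \<otimes>\<^bsub>free_group S\<^esub> w" "w \<in> carrier (free_group S)" "fst a \<in> S"
    using free_group_Cons[OF Cons.prems] by auto
  have "weval (free_group S) gen (a # w) = [a] \<otimes>\<^bsub>free_group S\<^esub> w"
    using Cons.IH[OF *(2)] *(3) by (simp add: wletter_gen)
  then show ?case using *(1) by simp
qed (simp add: one_free_group)

lemma hom_free_group_weval:
  assumes "h \<in> hom (free_group S) H" "group H" "w \<in> carrier (free_group S)"
  shows "h w = weval H (h \<circ> gen) w"
proof -
  interpret group_hom "free_group S" H h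
    by (intro group_hom.intro group_hom_axioms.intro assms group_free_group)
  have "h (weval (free_group S) gen w) = weval H (h \<circ> gen) w"
    by (rule hom_weval) (use assms(3) in \<open>auto simp: carrier_free_group[of w]\<close>)
  then show ?thesis using assms(3) by (simp add: weval_free_group_gen)
qed

section \<open>Fox derivatives and crossed homomorphisms\<close>

text \<open>A homomorphism into \<open>magnus\<close> lifting \<open>\<alpha>\<close> is a family of crossed homomorphisms over \<open>\<alpha>\<close>;
  this is the Magnus representation.\<close>

definition magnus :: "((nat \<Rightarrow>\<^sub>0 int) \<times> (nat \<Rightarrow> laurent)) monoid" where
  "magnus = \<lparr>carrier = UNIV,
     monoid.mult = (\<lambda>(v, f) (w, g). (v + w, \<lambda>i. f i + frag_of v * g i)), one = (0, \<lambda>_. 0)\<rparr>"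

lemma carrier_magnus [simp]: "carrier magnus = UNIV"
  by (simp add: magnus_def)

lemma mult_magnus [simp]: "(v, f) \<otimes>\<^bsub>magnus\<^esub> (w, g) = (v + w, \<lambda>i. f i + frag_of v * g i)"
  by (simp add: magnus_def)

lemma one_magnus [simp]: "\<one>\<^bsub>magnus\<^esub> = (0, \<lambda>_. 0)"
  by (simp add: magnus_def)

lemma magnus_l_inv: "(- v, \<lambda>i. - (frag_of (- v) * f i)) \<otimes>\<^bsub>magnus\<^esub> (v, f) = \<one>\<^bsub>magnus\<^esub>"
  by simp

lemma group_magnus: "group magnus"
proof (rule groupI)
  fix x show "\<exists>y\<in>carrier magnus. y \<otimes>\<^bsub>magnus\<^esub> x = \<one>\<^bsub>magnus\<^esub>"
    using magnus_l_inv[of "fst x" "snd x"] by (metis UNIV_I carrier_magnus prod.collapse)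
next
  fix x y z
  show "x \<otimes>\<^bsub>magnus\<^esub> y \<otimes>\<^bsub>magnus\<^esub> z = x \<otimes>\<^bsub>magnus\<^esub> (y \<otimes>\<^bsub>magnus\<^esub> z)"
    by (cases x; cases y; cases z) (auto simp: algebra_simps frag_of_mult mult.assoc[symmetric])
next
  fix x show "\<one>\<^bsub>magnus\<^esub> \<otimes>\<^bsub>magnus\<^esub> x = x" by (cases x) (simp add: frag_of_zero)
qed auto

interpretation T: group magnus by (rule group_magnus)

lemma inv_magnus: "inv\<^bsub>magnus\<^esub> (v, f) = (- v, \<lambda>i. - (frag_of (- v) * f i))"
  by (rule T.inv_equality[OF magnus_l_inv]) auto

text \<open>The exponents cancel and the coefficients 1 - t^w and t^v - 1 lie in the augmentation
  ideal: this is why commutators raise the filtration.\<close>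

lemma gcomm_magnus:
  "gcomm magnus (v, f) (w, g) = (0, \<lambda>i. (1 - frag_of w) * f i + (frag_of v - 1) * g i)"
proof -
  have 1: "frag_of (- v) * frag_of (v + w) = (frag_of w :: laurent)"
    by (simp add: frag_of_mult)
  have 2: "frag_of w * frag_of (- w) = (1 :: laurent)"
    by (simp add: frag_of_mult frag_of_zero)
  show ?thesis by (simp add: gcomm_def inv_magnus 1 2 algebra_simps)
qed

definition magnus_fil :: "nat \<Rightarrow> ((nat \<Rightarrow>\<^sub>0 int) \<times> (nat \<Rightarrow> laurent)) set" where
  "magnus_fil n = {(v, f). v = 0 \<and> (\<forall>i. f i \<in> aug_fil n)}"

lemma subgroup_magnus_fil: "subgroup (magnus_fil n) magnus"
proof (rule T.subgroupI)
  have "(0, \<lambda>_. 0) \<in> magnus_fil n" by (simp add: magnus_fil_def)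
  then show "magnus_fil n \<noteq> {}" by blast
qed (auto simp: magnus_fil_def inv_magnus frag_of_zero intro!: aug_fil_add aug_fil_uminus)

lemma Dm_empty_frag_of_mult: "Dm {#} (frag_of v * f) = Dm {#} f"
  by (induction f rule: frag_cases) (auto simp: frag_of_mult mcoef_def right_diff_distrib Dm_diff)

text \<open>Pairs with exponent 0 form an abelian normal subgroup containing all commutators, so the
  second derived subgroup is trivial; the commutator of (v, f) with such a pair (0, g) is (0, (t^v -
  1)g). The shift by one arises because it is the second term of the series that lies in I.\<close>

lemma lcs_magnus: "n \<ge> 1 \<Longrightarrow> lcs magnus (Suc n) \<subseteq> magnus_fil n"
proof (induction n rule: dec_induct)
  case base
  have "derived1 magnus \<subseteq> magnus_fil 1"
    unfolding derived_gcomm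
    by (rule T.generate_subgroup_incl[OF _ subgroup_magnus_fil])
      (auto simp: gcomm_magnus magnus_fil_def aug_fil_1_iff Dm_add Dm_diff Dm_empty_frag_of_mult left_diff_distrib)
  then show ?case by (simp add: T.lcs_2)
next
  case (step n)
  have 1: "derived1 magnus \<subseteq> magnus_fil 0"
  proof -
    have "derived1 magnus \<subseteq> magnus_fil 0"
      unfolding derived_gcomm
      by (rule T.generate_subgroup_incl[OF _ subgroup_magnus_fil]) (auto simp: gcomm_magnus magnus_fil_def)
    then show ?thesis .
  qed
  have "gcomm magnus h k = \<one>\<^bsub>magnus\<^esub>" if "h \<in> derived1 magnus" "k \<in> derived1 magnus" for h k
  proof -
    have "h \<in> magnus_fil 0" "k \<in> magnus_fil 0" using that 1 by blast+
    then show ?thesis by (cases h; cases k) (simp add: magnus_fil_def gcomm_magnus frag_of_zero)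
  qed
  then have "derived2 magnus \<subseteq> {\<one>\<^bsub>magnus\<^esub>}"
    unfolding derived_gcomm[of _ "derived1 magnus"]
    by (intro T.generate_subgroup_incl[OF _ T.triv_subgroup]) blast
  then have 2: "derived2 magnus \<subseteq> magnus_fil (Suc n)" by (auto simp: magnus_fil_def)
  show ?case
  proof (rule T.lcs_Suc_least[OF subgroup_magnus_fil _ _ 2])
    fix g x assume "x \<in> lcs magnus (Suc n)"
    then have "x \<in> magnus_fil n" using step by auto
    then show "gcomm magnus g x \<in> magnus_fil (Suc n)"
      by (cases g; cases x) (auto simp: magnus_fil_def gcomm_magnus frag_of_zero aug_fil_frag_of_diff)
  qed simp
qed

fun wsum :: "('x \<Rightarrow> (nat \<Rightarrow>\<^sub>0 int)) \<Rightarrow> 'x word \<Rightarrow> (nat \<Rightarrow>\<^sub>0 int)" where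
  "wsum \<alpha> [] = 0"
| "wsum \<alpha> ((y, e) # w) = (if e then \<alpha> y else - \<alpha> y) + wsum \<alpha> w"

text \<open>The Fox derivative already mapped to \<Lambda> by \<alpha>, for words that need not be
  reduced; \<open>group_ring_map_fox\<close> connects it with the derivative in the group ring of
  the free group.\<close>

fun dfox :: "('x \<Rightarrow> (nat \<Rightarrow>\<^sub>0 int)) \<Rightarrow> 'x \<Rightarrow> 'x word \<Rightarrow> laurent" where
  "dfox \<alpha> j [] = 0"
| "dfox \<alpha> j ((y, e) # w) =
     (if y \<noteq> j then 0 else if e then 1 else - frag_of (- \<alpha> y)) +
     frag_of (if e then \<alpha> y else - \<alpha> y) * dfox \<alpha> j w"

lemma wsum_append: "wsum \<alpha> (u @ v) = wsum \<alpha> u + wsum \<alpha> v"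
  by (induction \<alpha> u rule: wsum.induct) auto

lemma dfox_append: "dfox \<alpha> j (u @ v) = dfox \<alpha> j u + frag_of (wsum \<alpha> u) * dfox \<alpha> j v"
  by (induction \<alpha> j u rule: dfox.induct)
    (auto simp: frag_of_zero distrib_left mult.assoc[symmetric] frag_of_mult)

text \<open>Crossed homomorphisms are determined by their values on generators, and the coefficients
  are the Fox derivatives. Every chain rule below is an instance of this formula.\<close>

lemma weval_magnus:
  assumes "finite S" "fst ` set w \<subseteq> S"
  shows "weval magnus (\<lambda>y. (\<alpha> y, u y)) w = (wsum \<alpha> w, \<lambda>i. \<Sum>j\<in>S. dfox \<alpha> j w * u j i)"
  using assms(2)
proof (induction w)
  case (Cons a w)
  obtain y e where a: "a = (y, e)" by (cases a)
  define c :: laurent where "c = (if e then 1 else - frag_of (- \<alpha> y))"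
  define t :: laurent where "t = frag_of (if e then \<alpha> y else - \<alpha> y)"
  have y: "y \<in> S" using Cons.prems a by simp
  have "(\<Sum>j\<in>S. dfox \<alpha> j (a # w) * u j i)
      = (\<Sum>j\<in>S. if j = y then c * u j i else 0) + (\<Sum>j\<in>S. t * (dfox \<alpha> j w * u j i))" for i
    unfolding sum.distrib[symmetric]
    by (intro sum.cong) (auto simp: a c_def t_def algebra_simps)
  then have s: "(\<Sum>j\<in>S. dfox \<alpha> j (a # w) * u j i) = c * u y i + t * (\<Sum>j\<in>S. dfox \<alpha> j w * u j i)" for i
    using y assms(1) by (simp add: sum_distrib_left)
  have l: "wletter magnus (\<lambda>y. (\<alpha> y, u y)) a = (if e then \<alpha> y else - \<alpha> y, \<lambda>i. c * u y i)"
    by (auto simp: wletter_def a c_def inv_magnus)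
  have "weval magnus (\<lambda>y. (\<alpha> y, u y)) w = (wsum \<alpha> w, \<lambda>i. \<Sum>j\<in>S. dfox \<alpha> j w * u j i)"
    using Cons by simp
  then show ?case unfolding weval_Cons l s by (simp add: a t_def)
qed simp

lemma weval_magnus_1:
  assumes "fst ` set w \<subseteq> S" "finite S" "j \<in> S"
  shows "weval magnus (\<lambda>y. (\<alpha> y, \<lambda>i. if y = j then 1 else 0)) w = (wsum \<alpha> w, \<lambda>i. dfox \<alpha> j w)"
proof -
  have "(\<Sum>k\<in>S. dfox \<alpha> k w * (if k = j then 1 else 0)) = dfox \<alpha> j w"
    using assms by (simp add: if_distrib cong: if_cong)
  then show ?thesis using weval_magnus[OF assms(2,1), of \<alpha> "\<lambda>y i. if y = j then 1 else 0"] by simp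
qed

text \<open>The easy half of the detection theorem: the Magnus representation carries the series of
  the free group to that of \<open>magnus\<close>. The converse is
  \<open>mem_lcs_if_dfox\<close>.\<close>

lemma dfox_lcs:
  assumes "finite S" "j \<in> S" "n \<ge> 1" "w \<in> lcs (free_group S) (Suc n)"
  shows "dfox \<alpha> j w \<in> aug_fil n" "wsum \<alpha> w = 0"
proof -
  define x where "x = (\<lambda>y. (\<alpha> y, \<lambda>i::nat. if y = j then 1 else (0::laurent)))"
  interpret F: group "free_group S" by (rule group_free_group)
  interpret h: group_hom "free_group S" magnus "weval magnus x"
    by unfold_locales (simp add: T.weval_hom)
  have "weval magnus x w \<in> magnus_fil n"
    using h.lcs_img[OF _ assms(4)] lcs_magnus[OF assms(3)] by auto
  moreover have "fst ` set w \<subseteq> S"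
    using F.lcs_in_carrier[OF assms(4)] by (simp add: carrier_free_group)
  ultimately show "dfox \<alpha> j w \<in> aug_fil n" "wsum \<alpha> w = 0"
    using weval_magnus_1[of w S j \<alpha>] assms by (auto simp: x_def magnus_fil_def)
qed

text \<open>The augmentation of a Fox derivative counts the signed occurrences of a generator. It
  does not see \<beta>, so derivatives over any coefficient map will do.\<close>

lemma wsum_dfox:
  assumes "finite S" "fst ` set w \<subseteq> S"
  shows "wsum \<alpha> w = (\<Sum>j\<in>S. frag_cmul (Dm {#} (dfox \<beta> j w)) (\<alpha> j))"
  using assms(2)
proof (induction w)
  case (Cons a w)
  obtain y e where a: "a = (y, e)" by (cases a)
  have D1: "Dm {#} 1 = 1" using Dm_frag_of[of "{#}" 0] by (simp add: mcoef_def frag_of_zero)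
  have "(\<Sum>j\<in>S. frag_cmul (Dm {#} (dfox \<beta> j (a # w))) (\<alpha> j))
     = (\<Sum>j\<in>S. if j = y then frag_cmul (if e then 1 else -1) (\<alpha> j) else 0)
       + (\<Sum>j\<in>S. frag_cmul (Dm {#} (dfox \<beta> j w)) (\<alpha> j))"
    unfolding sum.distrib[symmetric]
    by (intro sum.cong)
      (auto simp: a Dm_add Dm_uminus Dm_empty_frag_of_mult mcoef_def D1 frag_cmul_distrib[symmetric])
  then show ?case using Cons assms(1) by (simp add: a)
qed simp

lemma lookup_wsum_frag_of:
  assumes "fst ` set w \<subseteq> S" "finite S" "j \<in> S"
  shows "lookup (wsum frag_of w) j = Dm {#} (dfox \<alpha> j w)"
proof -
  have "lookup (wsum frag_of w) j = (\<Sum>k\<in>S. if k = j then Dm {#} (dfox \<alpha> k w) else 0)"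
    unfolding wsum_dfox[OF assms(2,1), of _ \<alpha>] lookup_sum by (intro sum.cong) auto
  then show ?thesis using assms by simp
qed

section \<open>Fox derivatives detect the lower central series\<close>

text \<open>Stands for F/F'' with the images of the free generators. The derived subgroup
  \<open>B\<close> is abelian, and conjugation makes it a module over \<Lambda> in which
  \<open>X\<^sub>k\<close> acts as the commutator with \<open>x k\<close>.\<close>

locale metab = group M for M (structure) +
  fixes x :: "nat \<Rightarrow> 'a" and \<mu> :: nat
  assumes x [simp]: "x i \<in> carrier M"
    and derived2_trivial: "derived2 M = {\<one>}"
begin

abbreviation "B \<equiv> derived1 M"

abbreviation "N \<equiv> lcs M"

lemma B_normal: "B \<lhd> M"
  by (rule derived_self_is_normal)

lemma B_subgroup: "subgroup B M"
  by (rule normal_imp_subgroup[OF B_normal])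

lemma B_carrier [simp]: "b \<in> B \<Longrightarrow> b \<in> carrier M"
  by (rule subgroup.mem_carrier[OF B_subgroup])

lemma B_comm:
  assumes "a \<in> B" "b \<in> B" shows "a \<otimes> b = b \<otimes> a"
  using derived2_gcomm[OF assms] assms by (simp add: derived2_trivial gcomm_eq_one_iff)

lemma B_mult [simp]: "a \<in> B \<Longrightarrow> b \<in> B \<Longrightarrow> a \<otimes> b \<in> B"
  by (rule subgroup.m_closed[OF B_subgroup])

lemma B_inv [simp]: "a \<in> B \<Longrightarrow> inv a \<in> B"
  by (rule subgroup.m_inv_closed[OF B_subgroup])

lemma B_one [simp]: "\<one> \<in> B"
  by (rule subgroup.one_closed[OF B_subgroup])

definition cj :: "'a \<Rightarrow> 'a \<Rightarrow> 'a" where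
  "cj g b = g \<otimes> b \<otimes> inv g"

lemma cj_B [simp]: "g \<in> carrier M \<Longrightarrow> b \<in> B \<Longrightarrow> cj g b \<in> B"
  unfolding cj_def by (rule normal.inv_op_closed2[OF B_normal])

lemma cj_one [simp]: "b \<in> B \<Longrightarrow> cj \<one> b = b"
  by (simp add: cj_def)

lemma cj_mult: "g \<in> carrier M \<Longrightarrow> h \<in> carrier M \<Longrightarrow> b \<in> B \<Longrightarrow> cj (g \<otimes> h) b = cj g (cj h b)"
  by (simp add: cj_def group_nf)

text \<open>A commutator lies in the abelian group \<open>B\<close> and acts trivially on it, so the
  action on \<open>B\<close> factors through the abelianization.\<close>

lemma cj_comm:
  assumes "g \<in> carrier M" "h \<in> carrier M" "b \<in> B"
  shows "cj g (cj h b) = cj h (cj g b)"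
proof -
  have "cj (gcomm M g h) c = c" if "c \<in> B" for c
  proof -
    have "gcomm M g h \<otimes> c = c \<otimes> gcomm M g h" using that assms by (intro B_comm derived1_gcomm)
    then show ?thesis using that assms by (simp add: cj_def m_assoc)
  qed
  then have "cj h (cj g b) = cj (gcomm M g h) (cj h (cj g b))" using assms by simp
  also have "\<dots> = cj (gcomm M g h \<otimes> (h \<otimes> g)) b" using assms by (simp add: cj_mult)
  also have "gcomm M g h \<otimes> (h \<otimes> g) = g \<otimes> h" using assms by (simp add: gcomm_def group_nf)
  finally show ?thesis using assms by (simp add: cj_mult)
qed

lemma cj_distrib: "g \<in> carrier M \<Longrightarrow> a \<in> B \<Longrightarrow> b \<in> B \<Longrightarrow> cj g (a \<otimes> b) = cj g a \<otimes> cj g b"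
  by (simp add: cj_def group_nf)

lemma cj_inv: "g \<in> carrier M \<Longrightarrow> a \<in> B \<Longrightarrow> cj g (inv a) = inv (cj g a)"
  by (simp add: cj_def group_nf)

lemma comm_group_B: "comm_group (M\<lparr>carrier := B\<rparr>)"
  by (rule group.group_comm_groupI[OF subgroup.subgroup_is_group[OF B_subgroup is_group]])
    (simp add: B_comm)

text \<open>Linear extension to formal integral combinations, written multiplicatively. The
  homomorphism exists when the values of g lie in the abelian group \<open>B\<close>.\<close>

definition zext :: "('c \<Rightarrow> 'a) \<Rightarrow> ('c \<Rightarrow>\<^sub>0 int) \<Rightarrow> 'a" where
  "zext g = (SOME h. h \<in> hom (free_Abelian_group UNIV) (M\<lparr>carrier := B\<rparr>) \<and> (\<forall>c. h (frag_of c) = g c))"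

context
  fixes g :: "'c \<Rightarrow> 'a"
  assumes g: "\<And>c. g c \<in> B"
begin

lemma zext_ex: "zext g \<in> hom (free_Abelian_group UNIV) (M\<lparr>carrier := B\<rparr>) \<and> (\<forall>c. zext g (frag_of c) = g c)"
proof -
  interpret C: comm_group "M\<lparr>carrier := B\<rparr>" by (rule comm_group_B)
  obtain h where "h \<in> hom (free_Abelian_group UNIV) (M\<lparr>carrier := B\<rparr>)" "\<And>c. h (frag_of c) = g c"
    by (rule C.free_Abelian_group_universal[of g UNIV]) (use g in auto)
  then have "\<exists>h. h \<in> hom (free_Abelian_group UNIV) (M\<lparr>carrier := B\<rparr>) \<and> (\<forall>c. h (frag_of c) = g c)"
    by blast
  then show ?thesis unfolding zext_def by (rule someI_ex)
qed

lemma zext_frag_of [simp]: "zext g (frag_of c) = g c"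
  using zext_ex by blast

lemma zext_B [simp]: "zext g f \<in> B"
  using zext_ex by (auto simp: hom_def)

lemma zext_add: "zext g (f + f') = zext g f \<otimes> zext g f'"
  using zext_ex by (auto simp: hom_def)

lemma zext_0 [simp]: "zext g 0 = \<one>"
  using zext_add[of 0 0] zext_B[of 0] by (metis B_carrier add.right_neutral l_cancel_one')

lemma zext_uminus: "zext g (- f) = inv (zext g f)"
  using zext_add[of "- f" f] by (intro inv_equality[symmetric]) auto

lemma zext_diff: "zext g (f - f') = zext g f \<otimes> inv (zext g f')"
  using zext_add[of f "- f'"] by (simp add: zext_uminus)

lemma zext_sum_mem:
  assumes "subgroup K M" "\<And>a. a \<in> A \<Longrightarrow> zext g (F a) \<in> K"
  shows "zext g (sum F A) \<in> K"
  using assms(2)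
  by (induction A rule: infinite_finite_induct)
    (auto simp: zext_add subgroup.one_closed[OF assms(1)] subgroup.m_closed[OF assms(1)])

end

lemma B_swap: "a \<in> B \<Longrightarrow> b \<in> B \<Longrightarrow> c \<in> B \<Longrightarrow> d \<in> B \<Longrightarrow> (a \<otimes> b) \<otimes> (c \<otimes> d) = (a \<otimes> c) \<otimes> (b \<otimes> d)"
  using B_comm[of b c] by (metis B_carrier m_assoc m_closed)

lemma zext_mult:
  assumes "\<And>c. g c \<in> B" "\<And>c. h c \<in> B"
  shows "zext (\<lambda>c. g c \<otimes> h c) f = zext g f \<otimes> zext h f"
proof (induction f rule: frag_cases)
  case (diff a b)
  have "inv (zext g b \<otimes> zext h b) = inv (zext g b) \<otimes> inv (zext h b)"
    using assms B_comm[of "inv (zext g b)" "inv (zext h b)"] by (simp add: inv_mult_group)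
  then show ?case using assms diff by (simp add: zext_diff B_swap)
qed (use assms in auto)

text \<open>The ordered product of the powers of the \<open>x i\<close> with exponents v: a way to
  lift exponent vectors to M. It is no homomorphism, but by \<open>cj_P_add\<close> its action on
  \<open>B\<close> is.\<close>

primrec P :: "nat \<Rightarrow> (nat \<Rightarrow>\<^sub>0 int) \<Rightarrow> 'a" where
  "P 0 v = \<one>"
| "P (Suc k) v = P k v \<otimes> x k [^] lookup v k"

lemma P_carrier [simp]: "P k v \<in> carrier M"
  by (induction k) auto

lemma P_zero [simp]: "P k 0 = \<one>"
  by (induction k) auto

lemma P_cong: "(\<And>i. i < k \<Longrightarrow> lookup v i = lookup w i) \<Longrightarrow> P k v = P k w"
  by (induction k) auto

lemma P_frag_of: "P k (frag_of i) = (if i < k then x i else \<one>)"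
  by (induction k) (auto simp: less_Suc_eq)

lemma P_trunc: "k \<le> n \<Longrightarrow> P n (trunc k v) = P k v"
proof (induction n rule: dec_induct)
  case base
  show ?case by (rule P_cong) (simp add: lookup_trunc)
next
  case (step n)
  then show ?case by (simp add: lookup_trunc)
qed

lemma cj_P_add:
  assumes "b \<in> B" shows "cj (P k (v + w)) b = cj (P k v) (cj (P k w) b)"
  using assms
proof (induction k arbitrary: b)
  case (Suc k)
  let ?a = "x k [^] lookup v k" and ?c = "x k [^] lookup w k"
  have "cj (P (Suc k) (v + w)) b = cj (P k v) (cj (P k w) (cj ?a (cj ?c b)))"
    using Suc by (simp add: lookup_add int_pow_mult cj_mult)
  also have "\<dots> = cj (P k v) (cj ?a (cj (P k w) (cj ?c b)))"
    using Suc.prems by (simp add: cj_comm[of "P k w" ?a])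
  finally show ?case using Suc.prems by (simp add: cj_mult)
qed simp

text \<open>The module structure: this is f applied to b, where a monomial acts through conjugation
  by its lift \<open>P \<mu> v\<close>.\<close>

definition act :: "'a \<Rightarrow> laurent \<Rightarrow> 'a" where
  "act b = zext (\<lambda>v. cj (P \<mu> v) b)"

context
  fixes b assumes b: "b \<in> B"
begin

lemma act_frag_of: "act b (frag_of v) = cj (P \<mu> v) b"
  using b by (simp add: act_def)

lemma act_B [simp]: "act b f \<in> B"
  using b by (simp add: act_def)

lemma act_0 [simp]: "act b 0 = \<one>"
  using b by (simp add: act_def)

lemma act_diff: "act b (f - f') = act b f \<otimes> inv (act b f')"
  using b by (simp add: act_def zext_diff)

lemma act_add: "act b (f + f') = act b f \<otimes> act b f'"
  using b by (simp add: act_def zext_add)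

lemma act_frag_of_mult: "act b (frag_of v * f) = cj (P \<mu> v) (act b f)"
proof (induction f rule: frag_cases)
  case zero
  then show ?case by (simp add: cj_def)
next
  case (one w)
  then show ?case using b by (simp add: frag_of_mult act_frag_of cj_P_add)
next
  case (diff f g)
  then show ?case by (simp add: right_diff_distrib act_diff cj_distrib cj_inv)
qed

lemma act_X:
  assumes "k < \<mu>" shows "act b ((tvar k - 1) * f) = gcomm M (x k) (act b f)"
proof -
  have "act b ((tvar k - 1) * f) = cj (P \<mu> (frag_of k)) (act b f) \<otimes> inv (act b f)"
    by (simp add: left_diff_distrib act_diff act_frag_of_mult)
  then show ?thesis using assms by (simp add: P_frag_of cj_def gcomm_def)
qed

lemma act_trunc: "act b (group_ring_map (trunc \<mu>) f) = act b f"
  by (induction f rule: frag_cases)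
    (auto simp: act_frag_of P_trunc group_ring_map_diff act_diff)

text \<open>For f of augmentation 0 the telescoped form is a sum of
  \<open>X\<^sub>k Delta k f\<close>, and \<open>X\<^sub>k\<close> acts as the commutator with
  \<open>x k\<close>, which moves one step down the series. The offset 2 is due to \<open>B\<close>
  being the second term.\<close>

lemma act_J: "f \<in> aug_fil n \<Longrightarrow> act b f \<in> N (Suc (Suc n))"
proof (induction n arbitrary: f)
  case 0
  then show ?case by (simp add: lcs_2)
next
  case (Suc n)
  have "Dm {#} f = 0" using Suc.prems by (simp add: aug_fil_def)
  then have "act b f = act b (\<Sum>k<\<mu>. (tvar k - 1) * Delta k f)"
    using act_trunc[of f] by (simp add: trunc_eq_sum_Delta)
  also have "\<dots> \<in> N (Suc (Suc (Suc n)))"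
    unfolding act_def
  proof (rule zext_sum_mem)
    show "cj (P \<mu> v) b \<in> B" for v using b by simp
    show "subgroup (N (Suc (Suc (Suc n)))) M" by (rule lcs_subgroup)
    fix k assume "k \<in> {..<\<mu>}"
    then have "act b ((tvar k - 1) * Delta k f) = gcomm M (x k) (act b (Delta k f))"
      by (simp add: act_X)
    also have "\<dots> \<in> N (Suc (Suc (Suc n)))"
      using Suc by (intro lcs_gcomm) (auto intro: aug_fil_Delta)
    finally show "zext (\<lambda>v. cj (P \<mu> v) b) ((tvar k - 1) * Delta k f) \<in> N (Suc (Suc (Suc n)))"
      by (simp add: act_def)
  qed
  finally show ?case .
qed

end

lemma gcomm_B [simp]: "a \<in> carrier M \<Longrightarrow> b \<in> carrier M \<Longrightarrow> gcomm M a b \<in> B"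
  by (rule derived1_gcomm)

text \<open>Both sides agree at n = 0 and satisfy the same recursion: conjugate by
  \<open>x k\<close>, then multiply by the basic commutator. Downwards it is inverted because
  conjugation is injective.\<close>

lemma gcomm_pow:
  assumes "k < \<mu>" shows "gcomm M (x k [^] (n::int)) (x i) = act (gcomm M (x k) (x i)) (geo k n)"
proof -
  let ?b = "gcomm M (x k) (x i)"
  define E where "E n = gcomm M (x k [^] (n::int)) (x i)" for n
  have EB: "E n \<in> B" for n by (simp add: E_def)
  have E: "E (n + 1) = cj (x k) (E n) \<otimes> ?b" for n
    using int_pow_mult[of "x k" 1 n]
    by (simp add: E_def cj_def gcomm_def group_nf add.commute)
  have A: "act ?b (geo k (n + 1)) = cj (x k) (act ?b (geo k n)) \<otimes> ?b" for n
  proof -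
    have "act ?b 1 = ?b" using act_frag_of[of ?b 0] by (simp add: frag_of_zero)
    then show ?thesis
      using assms by (simp add: geo_Suc act_add act_frag_of_mult P_frag_of)
  qed
  have "E n = act ?b (geo k n)"
  proof (induction n rule: int_induct[of _ 0])
    case base
    have "gcomm M \<one> (x i) = \<one>" by (simp add: gcomm_def)
    then show ?case by (simp add: E_def)
  next
    case (step1 i)
    then show ?case using E A by simp
  next
    case (step2 n)
    have "cj (x k) (E (n - 1)) \<otimes> ?b = cj (x k) (act ?b (geo k (n - 1))) \<otimes> ?b"
      using step2 E[of "n - 1"] A[of "n - 1"] by simp
    then have "cj (x k) (E (n - 1)) = cj (x k) (act ?b (geo k (n - 1)))"
      using EB by simp
    then show ?case using EB[of "n - 1"] unfolding cj_def by simp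
  qed
  then show ?thesis by (simp add: E_def)
qed

text \<open>\<open>loop \<mu> i v\<close> runs in the Cayley graph of \<open>\<int>\<^sup>\<mu>\<close> from \<open>0\<close> to \<open>v\<close> along the axes in order, crosses the edge
  from \<open>v\<close> to \<open>v + e\<^sub>i\<close> and returns in the same way. Schreier rewriting (\<open>weval_loops\<close>) expresses a word by
  these loops, and the exponents are the coefficients of its Fox derivatives. By \<open>loop_Suc\<close> the loops
  are combinations of basic commutators with divided differences as coefficients, and dividing by
  \<open>X\<^sub>k\<close> lowers the filtration by one only.\<close>

definition loop :: "nat \<Rightarrow> nat \<Rightarrow> (nat \<Rightarrow>\<^sub>0 int) \<Rightarrow> 'a" where
  "loop k i v = P k v \<otimes> x i \<otimes> inv (P k (v + frag_of i))"

lemma loop_Suc_self: "loop (Suc i) i v = \<one>"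
proof -
  have "P i (v + frag_of i) = P i v" by (rule P_cong) (simp add: lookup_add)
  then show ?thesis by (simp add: loop_def lookup_add int_pow_mult group_nf)
qed

lemma loop_Suc:
  assumes "i < k" "k < \<mu>"
  shows "loop (Suc k) i v = act (gcomm M (x k) (x i)) (Delta k (frag_of v)) \<otimes> loop k i v"
proof -
  have "act (gcomm M (x k) (x i)) (Delta k (frag_of v)) = cj (P k v) (gcomm M (x k [^] lookup v k) (x i))"
    using assms by (simp add: Delta_frag_of act_frag_of_mult P_trunc gcomm_pow)
  then show ?thesis using assms
    by (simp add: loop_def lookup_add cj_def gcomm_def group_nf)
qed

lemma loop_B:
  assumes "i < k" "k \<le> \<mu>" shows "loop k i v \<in> B"
  using assms(1,2)
proof (induction k)
  case (Suc k)
  show ?case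
  proof (cases "i = k")
    case True
    then show ?thesis by (simp add: loop_Suc_self)
  next
    case False
    then show ?thesis using Suc by (simp add: loop_Suc)
  qed
qed simp

lemma zext_act_Delta:
  assumes "b \<in> B" shows "zext (\<lambda>v. act b (Delta k (frag_of v))) f = act b (Delta k f)"
  using assms by (induction f rule: frag_cases) (auto simp: zext_diff Delta_diff act_diff)

text \<open>Coordinates above i are peeled off one at a time by \<open>loop_Suc\<close>, until at
  coordinate i the loops become trivial. \<open>Delta\<close> loses one power of I, and
  \<open>act_J\<close> turns the remaining I^q into the term of index q + 2.\<close>

lemma zext_loop_J:
  assumes "i < k" "k \<le> \<mu>" "f \<in> aug_fil (Suc q)"
  shows "zext (loop k i) f \<in> N (Suc (Suc q))"
  using assms(1,2)
proof (induction k)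
  case (Suc k)
  show ?case
  proof (cases "i = k")
    case True
    have "zext (loop (Suc i) i) f = \<one>"
      by (induction f rule: frag_cases) (auto simp: loop_Suc_self zext_diff)
    then show ?thesis using True subgroup.one_closed[OF lcs_subgroup] by simp
  next
    case False
    then have ik: "i < k" "k < \<mu>" using Suc by auto
    have "loop (Suc k) i = (\<lambda>v. act (gcomm M (x k) (x i)) (Delta k (frag_of v)) \<otimes> loop k i v)"
      using ik by (simp add: loop_Suc fun_eq_iff)
    then have "zext (loop (Suc k) i) f = act (gcomm M (x k) (x i)) (Delta k f) \<otimes> zext (loop k i) f"
      using ik by (simp add: zext_mult zext_act_Delta loop_B)
    moreover have "zext (loop k i) f \<in> N (Suc (Suc q))" using Suc ik by simp
    moreover have "act (gcomm M (x k) (x i)) (Delta k f) \<in> N (Suc (Suc q))"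
      by (intro act_J aug_fil_Delta assms) simp
    ultimately show ?thesis using subgroup.m_closed[OF lcs_subgroup] by simp
  qed
qed simp

primrec ZL :: "nat \<Rightarrow> (nat \<Rightarrow> laurent) \<Rightarrow> 'a" where
  "ZL 0 d = \<one>"
| "ZL (Suc m) d = ZL m d \<otimes> zext (loop \<mu> m) (d m)"

lemma ZL_B [simp]: "m \<le> \<mu> \<Longrightarrow> ZL m d \<in> B"
  by (induction m) (auto simp: loop_B)

lemma ZL_upd:
  "m \<le> \<mu> \<Longrightarrow> ZL m (\<lambda>i. d i + (if j = i then c else 0)) = ZL m d \<otimes> (if j < m then zext (loop \<mu> j) c else \<one>)"
proof (induction m)
  case (Suc m)
  have B: "ZL m d \<in> B" "zext (loop \<mu> m) f \<in> B" for f using Suc.prems by (auto simp: loop_B)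
  show ?case
  proof (cases "j < m")
    case True
    then have "zext (loop \<mu> j) c \<in> B" using Suc.prems by (simp add: loop_B)
    then show ?thesis using True Suc B B_comm[of "zext (loop \<mu> j) c" "zext (loop \<mu> m) (d m)"]
      by (simp add: m_assoc)
  next
    case False
    then show ?thesis using Suc B by (auto simp: zext_add loop_B m_assoc less_Suc_eq)
  qed
qed simp

lemma weval_loops:
  assumes "fst ` set w \<subseteq> {..<\<mu>}"
  shows "weval M x w = ZL \<mu> (\<lambda>j. dfox frag_of j w) \<otimes> P \<mu> (wsum frag_of w)"
  using assms
proof (induction w rule: rev_induct)
  case Nil
  have "m \<le> \<mu> \<Longrightarrow> ZL m (\<lambda>_. 0) = \<one>" for m by (induction m) (auto simp: loop_B)
  then show ?case by simp
next
  case (snoc a w)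
  obtain i e where a: "a = (i, e)" by (cases a)
  have i: "i < \<mu>" using snoc.prems a by simp
  let ?v = "wsum frag_of w"
  let ?d = "\<lambda>j. dfox frag_of j w"
  have IH: "weval M x w = ZL \<mu> ?d \<otimes> P \<mu> ?v" using snoc by simp
  have ev: "weval M x (w @ [a]) = weval M x w \<otimes> weval M x [a]"
    by (rule weval_append) simp
  have Zc: "ZL \<mu> ?d \<in> carrier M" by simp
  show ?case
  proof (cases e)
    case True
    have "(\<lambda>j. dfox frag_of j (w @ [a])) = (\<lambda>j. ?d j + (if i = j then frag_of ?v else 0))"
      by (auto simp: dfox_append a True fun_eq_iff)
    then have "ZL \<mu> (\<lambda>j. dfox frag_of j (w @ [a])) = ZL \<mu> ?d \<otimes> loop \<mu> i ?v"
      using ZL_upd[of \<mu> ?d i "frag_of ?v"] i by (simp add: loop_B)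
    moreover have "wsum frag_of (w @ [a]) = ?v + frag_of i" by (simp add: wsum_append a True)
    ultimately show ?thesis
      using Zc unfolding ev IH by (simp add: a True wletter_def loop_def group_nf)
  next
    case False
    \<comment> \<open>An inverse letter crosses backwards the edge that ends at the current vertex,
      so the loop involved is the one based at v minus the i-th basis vector.\<close>
    let ?u = "?v - frag_of i"
    have "(\<lambda>j. dfox frag_of j (w @ [a])) = (\<lambda>j. ?d j + (if i = j then - frag_of ?u else 0))"
      by (auto simp: dfox_append a False fun_eq_iff frag_of_mult)
    then have "ZL \<mu> (\<lambda>j. dfox frag_of j (w @ [a])) = ZL \<mu> ?d \<otimes> inv (loop \<mu> i ?u)"
      using ZL_upd[of \<mu> ?d i "- frag_of ?u"] i by (simp add: loop_B zext_uminus)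
    moreover have "wsum frag_of (w @ [a]) = ?u" by (simp add: wsum_append a False)
    moreover have "loop \<mu> i ?u = P \<mu> ?u \<otimes> x i \<otimes> inv (P \<mu> ?v)" by (simp add: loop_def)
    ultimately show ?thesis
      using Zc unfolding ev IH by (simp add: a False wletter_def group_nf)
  qed
qed

lemma weval_lcs:
  assumes w: "fst ` set w \<subseteq> {..<\<mu>}" and d: "\<And>i. i < \<mu> \<Longrightarrow> dfox frag_of i w \<in> aug_fil (Suc q)"
  shows "weval M x w \<in> N (Suc (Suc q))"
proof -
  have "wsum frag_of w = 0"
  proof (rule poly_mapping_eqI)
    fix i
    have "Dm {#} (dfox frag_of j w) = 0" if "j < \<mu>" for j
      using d[OF that] by (simp add: aug_fil_def)
    then show "lookup (wsum frag_of w) i = lookup 0 i"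
      by (simp add: wsum_dfox[OF _ w, of _ frag_of])
  qed
  then have "weval M x w = ZL \<mu> (\<lambda>j. dfox frag_of j w)"
    using weval_loops[OF w] by simp
  also have "m \<le> \<mu> \<Longrightarrow> ZL m (\<lambda>j. dfox frag_of j w) \<in> N (Suc (Suc q))" for m
  proof (induction m)
    case 0
    then show ?case using subgroup.one_closed[OF lcs_subgroup] by simp
  next
    case (Suc m)
    then show ?case
      using zext_loop_J[of m \<mu> _ q] d subgroup.m_closed[OF lcs_subgroup] by simp
  qed
  then have "ZL \<mu> (\<lambda>j. dfox frag_of j w) \<in> N (Suc (Suc q))" by simp
  finally show ?thesis .
qed

end

lemma (in normal) group_hom_coset: "group_hom G (G Mod H) (\<lambda>g. H #> g)"
  by (intro group_hom.intro group_hom_axioms.intro is_group factorgroup_is_group r_coset_hom_Mod)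

lemma (in normal) coset_eq_iff:
  assumes "a \<in> carrier G" "b \<in> carrier G"
  shows "H #> a = H #> b \<longleftrightarrow> a \<otimes> inv b \<in> H"
  using assms
  by (metis is_group group.repr_independence inv_closed l_one m_assoc m_closed r_inv rcos_const rcos_module
      rcos_self subgroup_axioms coset_mult_assoc subset r_coset_hom_Mod)

text \<open>The series contains F'', so membership can be tested in F/F'' and lifted back by
  \<open>lcs_img_surj\<close>. The case q = 0 is separate because \<open>weval_lcs\<close> needs one
  power of I to see that w has exponent 0.\<close>

theorem mem_lcs_if_dfox:
  assumes w: "w \<in> carrier (free_group {..<\<mu>})" and d: "\<And>i. i < \<mu> \<Longrightarrow> dfox frag_of i w \<in> aug_fil q"
  shows "w \<in> lcs (free_group {..<\<mu>}) (Suc q)"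
proof (cases q)
  case 0
  interpret F: group "free_group {..<\<mu>}" by (rule group_free_group)
  show ?thesis using 0 w by (simp add: F.lcs_1)
next
  case (Suc q')
  define F where "F = free_group {..<\<mu>}"
  interpret F: group F unfolding F_def by (rule group_free_group)
  interpret D: normal "derived2 F" F by (rule F.derived2_normal)
  define M where "M = F Mod derived2 F"
  interpret h: group_hom F M "\<lambda>g. derived2 F #>\<^bsub>F\<^esub> g"
    unfolding M_def by (rule D.group_hom_coset)
  have surj: "(\<lambda>g. derived2 F #>\<^bsub>F\<^esub> g) ` carrier F = carrier M"
    by (simp add: M_def carrier_FactGroup)
  define x where "x i = (if i < \<mu> then derived2 F #>\<^bsub>F\<^esub> gen i else \<one>\<^bsub>M\<^esub>)" for i
  have "derived2 M = derived M ((\<lambda>g. derived2 F #>\<^bsub>F\<^esub> g) ` derived1 F)"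
    using h.derived_img[of "carrier F"] surj by simp
  also have "\<dots> = (\<lambda>g. derived2 F #>\<^bsub>F\<^esub> g) ` derived2 F"
    by (intro h.derived_img F.derived_in_carrier) simp
  also have "\<dots> = (\<lambda>_. derived2 F) ` derived2 F"
    by (rule image_cong[OF refl]) (simp add: D.rcos_const)
  also have "\<dots> = {\<one>\<^bsub>M\<^esub>}"
    using image_constant[OF D.one_closed] by (simp add: M_def)
  finally have d2: "derived2 M = {\<one>\<^bsub>M\<^esub>}" .
  have "gen i \<in> carrier F" if "i < \<mu>" for i using that by (simp add: F_def)
  then have "x i \<in> carrier M" for i by (simp add: x_def)
  then interpret metab M x \<mu>
    by unfold_locales (use d2 in auto)
  have wS: "fst ` set w \<subseteq> {..<\<mu>}" using w by (simp add: carrier_free_group)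
  have "weval M x w = weval M ((\<lambda>g. derived2 F #>\<^bsub>F\<^esub> g) \<circ> gen) w"
    by (rule h.H.weval_cong) (use wS in \<open>auto simp: x_def\<close>)
  also have "\<dots> = derived2 F #>\<^bsub>F\<^esub> w"
    using hom_free_group_weval[OF h.homh[unfolded F_def] h.H.is_group w] by (simp add: F_def)
  finally have "derived2 F #>\<^bsub>F\<^esub> w \<in> lcs M (Suc q)"
    using weval_lcs[OF wS, of q'] d Suc by simp
  then obtain w' where w': "w' \<in> lcs F (Suc q)" "derived2 F #>\<^bsub>F\<^esub> w = derived2 F #>\<^bsub>F\<^esub> w'"
    using h.lcs_img_surj[OF _ surj, of "Suc q"] by auto
  have wF: "w \<in> carrier F" "w' \<in> carrier F" using w w' F.lcs_in_carrier by (auto simp: F_def)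
  have "w \<otimes>\<^bsub>F\<^esub> inv\<^bsub>F\<^esub> w' \<in> derived2 F"
    using w' wF by (simp add: D.coset_eq_iff)
  then have "w \<otimes>\<^bsub>F\<^esub> inv\<^bsub>F\<^esub> w' \<otimes>\<^bsub>F\<^esub> w' \<in> lcs F (Suc q)"
    using w' F.derived2_in_lcs subgroup.m_closed[OF F.lcs_subgroup] by blast
  then show ?thesis using wF by (simp add: F_def[symmetric] F.m_assoc)
qed

section \<open>Chen groups and homomorphisms\<close>

text \<open>Elimination of one unknown at a time, without division, so that it applies over \<int>
  as well as over \<Lambda>.\<close>

lemma homogeneous_solution:
  fixes A :: "'e \<Rightarrow> 'v \<Rightarrow> 'a::idom"
  assumes "finite E" "finite V" "card E < card V"
  shows "\<exists>x. (\<exists>v\<in>V. x v \<noteq> 0) \<and> (\<forall>e\<in>E. (\<Sum>v\<in>V. A e v * x v) = 0)"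
  using assms
proof (induction E arbitrary: A V rule: finite_induct)
  case empty
  then have "V \<noteq> {}" by auto
  then show ?case by (intro exI[of _ "\<lambda>_. 1"]) auto
next
  case (insert e E)
  show ?case
  proof (cases "\<forall>v\<in>V. A e v = 0")
    case True
    have "card E < card V" using insert by simp
    then obtain x where "\<exists>v\<in>V. x v \<noteq> 0" "\<forall>e\<in>E. (\<Sum>v\<in>V. A e v * x v) = 0"
      using insert.IH[OF insert.prems(1), of A] by blast
    moreover have "(\<Sum>v\<in>V. A e v * x v) = 0" using True by simp
    ultimately show ?thesis by blast
  next
    case False
    then obtain p where p: "p \<in> V" "A e p \<noteq> 0" by blast
    define V' where "V' = V - {p}"
    have V': "finite V'" "V = insert p V'" "p \<notin> V'" using p insert.prems by (auto simp: V'_def)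
    have "card E < card V'" using insert.prems insert.hyps V' by simp
    then obtain x where x: "\<exists>v\<in>V'. x v \<noteq> 0"
      "\<And>f. f \<in> E \<Longrightarrow> (\<Sum>v\<in>V'. (A e p * A f v - A f p * A e v) * x v) = 0"
      using insert.IH[OF V'(1), of "\<lambda>f v. A e p * A f v - A f p * A e v"] by blast
    \<comment> \<open>The pivot coordinate is read off from equation e; all other coordinates are
      multiplied by the pivot \<open>A e p\<close> to avoid fractions.\<close>
    define x' where "x' v = (if v = p then - (\<Sum>u\<in>V'. A e u * x u) else A e p * x v)" for v
    have s: "(\<Sum>v\<in>V. A f v * x' v) = - A f p * (\<Sum>u\<in>V'. A e u * x u) + (\<Sum>v\<in>V'. A f v * (A e p * x v))" for f
    proof -
      have "(\<Sum>v\<in>V'. A f v * x' v) = (\<Sum>v\<in>V'. A f v * (A e p * x v))"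
        by (rule sum.cong) (use V' in \<open>auto simp: x'_def\<close>)
      then show ?thesis using V' by (simp add: x'_def)
    qed
    have "\<exists>v\<in>V. x' v \<noteq> 0" using x(1) p V' by (auto simp: x'_def)
    moreover have "(\<Sum>v\<in>V. A e v * x' v) = 0"
      unfolding s by (simp add: sum_distrib_left sum_negf algebra_simps)
    moreover have "(\<Sum>v\<in>V. A f v * x' v) = 0" if "f \<in> E" for f
      unfolding s using x(2)[OF that] by (simp add: sum_distrib_left sum_negf algebra_simps sum_subtractf)
    ultimately show ?thesis by blast
  qed
qed

text \<open>Two additive maps are treated at once because the applications need one group element
  that realizes the same combination for both.\<close>

lemma (in group) additive_combination:
  fixes L L' :: "'a \<Rightarrow> 'k \<Rightarrow> int" and r :: nat
  assumes L: "\<And>u v k. u \<in> carrier G \<Longrightarrow> v \<in> carrier G \<Longrightarrow> k \<in> K \<Longrightarrow> L (u \<otimes> v) k = L u k + L v k"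
    and L': "\<And>u v k. u \<in> carrier G \<Longrightarrow> v \<in> carrier G \<Longrightarrow> k \<in> K \<Longrightarrow> L' (u \<otimes> v) k = L' u k + L' v k"
    and b: "\<And>i. i < r \<Longrightarrow> b i \<in> carrier G"
  shows "\<exists>g\<in>carrier G. \<forall>k\<in>K. L g k = (\<Sum>i<r. n i * L (b i) k) \<and> L' g k = (\<Sum>i<r. n i * L' (b i) k)"
proof -
  have one: "L \<one> k = 0" "L' \<one> k = 0" if "k \<in> K" for k
    using L[of \<one> \<one>] L'[of \<one> \<one>] that by auto
  have inv: "L (inv x) k = - L x k" "L' (inv x) k = - L' x k" if "k \<in> K" "x \<in> carrier G" for x k
    using L[of "inv x" x k] L'[of "inv x" x k] that one by auto
  have pow: "L (x [^] n) k = int n * L x k \<and> L' (x [^] n) k = int n * L' x k"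
    if "k \<in> K" "x \<in> carrier G" for x k and n :: nat
    using that by (induction n) (auto simp: one L L' algebra_simps)
  have ipow: "L (x [^] n) k = n * L x k \<and> L' (x [^] n) k = n * L' x k"
    if "k \<in> K" "x \<in> carrier G" for x k and n :: int
  proof (cases "n < 0")
    case True
    then have e: "x [^] n = inv (x [^] nat (- n))" by (subst int_pow_def2) (simp only: if_True)
    show ?thesis
      unfolding e inv[OF that(1) nat_pow_closed[OF that(2)]] using pow[OF that, of "nat (- n)"] True by simp
  next
    case False
    then have e: "x [^] n = x [^] nat n" by (subst int_pow_def2) (simp only: if_False)
    show ?thesis unfolding e using pow[OF that, of "nat n"] False by simp
  qed
  show ?thesis
    using b
  proof (induction r)
    case 0
    then show ?case using one by auto
  next
    case (Suc r)
    then obtain g where g: "g \<in> carrier G"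
      "\<forall>k\<in>K. L g k = (\<Sum>i<r. n i * L (b i) k) \<and> L' g k = (\<Sum>i<r. n i * L' (b i) k)"
      by auto
    then show ?case
      using Suc.prems ipow by (intro bexI[of _ "g \<otimes> b r [^] n r"]) (auto simp: L L')
  qed
qed

text \<open>Subgroups of \<open>\<int>\<^sup>K\<close> are Hopfian: think of \<open>L'\<close> as \<open>L\<close> followed by a surjective endomorphism
  of the image of \<open>L\<close>.\<close>

lemma (in group) hopf:
  fixes L L' :: "'a \<Rightarrow> 'k \<Rightarrow> int"
  assumes K: "finite K"
    and L: "\<And>u v k. u \<in> carrier G \<Longrightarrow> v \<in> carrier G \<Longrightarrow> k \<in> K \<Longrightarrow> L (u \<otimes> v) k = L u k + L v k"
    and L': "\<And>u v k. u \<in> carrier G \<Longrightarrow> v \<in> carrier G \<Longrightarrow> k \<in> K \<Longrightarrow> L' (u \<otimes> v) k = L' u k + L' v k"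
    and ker: "\<And>u. u \<in> carrier G \<Longrightarrow> \<forall>k\<in>K. L u k = 0 \<Longrightarrow> \<forall>k\<in>K. L' u k = 0"
    and surj: "\<And>u. u \<in> carrier G \<Longrightarrow> \<exists>u'\<in>carrier G. \<forall>k\<in>K. L' u' k = L u k"
    and c: "c \<in> carrier G" "\<forall>k\<in>K. L' c k = 0"
  shows "\<forall>k\<in>K. L c k = 0"
proof (rule ccontr)
  assume nz: "\<not> (\<forall>k\<in>K. L c k = 0)"
  define indep where "indep r a \<longleftrightarrow> (\<forall>i<r. a i \<in> carrier G) \<and>
      (\<forall>n::nat \<Rightarrow> int. (\<forall>k\<in>K. (\<Sum>i<r. n i * L (a i) k) = 0) \<longrightarrow> (\<forall>i<r. n i = 0))"
    for r and a :: "nat \<Rightarrow> 'a"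
  have bound: "r \<le> card K" if ind: "indep r a" for r a
  proof (rule ccontr)
    assume "\<not> r \<le> card K"
    then have "card K < card {..<r}" by simp
    from homogeneous_solution[OF K _ this, of "\<lambda>k i. L (a i) k"]
    obtain n where "\<exists>i\<in>{..<r}. n i \<noteq> 0" "\<forall>k\<in>K. (\<Sum>i<r. L (a i) k * n i) = 0" by auto
    then show False using ind by (auto simp: indep_def mult.commute)
  qed
  have "\<exists>a. indep 0 a" by (auto simp: indep_def)
  then have "\<exists>a. indep (GREATEST r. \<exists>a. indep r a) a"
    by (rule GreatestI_nat[where b = "card K"]) (use bound in blast)
  moreover define r where "r = (GREATEST r. \<exists>a. indep r a)"
  ultimately obtain a where a: "indep r a" by blast
  have max: "\<not> indep (Suc r) b" for b
  proof
    assume "indep (Suc r) b"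
    then have "Suc r \<le> r"
      unfolding r_def by (intro Greatest_le_nat[where b = "card K"]) (use bound in blast)+
    then show False by simp
  qed
  have "a i \<in> carrier G" if "i < r" for i using a that unfolding indep_def by blast
  then have "\<forall>i. \<exists>b. i < r \<longrightarrow> b \<in> carrier G \<and> (\<forall>k\<in>K. L' b k = L (a i) k)"
    by (metis surj)
  then obtain b where b: "\<And>i. i < r \<Longrightarrow> b i \<in> carrier G" "\<And>i k. i < r \<Longrightarrow> k \<in> K \<Longrightarrow> L' (b i) k = L (a i) k"
    by metis
  \<comment> \<open>A maximal independent family is lifted through L' and c is appended. A relation
    among these r + 1 elements under L holds under L' as well, where c goes to 0 and the lifts go to
    the independent family; so only the coefficient of c survives.\<close>
  define b' where "b' i = (if i < r then b i else c)" for i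
  have b': "b' i \<in> carrier G" for i using b c by (simp add: b'_def)
  obtain n where n: "\<forall>k\<in>K. (\<Sum>i<Suc r. n i * L (b' i) k) = 0" "\<exists>i<Suc r. n i \<noteq> 0"
    using max[of b'] b' unfolding indep_def by blast
  obtain g where g: "g \<in> carrier G"
    "\<forall>k\<in>K. L g k = (\<Sum>i<Suc r. n i * L (b' i) k) \<and> L' g k = (\<Sum>i<Suc r. n i * L' (b' i) k)"
    using additive_combination[where L = L and L' = L' and K = K and r = "Suc r" and b = b' and n = n, OF L L' b'] by blast
  have "(\<Sum>i<r. n i * L (a i) k) = 0" if k: "k \<in> K" for k
  proof -
    have "(\<Sum>i<Suc r. n i * L' (b' i) k) = 0" using ker[OF g(1)] g(2) n(1) k by auto
    moreover have "(\<Sum>i<r. n i * L' (b' i) k) = (\<Sum>i<r. n i * L (a i) k)"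
      by (rule sum.cong) (use b k in \<open>auto simp: b'_def\<close>)
    ultimately show ?thesis using c k by (simp add: b'_def)
  qed
  then have n0: "\<forall>i<r. n i = 0" using a unfolding indep_def by blast
  then have "n r \<noteq> 0" using n(2) less_Suc_eq by auto
  moreover have "n r * L c k = 0" if "k \<in> K" for k
    using n(1) that n0 by (auto simp: b'_def)
  ultimately show False using nz by auto
qed

text \<open>The central n drops out, and c can be moved through b and then past the whole
  commutator. This lets \<open>lcs_surj\<close> replace the entries of a commutator by
  approximations.\<close>

lemma (in group) gcomm_central_cong:
  assumes carr: "a \<in> carrier G" "b \<in> carrier G" "c \<in> carrier G" "n \<in> carrier G"
    and n: "\<And>z. z \<in> carrier G \<Longrightarrow> n \<otimes> z = z \<otimes> n"
    and cb: "c \<otimes> b = b \<otimes> c" and cc: "c \<otimes> gcomm G a b = gcomm G a b \<otimes> c"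
  shows "gcomm G (c \<otimes> a) (n \<otimes> b) = gcomm G a b"
proof -
  let ?t = "inv a \<otimes> inv c \<otimes> inv b"
  have "gcomm G (c \<otimes> a) (n \<otimes> b) = c \<otimes> a \<otimes> (n \<otimes> b) \<otimes> (?t \<otimes> inv n)"
    using carr by (simp add: gcomm_def group_nf)
  also have "\<dots> = c \<otimes> a \<otimes> b \<otimes> (n \<otimes> ?t) \<otimes> inv n"
    using carr n[of b] by (simp add: m_assoc)
  also have "\<dots> = c \<otimes> a \<otimes> b \<otimes> (?t \<otimes> n) \<otimes> inv n"
    using carr n[of ?t] by simp
  also have "\<dots> = c \<otimes> a \<otimes> b \<otimes> (inv a \<otimes> (inv c \<otimes> inv b))"
    using carr by (simp add: group_nf)
  also have "inv c \<otimes> inv b = inv b \<otimes> inv c"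
    using carr cb by (metis inv_mult_group)
  also have "c \<otimes> a \<otimes> b \<otimes> (inv a \<otimes> (inv b \<otimes> inv c)) = (c \<otimes> gcomm G a b) \<otimes> inv c"
    using carr by (simp add: gcomm_def m_assoc)
  also have "\<dots> = gcomm G a b" using carr by (simp add: cc m_assoc)
  finally show ?thesis .
qed

context group_hom
begin

text \<open>The next graded piece comes from commutators of arbitrary g with y in the current term.
  Both may be replaced by approximations in the image of h, because the errors do not change the
  commutator modulo the term after it.\<close>

lemma lcs_surj:
  assumes H: "\<And>y. y \<in> carrier H \<Longrightarrow> \<exists>x\<in>carrier G. y \<otimes>\<^bsub>H\<^esub> inv\<^bsub>H\<^esub> (h x) \<in> derived1 H"
    and "q \<ge> 1" "y \<in> lcs H q"
  shows "\<exists>x\<in>lcs G q. y \<otimes>\<^bsub>H\<^esub> inv\<^bsub>H\<^esub> (h x) \<in> lcs H (Suc q)"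
  using assms(2,3)
proof (induction q arbitrary: y rule: dec_induct)
  case base
  then show ?case using H[of y] by (simp add: G.lcs_1 H.lcs_1 H.lcs_2)
next
  case (step q)
  let ?N = "lcs H (Suc (Suc q))"
  interpret N: normal ?N H by (rule H.lcs_normal)
  define Q where "Q = H Mod ?N"
  define p where "p g = ?N #>\<^bsub>H\<^esub> g" for g
  interpret p: group_hom H Q p
    using N.group_hom_coset by (simp add: Q_def p_def[abs_def])
  have p_one: "p g = \<one>\<^bsub>Q\<^esub> \<longleftrightarrow> g \<in> ?N" if "g \<in> carrier H" for g
    using N.coset_eq_iff[OF that, of "\<one>\<^bsub>H\<^esub>"] that
    by (simp add: p_def Q_def H.coset_mult_one[OF N.subset])
  have p_comm: "p g \<otimes>\<^bsub>Q\<^esub> p k = p k \<otimes>\<^bsub>Q\<^esub> p g" if "gcomm H g k \<in> ?N" "g \<in> carrier H" "k \<in> carrier H" for g k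
    using that p_one[of "gcomm H g k"] by (simp add: p.hom_gcomm p.H.gcomm_eq_one_iff)
  have central: "p n \<otimes>\<^bsub>Q\<^esub> z = z \<otimes>\<^bsub>Q\<^esub> p n" if n: "n \<in> lcs H (Suc q)" and z: "z \<in> carrier Q" for n z
  proof -
    obtain g where g: "g \<in> carrier H" "z = p g" using z by (auto simp: Q_def carrier_FactGroup p_def)
    have "gcomm H g n \<in> ?N" by (rule H.lcs_gcomm) (use n g in auto)
    then show ?thesis using p_comm[of g n] g n H.lcs_in_carrier by auto
  qed
  interpret ph: group_hom G Q "p \<circ> h"
    by unfold_locales (use Group.hom_compose[OF homh p.homh] in simp)
  define K where "K = {y \<in> carrier H. p y \<in> (p \<circ> h) ` lcs G (Suc q)}"
  have "lcs H (Suc q) \<subseteq> K"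
  proof (rule H.lcs_Suc_least)
    show "subgroup K H" unfolding K_def
      by (intro p.vimage_subgroup ph.subgroup_img_is_subgroup G.lcs_subgroup)
    show "derived2 H \<subseteq> K"
    proof
      fix y assume y: "y \<in> derived2 H"
      then have yc: "y \<in> carrier H" using normal_imp_subgroup[OF H.derived2_normal] by (rule subgroup.mem_carrier[rotated])
      have "p y = \<one>\<^bsub>Q\<^esub>" using y yc H.derived2_in_lcs by (simp add: p_one)
      also have "\<dots> = (p \<circ> h) \<one>\<^bsub>G\<^esub>" by simp
      finally show "y \<in> K"
        using yc subgroup.one_closed[OF G.lcs_subgroup] unfolding K_def by blast
    qed
  next
    fix g y assume g: "g \<in> carrier H" and y: "y \<in> lcs H q"
    have yc: "y \<in> carrier H" using y by (rule H.lcs_in_carrier)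
    obtain a where a: "a \<in> carrier G" "g \<otimes>\<^bsub>H\<^esub> inv\<^bsub>H\<^esub> (h a) \<in> derived1 H" using H[OF g] by blast
    obtain b where b: "b \<in> lcs G q" "y \<otimes>\<^bsub>H\<^esub> inv\<^bsub>H\<^esub> (h b) \<in> lcs H (Suc q)"
      using step.IH[OF y] by blast
    have bc: "b \<in> carrier G" using b by (intro G.lcs_in_carrier)
    define c where "c = g \<otimes>\<^bsub>H\<^esub> inv\<^bsub>H\<^esub> (h a)"
    define n where "n = y \<otimes>\<^bsub>H\<^esub> inv\<^bsub>H\<^esub> (h b)"
    have carr: "c \<in> carrier H" "n \<in> carrier H" using g yc a bc by (auto simp: c_def n_def)
    have hb: "h b \<in> lcs H q" using step.hyps b by (intro lcs_img) auto
    \<comment> \<open>In degree 1, commutators with c in the derived subgroup lie in the third term.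
      In higher degree h b is in the derived subgroup too, so the commutator lies in the second
      derived subgroup: working modulo H'' replaces the usual estimate for commutators of two terms
      of the series.\<close>
    have "gcomm H (h b) c \<in> ?N"
    proof (cases "q = 1")
      case True
      then show ?thesis using H.lcs_gcomm[of "Suc q" "h b" c] bc a(2) by (simp add: c_def H.lcs_2)
    next
      case False
      then have "h b \<in> derived1 H" using hb H.lcs_subset_derived1[of q] step.hyps by auto
      then have "gcomm H (h b) c \<in> derived2 H" using a(2) by (simp add: c_def H.derived2_gcomm)
      then show ?thesis by (rule H.derived2_in_lcs)
    qed
    then have cb: "p c \<otimes>\<^bsub>Q\<^esub> p (h b) = p (h b) \<otimes>\<^bsub>Q\<^esub> p c"
      using p_comm[of "h b" c] bc carr by simp
    have ab: "gcomm G a b \<in> lcs G (Suc q)"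
      using step.hyps a b by (intro G.lcs_gcomm) auto
    then have "h (gcomm G a b) \<in> lcs H (Suc q)" by (intro lcs_img) auto
    then have cc: "p c \<otimes>\<^bsub>Q\<^esub> gcomm Q (p (h a)) (p (h b)) = gcomm Q (p (h a)) (p (h b)) \<otimes>\<^bsub>Q\<^esub> p c"
      using central[of "h (gcomm G a b)" "p c"] carr a bc by (simp add: hom_gcomm p.hom_gcomm)
    have "g = c \<otimes>\<^bsub>H\<^esub> h a" "y = n \<otimes>\<^bsub>H\<^esub> h b"
      using g yc a bc by (auto simp: c_def n_def H.m_assoc)
    then have "p (gcomm H g y) = gcomm Q (p c \<otimes>\<^bsub>Q\<^esub> p (h a)) (p n \<otimes>\<^bsub>Q\<^esub> p (h b))"
      using carr a bc by (simp add: p.hom_gcomm)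
    also have "\<dots> = gcomm Q (p (h a)) (p (h b))"
      by (rule p.H.gcomm_central_cong) (use carr a bc cb cc central b in \<open>auto simp: n_def\<close>)
    also have "\<dots> = (p \<circ> h) (gcomm G a b)" using a bc by (simp add: hom_gcomm p.hom_gcomm)
    finally show "gcomm H g y \<in> K" using ab g yc unfolding K_def by auto
  qed (use step in auto)
  then obtain x where x: "x \<in> lcs G (Suc q)" "p y = p (h x)" and y: "y \<in> carrier H"
    using step.prems unfolding K_def by auto
  have "x \<in> carrier G" using x by (intro G.lcs_in_carrier)
  then show ?case using x y N.coset_eq_iff[of y "h x"] by (auto simp: p_def)
qed

end

context group
begin

lemma lcs_Suc_normal:
  assumes "q \<ge> 1"
  shows "lcs G (Suc q) \<lhd> G\<lparr>carrier := lcs G q\<rparr>"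
  by (rule normal_restrict_supergroup) (intro lcs_subgroup lcs_normal lcs_Suc_subset assms)+

lemma chen_group_hom:
  assumes "q \<ge> 1"
  shows "group_hom (G\<lparr>carrier := lcs G q\<rparr>) (chen_group G q)
           (\<lambda>g. lcs G (Suc q) #> g)"
  using normal.group_hom_coset[OF lcs_Suc_normal[OF assms]] by (simp add: chen_group_def)

lemma chen_coset_eq_iff:
  "a \<in> carrier G \<Longrightarrow> b \<in> carrier G \<Longrightarrow>
    lcs G q #> a = lcs G q #> b \<longleftrightarrow> a \<otimes> inv b \<in> lcs G q"
  by (rule normal.coset_eq_iff[OF lcs_normal])

lemma carrier_chen_group:
  "carrier (chen_group G q) = (\<lambda>g. lcs G (Suc q) #> g) ` lcs G q"
  by (simp add: chen_group_def carrier_FactGroup)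

lemma coset_lcs_self:
  "a \<in> carrier G \<Longrightarrow> lcs G q #> a = lcs G q \<longleftrightarrow> a \<in> lcs G q"
  using chen_coset_eq_iff[of a \<one> q] subgroup.subset[OF lcs_subgroup[of q]] by simp

end

context group_hom
begin

lemma chen_group_map:
  assumes "q \<ge> 1"
  shows "group_hom (G\<lparr>carrier := lcs G q\<rparr>) (chen_group H q)
           (\<lambda>g. lcs H (Suc q) #>\<^bsub>H\<^esub> h g)"
proof -
  interpret c: group_hom "H\<lparr>carrier := lcs H q\<rparr>" "chen_group H q"
    "\<lambda>g. lcs H (Suc q) #>\<^bsub>H\<^esub> g" by (rule H.chen_group_hom[OF assms])
  have "h \<in> hom (G\<lparr>carrier := lcs G q\<rparr>) (H\<lparr>carrier := lcs H q\<rparr>)"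
    using lcs_img[OF assms] G.lcs_in_carrier by (auto simp: hom_def)
  from Group.hom_compose[OF this c.homh]
  show ?thesis
    by (intro group_hom.intro group_hom_axioms.intro c.H.is_group G.subgroup_imp_group G.lcs_subgroup)
      (simp add: o_def)
qed

text \<open>Surjectivity is \<open>lcs_surj\<close>; the kernel is controlled by injectivity one
  level further down.\<close>

lemma chen_group_iso:
  assumes H: "\<And>y. y \<in> carrier H \<Longrightarrow> \<exists>x\<in>carrier G. y \<otimes>\<^bsub>H\<^esub> inv\<^bsub>H\<^esub> (h x) \<in> derived1 H"
    and inj: "\<And>x. x \<in> carrier G \<Longrightarrow> h x \<in> lcs H (Suc q) \<Longrightarrow> x \<in> lcs G (Suc q)"
    and q: "q \<ge> 1"
  shows "chen_group G q \<cong> chen_group H q"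
proof -
  let ?f = "\<lambda>g. lcs H (Suc q) #>\<^bsub>H\<^esub> h g"
  interpret f: group_hom "G\<lparr>carrier := lcs G q\<rparr>" "chen_group H q" ?f
    by (rule chen_group_map[OF q])
  have one: "\<one>\<^bsub>chen_group H q\<^esub> = lcs H (Suc q)" by (simp add: chen_group_def)
  have ker: "kernel (G\<lparr>carrier := lcs G q\<rparr>) (chen_group H q) ?f = lcs G (Suc q)"
  proof (intro equalityI subsetI)
    fix x assume "x \<in> kernel (G\<lparr>carrier := lcs G q\<rparr>) (chen_group H q) ?f"
    then have "x \<in> lcs G q" "?f x = lcs H (Suc q)"
      by (auto simp: kernel_def one)
    then show "x \<in> lcs G (Suc q)"
      using inj[of x] H.coset_lcs_self[of "h x"] G.lcs_in_carrier[of x q] by auto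
  next
    fix x assume x: "x \<in> lcs G (Suc q)"
    then have "x \<in> lcs G q" "x \<in> carrier G" "h x \<in> lcs H (Suc q)"
      using G.lcs_Suc_subset[OF q] G.lcs_in_carrier lcs_img[of "Suc q" x] by auto
    then show "x \<in> kernel (G\<lparr>carrier := lcs G q\<rparr>) (chen_group H q) ?f"
      using H.coset_lcs_self[of "h x"] by (simp add: kernel_def one)
  qed
  have "?f ` lcs G q = carrier (chen_group H q)"
  proof (intro equalityI subsetI)
    fix C assume "C \<in> carrier (chen_group H q)"
    then obtain y where y: "y \<in> lcs H q" "C = lcs H (Suc q) #>\<^bsub>H\<^esub> y"
      by (auto simp: H.carrier_chen_group)
    obtain x where x: "x \<in> lcs G q" "y \<otimes>\<^bsub>H\<^esub> inv\<^bsub>H\<^esub> (h x) \<in> lcs H (Suc q)"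
      using lcs_surj[OF H q y(1)] by blast
    have "C = ?f x" using x y G.lcs_in_carrier[OF x(1)] H.lcs_in_carrier[OF y(1)]
      by (simp add: H.chen_coset_eq_iff)
    then show "C \<in> ?f ` lcs G q" using x by blast
  qed (use f.hom_closed in auto)
  then have "(G\<lparr>carrier := lcs G q\<rparr>) Mod lcs G (Suc q) \<cong> chen_group H q"
    using f.FactGroup_iso by (simp add: ker)
  then show ?thesis by (simp add: chen_group_def)
qed

end

section \<open>Taylor coefficients on the Chen groups of a free group\<close>

lemma finite_multisets_size: "finite A \<Longrightarrow> finite {m. set_mset m \<subseteq> A \<and> size m = n}"
proof -
  assume "finite A"
  then have "finite (mset ` {xs. set xs \<subseteq> A \<and> length xs = n})"
    by (intro finite_imageI finite_lists_length_eq)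
  moreover have "{m. set_mset m \<subseteq> A \<and> size m = n} \<subseteq> mset ` {xs. set xs \<subseteq> A \<and> length xs = n}"
  proof
    fix m assume "m \<in> {m. set_mset m \<subseteq> A \<and> size m = n}"
    moreover obtain xs where "m = mset xs" by (metis ex_mset)
    ultimately show "m \<in> mset ` {xs. set xs \<subseteq> A \<and> length xs = n}" by auto
  qed
  ultimately show ?thesis by (rule finite_subset[rotated])
qed

lemma trunc_add: "trunc k (v + w) = trunc k v + trunc k w"
  by (rule poly_mapping_eqI) (simp add: lookup_trunc lookup_add)

lemma trunc_uminus: "trunc k (- v) = - trunc k v"
  by (rule poly_mapping_eqI) (simp add: lookup_trunc)

lemma trunc_frag_of: "i < k \<Longrightarrow> trunc k (frag_of i) = frag_of i"
  by (rule poly_mapping_eqI) (auto simp: lookup_trunc)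

lemma group_ring_map_trunc_mult:
  "group_ring_map (trunc k) (frag_of v * f) = frag_of (trunc k v) * group_ring_map (trunc k) f"
  by (induction f rule: frag_cases)
    (auto simp: frag_of_mult trunc_add right_diff_distrib group_ring_map_diff)

lemma trunc_zero [simp]: "trunc k 0 = 0"
  by (rule poly_mapping_eqI) (simp add: lookup_trunc)

text \<open>Words in k letters have derivatives in k variables. Hence finitely many Taylor
  coefficients in each degree decide membership in the filtration.\<close>

lemma dfox_trunc:
  "fst ` set w \<subseteq> {..<k} \<Longrightarrow> group_ring_map (trunc k) (dfox frag_of j w) = dfox frag_of j w"
proof (induction w)
  case (Cons a w)
  obtain y e where a: "a = (y, e)" by (cases a)
  have y: "y < k" using Cons.prems a by simp
  have 1: "group_ring_map (trunc k) 1 = 1"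
    using group_ring_map_frag_of[of "trunc k" 0] by (simp add: frag_of_zero)
  show ?case using Cons y
    by (simp add: a group_ring_map_add group_ring_map_trunc_mult group_ring_map_uminus
        trunc_frag_of trunc_uminus 1)
qed simp

lemma dfox_mult:
  assumes "u \<in> carrier (free_group S)" "v \<in> carrier (free_group S)" "finite S" "j \<in> S"
  shows "dfox \<alpha> j (u \<otimes>\<^bsub>free_group S\<^esub> v) = dfox \<alpha> j u + frag_of (wsum \<alpha> u) * dfox \<alpha> j v"
proof -
  define x where "x = (\<lambda>y. (\<alpha> y, \<lambda>i::nat. if y = j then 1 else (0::laurent)))"
  interpret F: group "free_group S" by (rule group_free_group)
  interpret h: group_hom "free_group S" magnus "weval magnus x"
    by unfold_locales (simp add: T.weval_hom)
  have e: "weval magnus x w = (wsum \<alpha> w, \<lambda>i. dfox \<alpha> j w)" if "w \<in> carrier (free_group S)" for w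
    using weval_magnus_1[of w S j \<alpha>] that assms by (simp add: x_def carrier_free_group)
  have "weval magnus x (u \<otimes>\<^bsub>free_group S\<^esub> v) = weval magnus x u \<otimes>\<^bsub>magnus\<^esub> weval magnus x v"
    using assms by simp
  then show ?thesis using assms by (auto simp: e fun_eq_iff)
qed

text \<open>The coefficients \<open>Dm m\<close> of the Fox derivatives, with \<open>m\<close> of size \<open>q - 1\<close>, embed the \<open>q\<close>-th Chen
  group of the free group into some \<open>\<int>\<^sup>k\<close>, so \<open>hopf\<close> applies.\<close>

lemma chen_iso_imp_inj:
  fixes \<mu> :: nat and G :: "('a, 'b) monoid_scheme"
  assumes "group_hom (free_group {..<\<mu>}) G h"
    and H: "\<And>y. y \<in> carrier G \<Longrightarrow> \<exists>x\<in>carrier (free_group {..<\<mu>}). y \<otimes>\<^bsub>G\<^esub> inv\<^bsub>G\<^esub> (h x) \<in> derived1 G"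
    and iso: "\<And>q. q \<ge> 1 \<Longrightarrow> chen_group G q \<cong> chen_group (free_group {..<\<mu>}) q"
    and "q \<ge> 1" "w \<in> carrier (free_group {..<\<mu>})" "h w \<in> lcs G q"
  shows "w \<in> lcs (free_group {..<\<mu>}) q"
  using assms(4-6)
proof (induction q arbitrary: w rule: dec_induct)
  case base
  interpret F: group "free_group {..<\<mu>}" by (rule group_free_group)
  show ?case using base by (simp add: F.lcs_1)
next
  case (step q)
  define F where "F = free_group {..<\<mu>}"
  interpret h: group_hom F G h using assms(1) by (simp add: F_def)
  let ?NF = "lcs F" and ?NG = "lcs G"
  define \<Gamma> where "\<Gamma> = F\<lparr>carrier := ?NF q\<rparr>"
  interpret \<Gamma>: group \<Gamma> unfolding \<Gamma>_def by (intro h.G.subgroup_imp_group h.G.lcs_subgroup)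
  have c\<Gamma>: "carrier \<Gamma> = ?NF q" "u \<otimes>\<^bsub>\<Gamma>\<^esub> v = u \<otimes>\<^bsub>F\<^esub> v" for u v by (auto simp: \<Gamma>_def)
  have carF: "u \<in> carrier F" if "u \<in> ?NF n" for u n using that by (rule h.G.lcs_in_carrier)
  have wordF: "fst ` set u \<subseteq> {..<\<mu>}" if "u \<in> carrier F" for u
    using that by (simp add: F_def carrier_free_group)
  define K where "K = {..<\<mu>} \<times> {m. set_mset m \<subseteq> {..<\<mu>} \<and> size m = q - 1}"
  define L where "L u k = Dm (snd k) (dfox frag_of (fst k) u)" for u :: "nat word" and k :: "nat \<times> nat multiset"
  have K: "finite K" unfolding K_def by (intro finite_cartesian_product finite_multisets_size) auto
  have L_add: "L (u \<otimes>\<^bsub>F\<^esub> v) k = L u k + L v k" if u: "u \<in> ?NF q" and v: "v \<in> ?NF q" and k: "k \<in> K" for u v k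
  proof -
    have d: "dfox frag_of (fst k) (u \<otimes>\<^bsub>F\<^esub> v)
        = dfox frag_of (fst k) u + frag_of (wsum frag_of u) * dfox frag_of (fst k) v"
      unfolding F_def by (rule dfox_mult) (use carF[OF u] carF[OF v] k in \<open>auto simp: K_def F_def\<close>)
    \<comment> \<open>Additivity needs the factor t^u to be invisible: for q = 1 only augmentations
      are taken, and for larger q the exponent of u is 0.\<close>
    show ?thesis
    proof (cases "q = 1")
      case True
      then show ?thesis using k by (auto simp: K_def L_def d Dm_add Dm_empty_frag_of_mult)
    next
      case False
      then have "wsum (frag_of :: nat \<Rightarrow> _) u = 0"
        using dfox_lcs(2)[of "{..<\<mu>}" "fst k" "q - 1" u frag_of] u k step.hyps by (auto simp: K_def F_def)
      then show ?thesis by (simp add: L_def d Dm_add frag_of_zero)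
    qed
  qed
  have L_ker: "u \<in> ?NF (Suc q) \<longleftrightarrow> (\<forall>k\<in>K. L u k = 0)" if u: "u \<in> ?NF q" for u
  proof
    assume "u \<in> ?NF (Suc q)"
    then show "\<forall>k\<in>K. L u k = 0"
      using dfox_lcs(1)[of "{..<\<mu>}" _ q u frag_of] step.hyps by (auto simp: K_def L_def F_def aug_fil_def)
  next
    assume 0: "\<forall>k\<in>K. L u k = 0"
    show "u \<in> ?NF (Suc q)"
      unfolding F_def
    proof (rule mem_lcs_if_dfox)
      fix i assume i: "i < \<mu>"
      have aug_fil: "dfox frag_of i u \<in> aug_fil (q - 1)"
      proof (cases "q = 1")
        case False
        then show ?thesis
          using dfox_lcs(1)[of "{..<\<mu>}" i "q - 1" u frag_of] i u step.hyps by (simp add: F_def)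
      qed simp
      have "Dm m (dfox frag_of i u) = 0" if m: "size m < q" for m
      proof (cases "size m < q - 1")
        case True
        then show ?thesis using aug_fil by (simp add: aug_fil_def)
      next
        case False
        then have sm: "size m = q - 1" using m by simp
        show ?thesis
        proof (cases "set_mset m \<subseteq> {..<\<mu>}")
          case True
          then have "(i, m) \<in> K" using sm i by (simp add: K_def)
          then show ?thesis using 0 by (auto simp: L_def)
        next
          case False
          then show ?thesis
            using Dm_trunc[of m \<mu> "dfox frag_of i u"] dfox_trunc[OF wordF[OF carF[OF u]], of i] by simp
        qed
      qed
      then show "dfox frag_of i u \<in> aug_fil q" by (simp add: aug_fil_def)
    qed (use carF[OF u] in \<open>simp add: F_def\<close>)
  qed
  obtain \<Theta> where \<Theta>: "\<Theta> \<in> iso (chen_group G q) (chen_group F q)"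
    using iso[OF step.hyps(1)] by (auto simp: is_iso_def F_def)
  interpret c: group_hom \<Gamma> "chen_group F q" "\<lambda>g. ?NF (Suc q) #>\<^bsub>F\<^esub> g"
    unfolding \<Gamma>_def by (rule h.G.chen_group_hom[OF step.hyps(1)])
  interpret hc: group_hom \<Gamma> "chen_group G q" "\<lambda>g. ?NG (Suc q) #>\<^bsub>G\<^esub> h g"
    unfolding \<Gamma>_def by (rule h.chen_group_map[OF step.hyps(1)])
  interpret \<Theta>: group_hom "chen_group G q" "chen_group F q" \<Theta>
    by unfold_locales (use \<Theta> in \<open>simp add: iso_def\<close>)
  \<comment> \<open>The function \<open>r\<close> obtained from this lifts the composite Q(F;q)
    \<rightarrow> Q(G;q) \<rightarrow> Q(F;q) of the map induced by h with the given isomorphism. It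
    is onto by \<open>lcs_surj\<close>, hence injective by \<open>hopf\<close>.\<close>
  have "\<exists>u'\<in>?NF q. \<Theta> (?NG (Suc q) #>\<^bsub>G\<^esub> h u) = ?NF (Suc q) #>\<^bsub>F\<^esub> u'" if "u \<in> ?NF q" for u
  proof -
    have "\<Theta> (?NG (Suc q) #>\<^bsub>G\<^esub> h u) \<in> carrier (chen_group F q)"
      using that c\<Gamma> by (intro \<Theta>.hom_closed hc.hom_closed) simp
    then show ?thesis by (auto simp: h.G.carrier_chen_group)
  qed
  then obtain r where r: "\<And>u. u \<in> ?NF q \<Longrightarrow> r u \<in> ?NF q"
    "\<And>u. u \<in> ?NF q \<Longrightarrow> \<Theta> (?NG (Suc q) #>\<^bsub>G\<^esub> h u) = ?NF (Suc q) #>\<^bsub>F\<^esub> r u"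
    by metis
  have NFm: "u \<otimes>\<^bsub>F\<^esub> v \<in> ?NF n" if "u \<in> ?NF n" "v \<in> ?NF n" for u v n
    using subgroup.m_closed[OF h.G.lcs_subgroup that] .
  have NFi: "inv\<^bsub>F\<^esub> u \<in> ?NF n" if "u \<in> ?NF n" for u n
    using subgroup.m_inv_closed[OF h.G.lcs_subgroup that] .
  have L_coset: "\<forall>k\<in>K. L u k = L v k"
    if u: "u \<in> ?NF q" and v: "v \<in> ?NF q" and uv: "?NF (Suc q) #>\<^bsub>F\<^esub> u = ?NF (Suc q) #>\<^bsub>F\<^esub> v" for u v
  proof -
    have n: "u \<otimes>\<^bsub>F\<^esub> inv\<^bsub>F\<^esub> v \<in> ?NF (Suc q)"
      using uv carF[OF u] carF[OF v] by (simp add: h.G.chen_coset_eq_iff)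
    have nq: "u \<otimes>\<^bsub>F\<^esub> inv\<^bsub>F\<^esub> v \<in> ?NF q" using u v by (intro NFm NFi)
    have "u = (u \<otimes>\<^bsub>F\<^esub> inv\<^bsub>F\<^esub> v) \<otimes>\<^bsub>F\<^esub> v" using carF[OF u] carF[OF v] by (simp add: h.G.m_assoc)
    then show ?thesis using L_add[OF nq v] L_ker[OF nq] n by auto
  qed
  have L0: "\<forall>k\<in>K. L (r u) k = 0" if u: "u \<in> ?NF q" and hu: "h u \<in> ?NG (Suc q)" for u
  proof -
    have "?NG (Suc q) #>\<^bsub>G\<^esub> h u = \<one>\<^bsub>chen_group G q\<^esub>"
      using hu carF[OF u] by (simp add: h.H.coset_lcs_self chen_group_def)
    then have "?NF (Suc q) #>\<^bsub>F\<^esub> r u = ?NF (Suc q)"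
      using r(2)[OF u] \<Theta>.hom_one by (simp add: chen_group_def)
    then have "r u \<in> ?NF (Suc q)"
      using carF[OF r(1)[OF u]] by (simp add: h.G.coset_lcs_self)
    then show ?thesis using L_ker[OF r(1)[OF u]] by simp
  qed
  have wq: "w \<in> ?NF q"
    using step.IH[of w] step.prems h.H.lcs_Suc_subset[OF step.hyps(1)] by (auto simp: F_def)
  have "\<forall>k\<in>K. L w k = 0"
  proof (rule \<Gamma>.hopf[where L' = "\<lambda>u. L (r u)"])
    show "finite K" by (rule K)
    show "L (u \<otimes>\<^bsub>\<Gamma>\<^esub> v) k = L u k + L v k" if "u \<in> carrier \<Gamma>" "v \<in> carrier \<Gamma>" "k \<in> K" for u v k
      using that L_add by (simp add: c\<Gamma>)
    show "L (r (u \<otimes>\<^bsub>\<Gamma>\<^esub> v)) k = L (r u) k + L (r v) k"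
      if u: "u \<in> carrier \<Gamma>" and v: "v \<in> carrier \<Gamma>" and k: "k \<in> K" for u v k
    proof -
      have uv: "u \<in> ?NF q" "v \<in> ?NF q" "u \<otimes>\<^bsub>F\<^esub> v \<in> ?NF q" using u v NFm by (auto simp: c\<Gamma>)
      have "?NF (Suc q) #>\<^bsub>F\<^esub> r (u \<otimes>\<^bsub>F\<^esub> v) = \<Theta> (?NG (Suc q) #>\<^bsub>G\<^esub> h (u \<otimes>\<^bsub>\<Gamma>\<^esub> v))"
        using r(2)[OF uv(3)] by (simp add: c\<Gamma>)
      also have "\<dots> = \<Theta> (?NG (Suc q) #>\<^bsub>G\<^esub> h u) \<otimes>\<^bsub>chen_group F q\<^esub> \<Theta> (?NG (Suc q) #>\<^bsub>G\<^esub> h v)"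
        using u v by (simp add: hc.hom_mult)
      also have "\<dots> = ?NF (Suc q) #>\<^bsub>F\<^esub> (r u \<otimes>\<^bsub>\<Gamma>\<^esub> r v)"
        using r uv by (simp add: c\<Gamma>(1) c.hom_mult)
      finally have "\<forall>k\<in>K. L (r (u \<otimes>\<^bsub>F\<^esub> v)) k = L (r u \<otimes>\<^bsub>F\<^esub> r v) k"
        using r(1)[OF uv(1)] r(1)[OF uv(2)] r(1)[OF uv(3)] NFm by (intro L_coset) (auto simp: c\<Gamma>)
      then show ?thesis using L_add[OF r(1)[OF uv(1)] r(1)[OF uv(2)] k] k by (simp add: c\<Gamma>)
    qed
    show "\<forall>k\<in>K. L (r u) k = 0" if "u \<in> carrier \<Gamma>" "\<forall>k\<in>K. L u k = 0" for u
    proof -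
      have u: "u \<in> ?NF q" "u \<in> ?NF (Suc q)" using that L_ker[of u] by (auto simp: c\<Gamma>)
      then show ?thesis using h.lcs_img[of "Suc q" u] by (intro L0) auto
    qed
    show "\<exists>u'\<in>carrier \<Gamma>. \<forall>k\<in>K. L (r u') k = L u k" if "u \<in> carrier \<Gamma>" for u
    proof -
      have u: "u \<in> ?NF q" using that by (simp add: c\<Gamma>)
      have "?NF (Suc q) #>\<^bsub>F\<^esub> u \<in> carrier (chen_group F q)" using that by (rule c.hom_closed)
      then obtain C where C: "C \<in> carrier (chen_group G q)" "\<Theta> C = ?NF (Suc q) #>\<^bsub>F\<^esub> u"
        using \<Theta> unfolding iso_def bij_betw_def by (smt (verit, best) imageE mem_Collect_eq)
      then obtain y where y: "y \<in> ?NG q" "C = ?NG (Suc q) #>\<^bsub>G\<^esub> y" by (auto simp: h.H.carrier_chen_group)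
      obtain x where x: "x \<in> ?NF q" "y \<otimes>\<^bsub>G\<^esub> inv\<^bsub>G\<^esub> (h x) \<in> ?NG (Suc q)"
        using h.lcs_surj[OF _ step.hyps(1) y(1)] H unfolding F_def by blast
      have "C = ?NG (Suc q) #>\<^bsub>G\<^esub> h x"
        using x y carF[OF x(1)] h.H.lcs_in_carrier[OF y(1)] by (simp add: h.H.chen_coset_eq_iff)
      then have "?NF (Suc q) #>\<^bsub>F\<^esub> r x = ?NF (Suc q) #>\<^bsub>F\<^esub> u" using r(2)[OF x(1)] C by simp
      then have "\<forall>k\<in>K. L (r x) k = L u k" using r(1)[OF x(1)] u by (intro L_coset)
      then show ?thesis using x by (auto simp: c\<Gamma>)
    qed
    show "w \<in> carrier \<Gamma>" using wq by (simp add: c\<Gamma>)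
    show "\<forall>k\<in>K. L (r w) k = 0" using L0[OF wq] step.prems by simp
  qed
  then show ?case using L_ker[OF wq] by (simp add: F_def)
qed

section \<open>Minors and rank over integral domains\<close>

text \<open>Over a domain, singular matrices are those that kill a nonzero vector. Phrasing this
  with sums over index sets hides the enumeration \<open>pick\<close> used by
  \<open>submatrix\<close>.\<close>

lemma det_eq_0_iff_sum:
  fixes A :: "nat \<Rightarrow> nat \<Rightarrow> 'a::idom"
  assumes f: "bij_betw f {..<n} I" and g: "bij_betw g {..<n} K"
  shows "Determinant.det (mat n n (\<lambda>(a, b). A (f a) (g b))) = 0 \<longleftrightarrow>
    (\<exists>z. (\<exists>j\<in>K. z j \<noteq> 0) \<and> (\<forall>k\<in>I. (\<Sum>j\<in>K. A k j * z j) = 0))"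
proof -
  let ?M = "mat n n (\<lambda>(a, b). A (f a) (g b))"
  have M: "?M \<in> carrier_mat n n" by simp
  have idx: "(?M *\<^sub>v v) $ a = (\<Sum>b<n. A (f a) (g b) * v $ b)" if "v \<in> carrier_vec n" "a < n" for v a
    using that by (simp add: scalar_prod_def atLeast0LessThan)
  have reindex: "(\<Sum>b<n. A k (g b) * z (g b)) = (\<Sum>j\<in>K. A k j * z j)" for k z
    using sum.reindex_bij_betw[OF g, of "\<lambda>j. A k j * z j"] .
  show ?thesis
  proof
    assume "Determinant.det ?M = 0"
    then obtain v where v: "v \<in> carrier_vec n" "v \<noteq> 0\<^sub>v n" "?M *\<^sub>v v = 0\<^sub>v n"
      using det_0_iff_vec_prod_zero[OF M] by blast
    define z where "z j = v $ (inv_into {..<n} g j)" for j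
    have zg: "z (g b) = v $ b" if "b < n" for b
      using that g by (simp add: z_def bij_betw_def inv_into_f_f)
    obtain b where b: "b < n" "v $ b \<noteq> 0"
      using v(1,2) by (metis eq_vecI carrier_vecD index_zero_vec)
    have "g b \<in> K" using b g by (auto simp: bij_betw_def)
    moreover have "z (g b) \<noteq> 0" using b zg by simp
    moreover have "(\<Sum>j\<in>K. A k j * z j) = 0" if "k \<in> I" for k
    proof -
      have "k \<in> f ` {..<n}" using that bij_betw_imp_surj_on[OF f] by simp
      then obtain a where a: "a < n" "k = f a" by auto
      have "(\<Sum>j\<in>K. A k j * z j) = (\<Sum>b<n. A (f a) (g b) * v $ b)"
        unfolding reindex[symmetric] a by (rule sum.cong) (auto simp: zg)
      also have "\<dots> = 0" using idx[OF v(1) a(1)] v(3) a by simp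
      finally show ?thesis .
    qed
    ultimately show "\<exists>z. (\<exists>j\<in>K. z j \<noteq> 0) \<and> (\<forall>k\<in>I. (\<Sum>j\<in>K. A k j * z j) = 0)" by blast
  next
    assume "\<exists>z. (\<exists>j\<in>K. z j \<noteq> 0) \<and> (\<forall>k\<in>I. (\<Sum>j\<in>K. A k j * z j) = 0)"
    then obtain z j where z: "j \<in> K" "z j \<noteq> 0" "\<And>k. k \<in> I \<Longrightarrow> (\<Sum>j\<in>K. A k j * z j) = 0" by blast
    define v where "v = vec n (\<lambda>b. z (g b))"
    have v: "v \<in> carrier_vec n" by (simp add: v_def)
    obtain b where b: "b < n" "j = g b" using z(1) g by (auto simp: bij_betw_def)
    then have "v $ b \<noteq> 0" using z by (simp add: v_def)
    then have "v \<noteq> 0\<^sub>v n" using b by auto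
    moreover have "?M *\<^sub>v v = 0\<^sub>v n"
    proof (rule eq_vecI)
      fix a assume "a < dim_vec (0\<^sub>v n :: 'a vec)"
      then have a: "a < n" by simp
      have "(?M *\<^sub>v v) $ a = (\<Sum>b<n. A (f a) (g b) * z (g b))"
        unfolding idx[OF v a] by (rule sum.cong) (auto simp: v_def)
      also have "\<dots> = 0" unfolding reindex by (rule z(3)) (use f a in \<open>auto simp: bij_betw_def\<close>)
      finally show "(?M *\<^sub>v v) $ a = 0\<^sub>v n $ a" using a by simp
    qed simp
    ultimately show "Determinant.det ?M = 0" using det_0_iff_vec_prod_zero[OF M] v by blast
  qed
qed

lemma bij_betw_pick:
  assumes "finite I" shows "bij_betw (pick I) {..<card I} I"
proof -
  have sub: "I \<subseteq> pick I ` {..<card I}"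
  proof
    fix i assume i: "i \<in> I"
    then have "{a \<in> I. a < i} \<subset> I" by blast
    then have "card {a \<in> I. a < i} < card I" using assms by (rule psubset_card_mono[rotated])
    then show "i \<in> pick I ` {..<card I}"
      by (intro image_eqI[of _ _ "card {a \<in> I. a < i}"]) (auto simp: pick_card_in_set[OF i])
  qed
  have "card (pick I ` {..<card I}) \<le> card I" using card_image_le[of "{..<card I}" "pick I"] by simp
  then have eq: "pick I ` {..<card I} = I" using sub by (metis card_seteq finite_imageI finite_lessThan)
  then have "inj_on (pick I) {..<card I}" by (intro eq_card_imp_inj_on) auto
  with eq show ?thesis by (simp add: bij_betw_def)
qed

lemma det_submatrix_eq_0_iff:
  fixes A :: "nat \<Rightarrow> nat \<Rightarrow> 'a::idom"
  assumes "I \<subseteq> {..<m}" "K \<subseteq> {..<n}" "card I = card K"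
  shows "Determinant.det (submatrix (mat m n (\<lambda>(i, j). A i j)) I K) = 0 \<longleftrightarrow>
    (\<exists>z. (\<exists>j\<in>K. z j \<noteq> 0) \<and> (\<forall>k\<in>I. (\<Sum>j\<in>K. A k j * z j) = 0))"
proof -
  have fin: "finite I" "finite K" using assms finite_subset by auto
  have I: "{i. i < m \<and> i \<in> I} = I" and K: "{i. i < n \<and> i \<in> K} = K" using assms by auto
  have pI: "pick I a < m" "pick K a < n" if "a < card K" for a
    using bij_betw_pick[OF fin(1)] bij_betw_pick[OF fin(2)] assms that by (auto simp: bij_betw_def)
  have "submatrix (mat m n (\<lambda>(i, j). A i j)) I K = mat (card K) (card K) (\<lambda>(a, b). A (pick I a) (pick K b))"
    by (rule eq_matI) (use assms pI in \<open>auto simp: submatrix_def I K\<close>)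
  then show ?thesis
    using det_eq_0_iff_sum[of "pick I" "card K" I "pick K" K A] bij_betw_pick[OF fin(1)] bij_betw_pick[OF fin(2)] assms
    by simp
qed

text \<open>Take a nonvanishing minor of maximal size s. Bordering it by row k and any column gives
  a vanishing determinant, and expansion along the new column expresses a nonzero multiple of row k
  by the s chosen rows, with coefficients independent of the column.\<close>

lemma minors_vanish_imp_row_relations:
  fixes A :: "nat \<Rightarrow> nat \<Rightarrow> 'a::idom"
  assumes minors: "\<And>I K. I \<subseteq> {..<m} \<Longrightarrow> K \<subseteq> {..<n} \<Longrightarrow> card I = Suc r \<Longrightarrow> card K = Suc r \<Longrightarrow>
      Determinant.det (submatrix (mat m n (\<lambda>(i, j). A i j)) I K) = 0"
  obtains s f where "s \<le> r" "\<And>i. i < s \<Longrightarrow> f i < m"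
    "\<And>x k. (\<And>i. i < s \<Longrightarrow> (\<Sum>j<n. A (f i) j * x j) = 0) \<Longrightarrow> k < m \<Longrightarrow> (\<Sum>j<n. A k j * x j) = 0"
proof -
  define M where "M s f g = mat s s (\<lambda>(a, b). A (f a) (g b))" for s and f g :: "nat \<Rightarrow> nat"
  have Mc: "M s f g \<in> carrier_mat s s" for s f g by (simp add: M_def)
  \<comment> \<open>Rows and columns are picked by arbitrary functions, so bordered matrices need no
    case distinction for repeated indices; a repetition only makes the determinant vanish.\<close>
  define good where "good s \<longleftrightarrow> (\<exists>f g. (\<forall>i<s. f i < m \<and> g i < n) \<and> Determinant.det (M s f g) \<noteq> 0)" for s
  have bad: "\<not> good (Suc r)"
  proof
    assume "good (Suc r)"
    then obtain f g where fg: "\<forall>i<Suc r. f i < m \<and> g i < n" "Determinant.det (M (Suc r) f g) \<noteq> 0"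
      unfolding good_def by blast
    have "inj_on f {..<Suc r}"
    proof (rule inj_onI, rule ccontr)
      fix a b assume ab: "a \<in> {..<Suc r}" "b \<in> {..<Suc r}" "f a = f b" "a \<noteq> b"
      then have "Determinant.det (M (Suc r) f g) = 0"
        by (intro det_identical_rows[OF Mc, of a b]) (auto simp: M_def)
      with fg show False by simp
    qed
    moreover have "inj_on g {..<Suc r}"
    proof (rule inj_onI, rule ccontr)
      fix a b assume ab: "a \<in> {..<Suc r}" "b \<in> {..<Suc r}" "g a = g b" "a \<noteq> b"
      then have "Determinant.det (M (Suc r) f g) = 0"
        by (intro det_identical_columns[OF Mc, of a b]) (auto simp: M_def)
      with fg show False by simp
    qed
    ultimately have bij: "bij_betw f {..<Suc r} (f ` {..<Suc r})" "bij_betw g {..<Suc r} (g ` {..<Suc r})"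
      and card: "card (f ` {..<Suc r}) = Suc r" "card (g ` {..<Suc r}) = Suc r"
      by (auto simp: bij_betw_def card_image simp del: image_Suc_lessThan)
    have sub: "f ` {..<Suc r} \<subseteq> {..<m}" "g ` {..<Suc r} \<subseteq> {..<n}" using fg(1) by auto
    have "Determinant.det (M (Suc r) f g) = 0"
      using minors[OF sub card] det_submatrix_eq_0_iff[OF sub, of A] det_eq_0_iff_sum[OF bij, of A] card
      unfolding M_def by simp
    with fg show False by simp
  qed
  have "good 0" unfolding good_def using det_dim_zero[OF Mc] by fastforce
  define s where "s = (GREATEST s. good s \<and> s \<le> r)"
  have s: "good s \<and> s \<le> r"
    unfolding s_def by (rule GreatestI_nat[where b = r and k = 0]) (use \<open>good 0\<close> in auto)
  have nots: "\<not> good (Suc s)"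
  proof
    assume g: "good (Suc s)"
    show False
    proof (cases "s = r")
      case True
      with g bad show False by simp
    next
      case False
      then have "Suc s \<le> s"
        unfolding s_def[symmetric] using g s Greatest_le_nat[where P = "\<lambda>s. good s \<and> s \<le> r" and b = r and k = "Suc s"]
        by (simp add: s_def[symmetric])
      then show False by simp
    qed
  qed
  obtain f g where fg: "\<forall>i<s. f i < m \<and> g i < n" "Determinant.det (M s f g) \<noteq> 0"
    using s unfolding good_def by blast
  show thesis
  proof
    show "s \<le> r" using s by simp
    show "f i < m" if "i < s" for i using fg(1) that by simp
    fix x k assume x: "\<And>i. i < s \<Longrightarrow> (\<Sum>j<n. A (f i) j * x j) = 0" and k: "k < m"
    define f' where "f' = f(s := k)"
    define g' where "g' j = g(s := j)" for j
    \<comment> \<open>Cofactors along the last column ignore its entries, so the choice of column 0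
      is immaterial.\<close>
    define cf where "cf i = cofactor (M (Suc s) f' (g' 0)) i s" for i
    have cf: "cofactor (M (Suc s) f' (g' j)) i s = cf i" for i j
    proof -
      have "mat_delete (M (Suc s) f' (g' j)) i s = mat_delete (M (Suc s) f' (g' 0)) i s"
        by (rule eq_matI) (auto simp: mat_delete_def M_def g'_def)
      then show ?thesis by (simp add: cf_def cofactor_def)
    qed
    have exp: "(\<Sum>i<Suc s. A (f' i) j * cf i) = 0" if j: "j < n" for j
    proof -
      have "\<forall>i<Suc s. f' i < m \<and> g' j i < n" using fg(1) k j by (auto simp: f'_def g'_def less_Suc_eq)
      then have "Determinant.det (M (Suc s) f' (g' j)) = 0" using nots unfolding good_def by blast
      then have "(\<Sum>i<Suc s. M (Suc s) f' (g' j) $$ (i, s) * cf i) = 0"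
        using laplace_expansion_column[OF Mc, of s "Suc s" f' "g' j"] by (simp add: cf del: sum.lessThan_Suc)
      moreover have "(\<Sum>i<Suc s. M (Suc s) f' (g' j) $$ (i, s) * cf i) = (\<Sum>i<Suc s. A (f' i) j * cf i)"
        by (rule sum.cong) (auto simp: M_def g'_def)
      ultimately show ?thesis by simp
    qed
    have "mat_delete (M (Suc s) f' (g' 0)) s s = M s f g"
      by (rule eq_matI) (auto simp: mat_delete_def M_def f'_def g'_def)
    then have cs: "cf s \<noteq> 0" using fg(2) by (simp add: cf_def cofactor_def)
    have "0 = (\<Sum>j<n. (\<Sum>i<Suc s. A (f' i) j * cf i) * x j)" using exp by simp
    also have "\<dots> = (\<Sum>i<Suc s. cf i * (\<Sum>j<n. A (f' i) j * x j))"
      unfolding sum_distrib_right sum_distrib_left by (subst sum.swap) (simp add: mult_ac)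
    also have "\<dots> = (\<Sum>i<s. cf i * (\<Sum>j<n. A (f i) j * x j)) + cf s * (\<Sum>j<n. A k j * x j)"
      by (simp add: f'_def)
    also have "\<dots> = cf s * (\<Sum>j<n. A k j * x j)" using x by simp
    finally show "(\<Sum>j<n. A k j * x j) = 0" using cs by simp
  qed
qed

section \<open>The Alexander matrix\<close>

lemma Dm_empty_mult: "Dm {#} (f * g) = Dm {#} f * Dm {#} g"
  by (induction f rule: frag_cases)
    (auto simp: Dm_empty_frag_of_mult mcoef_def left_diff_distrib Dm_diff)

lemma Dm_empty_1 [simp]: "Dm {#} 1 = 1"
  using Dm_frag_of[of "{#}" 0] by (simp add: frag_of_zero mcoef_def)

lemma Dm_empty_hom: "comm_ring_hom (Dm {#})"
  by unfold_locales (auto simp: Dm_empty_mult Dm_add)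

lemma Dm_empty_of_int [simp]: "Dm {#} (of_int n) = n"
proof -
  interpret comm_ring_hom "Dm {#}" by (rule Dm_empty_hom)
  show ?thesis by (simp add: hom_of_int)
qed

lemma weval_free_Abelian_group:
  assumes "\<And>y. y \<in> fst ` set w \<Longrightarrow> keys (\<alpha> y) \<subseteq> S"
  shows "weval (free_Abelian_group S) \<alpha> w = wsum \<alpha> w"
  using assms
proof (induction w)
  case (Cons a w)
  then show ?case by (cases a) (auto simp: wletter_def)
qed simp

lemma hom_wsum:
  assumes "h \<in> hom (free_group X) (free_Abelian_group S)" "w \<in> carrier (free_group X)"
  shows "h w = wsum (\<lambda>y. h (gen y)) w"
proof -
  have "h w = weval (free_Abelian_group S) (h \<circ> gen) w"
    by (rule hom_free_group_weval) (use assms in auto)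
  also have "\<dots> = wsum (h \<circ> gen) w"
  proof (rule weval_free_Abelian_group)
    fix y assume "y \<in> fst ` set w"
    then have "gen y \<in> carrier (free_group X)" using assms(2) by (auto simp: carrier_free_group[of w])
    then show "keys ((h \<circ> gen) y) \<subseteq> S" using assms(1) by (auto simp: hom_def Pi_iff)
  qed
  finally show ?thesis by (simp add: o_def)
qed

lemma (in group) normal_closure_subset:
  assumes "subgroup K G" "R \<subseteq> K" "\<And>g r. g \<in> carrier G \<Longrightarrow> r \<in> R \<Longrightarrow> g \<otimes> r \<otimes> inv g \<in> K"
  shows "normal_closure G R \<subseteq> K"
  unfolding normal_closure_def by (rule generate_subgroup_incl) (use assms in auto)

lemma (in group) normal_closure_normal:
  assumes "R \<subseteq> carrier G" shows "normal_closure G R \<lhd> G"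
  unfolding normal_closure_def
proof (rule normal_generateI)
  show "{g \<otimes> r \<otimes> inv g |g r. g \<in> carrier G \<and> r \<in> R} \<subseteq> carrier G" using assms by auto
  fix h k assume h: "h \<in> {g \<otimes> r \<otimes> inv g |g r. g \<in> carrier G \<and> r \<in> R}" and k: "k \<in> carrier G"
  then obtain g r where gr: "g \<in> carrier G" "r \<in> R" "h = g \<otimes> r \<otimes> inv g" by blast
  then have "k \<otimes> h \<otimes> inv k = (k \<otimes> g) \<otimes> r \<otimes> inv (k \<otimes> g)"
    using k assms by (auto simp: group_nf)
  then show "k \<otimes> h \<otimes> inv k \<in> {g \<otimes> r \<otimes> inv g |g r. g \<in> carrier G \<and> r \<in> R}"
    using gr k by blast
qed

text \<open>Replaces the isomorphism from the presented group by the resulting map p on words. The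
  same interface serves the given presentation and the one read off from a link diagram.\<close>

locale presentation = p: group_hom "free_group X" G p
  for X :: "'x set" and R :: "'x word set" and G :: "('a, 'b) monoid_scheme" and p :: "'x word \<Rightarrow> 'a" +
  assumes relators: "R \<subseteq> carrier (free_group X)"
    and surj: "p ` carrier (free_group X) = carrier G"
    and kernel_iff: "w \<in> carrier (free_group X) \<Longrightarrow> p w = \<one>\<^bsub>G\<^esub> \<longleftrightarrow> w \<in> normal_closure (free_group X) R"
begin

abbreviation "FX \<equiv> free_group X"

lemma relator_one: "r \<in> R \<Longrightarrow> p r = \<one>\<^bsub>G\<^esub>"
proof -
  assume r: "r \<in> R"
  then have "\<one>\<^bsub>FX\<^esub> \<otimes>\<^bsub>FX\<^esub> r \<otimes>\<^bsub>FX\<^esub> inv\<^bsub>FX\<^esub> \<one>\<^bsub>FX\<^esub> \<in> normal_closure FX R"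
    unfolding normal_closure_def by (intro generate.incl) blast
  then show ?thesis using r relators kernel_iff[of r] by auto
qed

lemma factor:
  assumes "group_hom FX H f" "\<And>r. r \<in> R \<Longrightarrow> f r = \<one>\<^bsub>H\<^esub>"
  obtains g where "group_hom G H g" "\<And>w. w \<in> carrier FX \<Longrightarrow> g (p w) = f w"
proof -
  interpret f: group_hom FX H f by fact
  have sub: "normal_closure FX R \<subseteq> kernel FX H f"
    by (rule p.G.normal_closure_subset[OF f.subgroup_kernel]) (use relators assms in \<open>auto simp: kernel_def\<close>)
  have wd: "f u = f v" if "u \<in> carrier FX" "v \<in> carrier FX" "p u = p v" for u v
  proof -
    have "u \<otimes>\<^bsub>FX\<^esub> inv\<^bsub>FX\<^esub> v \<in> normal_closure FX R"
      using that kernel_iff[of "u \<otimes>\<^bsub>FX\<^esub> inv\<^bsub>FX\<^esub> v"] by simp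
    then have "f u \<otimes>\<^bsub>H\<^esub> inv\<^bsub>H\<^esub> (f v) = \<one>\<^bsub>H\<^esub>" using sub that by (auto simp: kernel_def)
    then show ?thesis using that f.H.inv_equality[of "f u" "inv\<^bsub>H\<^esub> (f v)"] by simp
  qed
  define g where "g y = f (SOME w. w \<in> carrier FX \<and> p w = y)" for y
  have gp: "g (p w) = f w" if "w \<in> carrier FX" for w
  proof -
    have "(SOME v. v \<in> carrier FX \<and> p v = p w) \<in> carrier FX \<and> p (SOME v. v \<in> carrier FX \<and> p v = p w) = p w"
      by (rule someI[of _ w]) (use that in simp)
    then show ?thesis unfolding g_def using that by (intro wd) auto
  qed
  have "g \<in> hom G H"
  proof (rule homI)
    fix y assume "y \<in> carrier G"
    then obtain w where "w \<in> carrier FX" "y = p w" using surj by auto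
    then show "g y \<in> carrier H" using gp by simp
  next
    fix y z assume "y \<in> carrier G" "z \<in> carrier G"
    then have "y \<in> p ` carrier FX" "z \<in> p ` carrier FX" using surj by simp_all
    then obtain u v where "u \<in> carrier FX" "y = p u" "v \<in> carrier FX" "z = p v"
      by (elim imageE)
    then show "g (y \<otimes>\<^bsub>G\<^esub> z) = g y \<otimes>\<^bsub>H\<^esub> g z"
      using gp[of u] gp[of v] gp[of "u \<otimes>\<^bsub>FX\<^esub> v"] by simp
  qed
  then have "group_hom G H g"
    by (intro group_hom.intro group_hom_axioms.intro p.H.is_group f.H.is_group)
  with gp that show thesis by blast
qed

end

text \<open>Each step corrects the approximation in the next graded piece, using
  \<open>lcs_surj\<close>.\<close>

lemma (in group_hom) lcs_dense:
  assumes H: "\<And>y. y \<in> carrier H \<Longrightarrow> \<exists>x\<in>carrier G. y \<otimes>\<^bsub>H\<^esub> inv\<^bsub>H\<^esub> (h x) \<in> derived1 H"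
    and "q \<ge> 1" "y \<in> carrier H"
  shows "\<exists>x\<in>carrier G. y \<otimes>\<^bsub>H\<^esub> inv\<^bsub>H\<^esub> (h x) \<in> lcs H q"
  using assms(2)
proof (induction q rule: dec_induct)
  case base
  show ?case using assms(3) H.lcs_1 by (intro bexI[of _ "\<one>\<^bsub>G\<^esub>"]) auto
next
  case (step q)
  then obtain x where x: "x \<in> carrier G" "y \<otimes>\<^bsub>H\<^esub> inv\<^bsub>H\<^esub> (h x) \<in> lcs H q" by blast
  obtain x' where x': "x' \<in> lcs G q"
    "y \<otimes>\<^bsub>H\<^esub> inv\<^bsub>H\<^esub> (h x) \<otimes>\<^bsub>H\<^esub> inv\<^bsub>H\<^esub> (h x') \<in> lcs H (Suc q)"
    using lcs_surj[OF H step.hyps(1) x(2)] by blast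
  have x'c: "x' \<in> carrier G" using x' by (intro G.lcs_in_carrier)
  have "y \<otimes>\<^bsub>H\<^esub> inv\<^bsub>H\<^esub> (h (x' \<otimes>\<^bsub>G\<^esub> x)) = y \<otimes>\<^bsub>H\<^esub> inv\<^bsub>H\<^esub> (h x) \<otimes>\<^bsub>H\<^esub> inv\<^bsub>H\<^esub> (h x')"
    using x x'c assms(3) by (simp add: H.group_nf)
  then show ?case using x x' x'c by (intro bexI[of _ "x' \<otimes>\<^bsub>G\<^esub> x"]) auto
qed


lemma dfox_zero_if_derived:
  assumes "w \<in> derived1 (free_group X)" "finite X" "j \<in> X"
  shows "Dm {#} (dfox \<alpha> j w) = 0"
proof -
  interpret F: group "free_group X" by (rule group_free_group)
  have "dfox \<alpha> j w \<in> aug_fil (Suc 0)"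
    by (rule dfox_lcs(1)[OF assms(2,3)]) (use assms(1) in \<open>simp_all add: F.lcs_2\<close>)
  then show ?thesis by (simp add: aug_fil_1_iff)
qed

text \<open>The \<open>x i\<close> lift the standard basis of \<int>^\<mu> to G and the
  \<open>u i\<close> are words for them; for a general G they play the role of meridians.\<close>

locale alexander = presentation "{..<N}" "set rs" G p
  for N :: nat and rs :: "nat word list" and G :: "('a, 'b) monoid_scheme" and p :: "nat word \<Rightarrow> 'a" +
  fixes \<mu> :: nat and ab :: "'a \<Rightarrow> (nat \<Rightarrow>\<^sub>0 int)" and x :: "nat \<Rightarrow> 'a" and u :: "nat \<Rightarrow> nat word"
  assumes ab_hom: "ab \<in> hom G (free_Abelian_group {..<\<mu>})"
    and ab_kernel: "g \<in> carrier G \<Longrightarrow> ab g = 0 \<Longrightarrow> g \<in> derived1 G"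
    and u: "i < \<mu> \<Longrightarrow> u i \<in> carrier (free_group {..<N})"
    and pu: "i < \<mu> \<Longrightarrow> p (u i) = x i"
    and ab_x: "i < \<mu> \<Longrightarrow> ab (x i) = frag_of i"
begin

abbreviation "FN \<equiv> free_group {..<N}"
abbreviation "F\<mu> \<equiv> free_group {..<\<mu>}"

definition \<alpha> :: "nat \<Rightarrow> (nat \<Rightarrow>\<^sub>0 int)" where "\<alpha> j = ab (p (gen j))"

abbreviation \<alpha>i :: "nat \<Rightarrow> nat \<Rightarrow> int" where "\<alpha>i j i \<equiv> lookup (\<alpha> j) i"

abbreviation e :: "nat word \<Rightarrow> nat \<Rightarrow> int" where "e w j \<equiv> Dm {#} (dfox \<alpha> j w)"

definition A :: "nat \<Rightarrow> nat \<Rightarrow> laurent" where "A k j = dfox \<alpha> j (rs ! k)"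

definition C :: "nat \<Rightarrow> nat \<Rightarrow> laurent" where "C i j = dfox \<alpha> j (u i)"

lemma group_fag: "group (free_Abelian_group {..<\<mu>})"
  by simp

sublocale ab: group_hom G "free_Abelian_group {..<\<mu>}" ab
  by (intro group_hom.intro group_hom_axioms.intro p.H.is_group group_fag ab_hom)

declare ab.hom_inv [simp del]

lemma ab_mult: "g \<in> carrier G \<Longrightarrow> h \<in> carrier G \<Longrightarrow> ab (g \<otimes>\<^bsub>G\<^esub> h) = ab g + ab h"
  using ab.hom_mult by simp

lemma ab_inv: "g \<in> carrier G \<Longrightarrow> ab (inv\<^bsub>G\<^esub> g) = - ab g"
  using ab_mult[of "inv\<^bsub>G\<^esub> g" g] by (simp add: eq_neg_iff_add_eq_0)

lemma ab_keys: "g \<in> carrier G \<Longrightarrow> keys (ab g) \<subseteq> {..<\<mu>}"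
  using ab.hom_closed[of g] by simp

lemma ab_p: "w \<in> carrier FN \<Longrightarrow> ab (p w) = wsum \<alpha> w"
proof -
  assume w: "w \<in> carrier FN"
  have "ab \<circ> p \<in> hom FN (free_Abelian_group {..<\<mu>})"
    by (rule Group.hom_compose[OF p.homh ab_hom])
  from hom_wsum[OF this w] show ?thesis by (simp add: \<alpha>_def[abs_def])
qed

lemma x_carrier: "i < \<mu> \<Longrightarrow> x i \<in> carrier G"
  using p.hom_closed[OF u] pu by simp

lemma derived1_ab: "g \<in> derived1 G \<Longrightarrow> ab g = 0"
proof -
  assume g: "g \<in> derived1 G"
  interpret Z: comm_group "free_Abelian_group {..<\<mu>}" by (rule abelian_free_Abelian_group)
  have "ab g \<in> derived1 (free_Abelian_group {..<\<mu>})"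
    using ab.derived_mono_img[of "carrier G" "carrier (free_Abelian_group {..<\<mu>})"] g ab.hom_closed by blast
  then show ?thesis using Z.derived_eq_singleton[of "carrier (free_Abelian_group {..<\<mu>})"] by simp
qed

lemma relator_carrier: "k < length rs \<Longrightarrow> rs ! k \<in> carrier FN"
  using relators nth_mem by blast

lemma relator_wsum: "k < length rs \<Longrightarrow> wsum \<alpha> (rs ! k) = 0"
  using ab_p[OF relator_carrier, of k] relator_one[of "rs ! k"] by simp

lemma e_mult: "v \<in> carrier FN \<Longrightarrow> w \<in> carrier FN \<Longrightarrow> j < N \<Longrightarrow> e (v \<otimes>\<^bsub>FN\<^esub> w) j = e v j + e w j"
  by (simp add: dfox_mult Dm_add Dm_empty_frag_of_mult)

lemma e_one: "j < N \<Longrightarrow> e \<one>\<^bsub>FN\<^esub> j = 0"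
  by (simp add: one_free_group)

lemma e_inv: "w \<in> carrier FN \<Longrightarrow> j < N \<Longrightarrow> e (inv\<^bsub>FN\<^esub> w) j = - e w j"
  using e_mult[of "inv\<^bsub>FN\<^esub> w" w j] e_one by simp

lemma e_u: "i < \<mu> \<Longrightarrow> l < \<mu> \<Longrightarrow> (\<Sum>j<N. e (u i) j * \<alpha>i j l) = (if i = l then 1 else 0)"
proof -
  assume i: "i < \<mu>" and l: "l < \<mu>"
  have "frag_of i = wsum \<alpha> (u i)" using ab_p[OF u[OF i]] pu[OF i] ab_x[OF i] by simp
  also have "\<dots> = (\<Sum>j<N. frag_cmul (e (u i) j) (\<alpha> j))"
    by (rule wsum_dfox) (use u[OF i] in \<open>auto simp: carrier_free_group\<close>)
  finally have "lookup (frag_of i) l = (\<Sum>j<N. e (u i) j * \<alpha>i j l)"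
    by (simp add: lookup_sum)
  then show ?thesis by (simp split: if_splits)
qed

text \<open>The images of the generators span \<int>^\<mu>. The bound makes the truncated difference
  N - \<mu> a true one and excludes the unit ideal in
  \<open>elementary_ideal_zero_iff\<close>.\<close>

lemma \<mu>_le_N: "\<mu> \<le> N"
proof (rule ccontr)
  assume "\<not> \<mu> \<le> N"
  then have "card {..<N} < card {..<\<mu>}" by simp
  from homogeneous_solution[OF _ _ this, of "\<lambda>j i. \<alpha>i j i"] obtain y where
    y: "\<exists>i<\<mu>. y i \<noteq> 0" "\<forall>j<N. (\<Sum>i<\<mu>. \<alpha>i j i * y i) = 0" by auto
  have "y i = 0" if i: "i < \<mu>" for i
  proof -
    have "y i = (\<Sum>l<\<mu>. if l = i then y l else 0)" using i by simp
    also have "\<dots> = (\<Sum>l<\<mu>. (if i = l then 1 else 0) * y l)" by (rule sum.cong) auto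
    finally have "y i = (\<Sum>l<\<mu>. (if i = l then 1 else 0) * y l)" .
    also have "\<dots> = (\<Sum>l<\<mu>. (\<Sum>j<N. e (u i) j * \<alpha>i j l) * y l)"
      by (rule sum.cong) (use i e_u in auto)
    also have "\<dots> = (\<Sum>j<N. e (u i) j * (\<Sum>l<\<mu>. \<alpha>i j l * y l))"
      unfolding sum_distrib_right sum_distrib_left by (subst sum.swap) (simp add: mult.assoc)
    also have "\<dots> = 0" using y(2) by simp
    finally show ?thesis .
  qed
  then show False using y(1) by blast
qed

text \<open>Such a word differs from an element of the commutator subgroup by a product of
  conjugates of relators and their inverses, and exponent sums see neither commutators nor
  conjugation.\<close>

lemma e_relators:
  assumes "w \<in> carrier FN" "ab (p w) = 0"
  shows "\<exists>W. \<forall>j<N. e w j = (\<Sum>k<length rs. W k * e (rs ! k) j)"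
proof -
  define spn where "spn w \<longleftrightarrow> (\<exists>W. \<forall>j<N. e w j = (\<Sum>k<length rs. W k * e (rs ! k) j))" for w
  define S where "S = {w \<in> carrier FN. spn w}"
  have SI: "spn w" if "\<And>j. j < N \<Longrightarrow> e w j = (\<Sum>k<length rs. W k * e (rs ! k) j)" for W w
    using that unfolding spn_def by blast
  have S: "subgroup S FN"
  proof (rule p.G.subgroupI)
    show "S \<subseteq> carrier FN" by (auto simp: S_def)
    have "\<one>\<^bsub>FN\<^esub> \<in> S" unfolding S_def using SI[of "\<one>\<^bsub>FN\<^esub>" "\<lambda>_. 0"] e_one by auto
    then show "S \<noteq> {}" by blast
    fix a assume "a \<in> S"
    then obtain W where W: "a \<in> carrier FN" "\<And>j. j < N \<Longrightarrow> e a j = (\<Sum>k<length rs. W k * e (rs ! k) j)"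
      unfolding S_def spn_def by auto
    have "spn (inv\<^bsub>FN\<^esub> a)"
      by (rule SI[of _ "\<lambda>k. - W k"]) (use W in \<open>simp add: e_inv sum_negf\<close>)
    then show "inv\<^bsub>FN\<^esub> a \<in> S" using W by (simp add: S_def)
    fix b assume "b \<in> S"
    then obtain V where V: "b \<in> carrier FN" "\<And>j. j < N \<Longrightarrow> e b j = (\<Sum>k<length rs. V k * e (rs ! k) j)"
      unfolding S_def spn_def by auto
    have "spn (a \<otimes>\<^bsub>FN\<^esub> b)"
      by (rule SI[of _ "\<lambda>k. W k + V k"]) (use W V in \<open>simp add: e_mult sum.distrib distrib_right\<close>)
    then show "a \<otimes>\<^bsub>FN\<^esub> b \<in> S" using W V by (simp add: S_def)
  qed
  have conj: "g \<otimes>\<^bsub>FN\<^esub> r \<otimes>\<^bsub>FN\<^esub> inv\<^bsub>FN\<^esub> g \<in> S" if g: "g \<in> carrier FN" and r: "r \<in> set rs" for g r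
  proof -
    obtain k where k: "k < length rs" "r = rs ! k" using r by (auto simp: in_set_conv_nth)
    have rc: "r \<in> carrier FN" using r relators by auto
    have "spn (g \<otimes>\<^bsub>FN\<^esub> r \<otimes>\<^bsub>FN\<^esub> inv\<^bsub>FN\<^esub> g)"
    proof (rule SI[of _ "\<lambda>l. if l = k then 1 else 0"])
      fix j assume j: "j < N"
      have "(\<Sum>l<length rs. (if l = k then 1 else 0) * e (rs ! l) j) = (\<Sum>l<length rs. if l = k then e r j else 0)"
        by (rule sum.cong) (use k in auto)
      then show "e (g \<otimes>\<^bsub>FN\<^esub> r \<otimes>\<^bsub>FN\<^esub> inv\<^bsub>FN\<^esub> g) j = (\<Sum>l<length rs. (if l = k then 1 else 0) * e (rs ! l) j)"
        using g rc j k by (simp add: e_mult e_inv)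
    qed
    then show ?thesis using g rc by (simp add: S_def)
  qed
  have "r \<in> S" if r: "r \<in> set rs" for r
    using conj[OF p.G.one_closed r] r relators by auto
  then have nc: "normal_closure FN (set rs) \<subseteq> S"
    by (intro p.G.normal_closure_subset S conj) auto
  have "p w \<in> derived1 G" using assms by (intro ab_kernel) auto
  then have "p w \<in> p ` derived1 FN" using p.derived_img[of "carrier FN"] surj by simp
  then obtain c where c: "c \<in> derived1 FN" "p w = p c" by auto
  have cc: "c \<in> carrier FN" using c p.G.derived_in_carrier[of "carrier FN"] by auto
  have "w \<otimes>\<^bsub>FN\<^esub> inv\<^bsub>FN\<^esub> c \<in> S"
    using nc kernel_iff[of "w \<otimes>\<^bsub>FN\<^esub> inv\<^bsub>FN\<^esub> c"] c cc assms by auto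
  then obtain W where W: "\<And>j. j < N \<Longrightarrow> e (w \<otimes>\<^bsub>FN\<^esub> inv\<^bsub>FN\<^esub> c) j = (\<Sum>k<length rs. W k * e (rs ! k) j)"
    unfolding S_def spn_def by auto
  have "e w j = (\<Sum>k<length rs. W k * e (rs ! k) j)" if j: "j < N" for j
    using W[OF j] dfox_zero_if_derived[OF c(1) _, of j \<alpha>] j assms cc by (simp add: e_mult e_inv)
  then show ?thesis by blast
qed

text \<open>Generator j minus its projection to the span of the \<open>u i\<close> is trivial in
  \<int>^\<mu>, so \<open>e_relators\<close> applies. The identity of \<int>^N thus splits into a
  part from the relators and a part from the lifts, which is the origin of \<open>Y\<close>.\<close>

lemma W_exists:
  assumes j: "j < N"
  shows "\<exists>W. \<forall>l<N. (\<Sum>k<length rs. W k * e (rs ! k) l) + (\<Sum>i<\<mu>. \<alpha>i j i * e (u i) l) = (if j = l then 1 else 0)"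
proof -
  define L' where "L' w i = lookup (ab (p w)) i" for w i
  define L where "L w l = (if l < N then e w l else 0)" for w l
  have "\<exists>g\<in>carrier FN. \<forall>k\<in>UNIV. L g k = (\<Sum>i<\<mu>. \<alpha>i j i * L (u i) k) \<and> L' g k = (\<Sum>i<\<mu>. \<alpha>i j i * L' (u i) k)"
    by (rule p.G.additive_combination) (use u in \<open>auto simp: L_def L'_def e_mult ab_mult lookup_add\<close>)
  then obtain g where g: "g \<in> carrier FN" "\<And>k. L g k = (\<Sum>i<\<mu>. \<alpha>i j i * L (u i) k)"
    "\<And>k. L' g k = (\<Sum>i<\<mu>. \<alpha>i j i * L' (u i) k)" by blast
  have gj: "gen j \<in> carrier FN" using j by simp
  have "ab (p (gen j \<otimes>\<^bsub>FN\<^esub> inv\<^bsub>FN\<^esub> g)) = \<alpha> j - ab (p g)"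
    using g gj by (simp add: ab_mult ab_inv \<alpha>_def)
  also have "\<dots> = 0"
  proof -
    have "lookup (ab (p g)) l = \<alpha>i j l" for l
    proof -
      have "lookup (ab (p g)) l = (\<Sum>i<\<mu>. \<alpha>i j i * lookup (ab (p (u i))) l)"
        using g(3)[of l] unfolding L'_def .
      also have "\<dots> = (\<Sum>i<\<mu>. if i = l then \<alpha>i j l else 0)"
        by (rule sum.cong) (auto simp: pu ab_x)
      finally have "lookup (ab (p g)) l = (\<Sum>i<\<mu>. if i = l then \<alpha>i j l else 0)" .
      moreover have "\<not> l < \<mu> \<Longrightarrow> \<alpha>i j l = 0"
        using ab_keys[OF p.hom_closed[OF gj]] by (auto simp: \<alpha>_def in_keys_iff)
      ultimately show ?thesis by auto
    qed
    then have "ab (p g) = \<alpha> j" by (rule poly_mapping_eqI)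
    then show ?thesis by simp
  qed
  finally obtain W where W: "\<And>l. l < N \<Longrightarrow> e (gen j \<otimes>\<^bsub>FN\<^esub> inv\<^bsub>FN\<^esub> g) l = (\<Sum>k<length rs. W k * e (rs ! k) l)"
    using e_relators[of "gen j \<otimes>\<^bsub>FN\<^esub> inv\<^bsub>FN\<^esub> g"] g gj by auto
  have "e (gen j) l = (if j = l then 1 else 0)" for l by (simp add: gen_def)
  then have "(\<Sum>k<length rs. W k * e (rs ! k) l) + (\<Sum>i<\<mu>. \<alpha>i j i * e (u i) l) = (if j = l then 1 else 0)" if "l < N" for l
    using W[OF that] g(2)[of l] g(1) gj that by (simp add: e_mult e_inv L_def)
  then show ?thesis by blast
qed

definition W :: "nat \<Rightarrow> nat \<Rightarrow> int" where
  "W j = (SOME W. \<forall>l<N. (\<Sum>k<length rs. W k * e (rs ! k) l) + (\<Sum>i<\<mu>. \<alpha>i j i * e (u i) l) = (if j = l then 1 else 0))"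

lemma W: "j < N \<Longrightarrow> l < N \<Longrightarrow>
  (\<Sum>k<length rs. W j k * e (rs ! k) l) + (\<Sum>i<\<mu>. \<alpha>i j i * e (u i) l) = (if j = l then 1 else 0)"
  unfolding W_def using someI_ex[OF W_exists] by blast

text \<open>The matrix \<open>Y\<close> is congruent to the identity modulo the augmentation ideal, so it is
  invertible after localization. Then \<open>U / \<delta>\<close> is the only candidate for the matrix of the crossed
  homomorphisms \<open>G \<rightarrow> \<Lambda>\<^sup>\<mu>\<close> taking the \<open>x i\<close> to the standard basis.\<close>

definition Y :: "nat \<Rightarrow> nat \<Rightarrow> laurent" where
  "Y j l = (\<Sum>k<length rs. of_int (W j k) * A k l) + (\<Sum>i<\<mu>. of_int (\<alpha>i j i) * C i l)"

definition \<delta> :: laurent where "\<delta> = Determinant.det (mat N N (\<lambda>(j, l). Y j l))"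

definition Badj :: "nat \<Rightarrow> nat \<Rightarrow> laurent" where
  "Badj j l = adj_mat (mat N N (\<lambda>(j, l). Y j l)) $$ (j, l)"

definition U :: "nat \<Rightarrow> nat \<Rightarrow> laurent" where
  "U j i = (\<Sum>l<N. Badj j l * of_int (\<alpha>i l i))"

lemma \<delta>_aug: "\<delta> - 1 \<in> aug_fil (Suc 0)"
proof -
  interpret D: comm_ring_hom "Dm {#}" by (rule Dm_empty_hom)
  have "map_mat (Dm {#}) (mat N N (\<lambda>(j, l). Y j l)) = 1\<^sub>m N"
  proof (rule eq_matI)
    fix j l assume "j < dim_row (1\<^sub>m N :: int mat)" "l < dim_col (1\<^sub>m N :: int mat)"
    then have jl: "j < N" "l < N" by auto
    have "Dm {#} (Y j l) = (if j = l then 1 else 0)"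
      using W[OF jl] by (simp add: Y_def Dm_add Dm_sum Dm_empty_mult A_def C_def)
    then show "map_mat (Dm {#}) (mat N N (\<lambda>(j, l). Y j l)) $$ (j, l) = 1\<^sub>m N $$ (j, l)"
      using jl by simp
  qed auto
  then have "Dm {#} \<delta> = 1"
    unfolding \<delta>_def D.hom_det[symmetric] by simp
  then show ?thesis by (simp add: aug_fil_1_iff Dm_diff)
qed

lemma \<delta>_nonzero: "\<delta> \<noteq> 0"
  using \<delta>_aug by (auto simp: aug_fil_1_iff Dm_uminus)

lemma Badj_Y: "j < N \<Longrightarrow> l < N \<Longrightarrow> (\<Sum>k<N. Badj j k * Y k l) = (if j = l then \<delta> else 0)"
proof -
  assume jl: "j < N" "l < N"
  let ?Y = "mat N N (\<lambda>(j, l). Y j l)"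
  have Y: "?Y \<in> carrier_mat N N" by simp
  have "(adj_mat ?Y * ?Y) $$ (j, l) = (\<Sum>k<N. Badj j k * Y k l)"
    using jl adj_mat(1)[OF Y] by (simp add: scalar_prod_def atLeast0LessThan Badj_def)
  then show ?thesis using jl unfolding adj_mat(3)[OF Y] by (simp add: \<delta>_def split: if_splits)
qed

lemma Y_Badj: "j < N \<Longrightarrow> l < N \<Longrightarrow> (\<Sum>k<N. Y j k * Badj k l) = (if j = l then \<delta> else 0)"
proof -
  assume jl: "j < N" "l < N"
  let ?Y = "mat N N (\<lambda>(j, l). Y j l)"
  have Y: "?Y \<in> carrier_mat N N" by simp
  have "(?Y * adj_mat ?Y) $$ (j, l) = (\<Sum>k<N. Y j k * Badj k l)"
    using jl adj_mat(1)[OF Y] by (simp add: scalar_prod_def atLeast0LessThan Badj_def)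
  then show ?thesis using jl unfolding adj_mat(2)[OF Y] by (simp add: \<delta>_def split: if_splits)
qed

lemma Y_sum:
  "(\<Sum>l<N. Y j l * z l)
    = (\<Sum>k<length rs. of_int (W j k) * (\<Sum>l<N. A k l * z l)) + (\<Sum>i<\<mu>. of_int (\<alpha>i j i) * (\<Sum>l<N. C i l * z l))"
proof -
  have "(\<Sum>l<N. Y j l * z l) = (\<Sum>l<N. \<Sum>k<length rs. of_int (W j k) * A k l * z l)
      + (\<Sum>l<N. \<Sum>i<\<mu>. of_int (\<alpha>i j i) * C i l * z l)"
    by (simp add: Y_def distrib_right sum.distrib sum_distrib_right)
  then show ?thesis
    unfolding sum_distrib_left by (subst (asm) (1 2) sum.swap) (simp add: mult.assoc)
qed

lemma Badj_solve:
  assumes "j < N" shows "(\<Sum>k<N. Badj j k * (\<Sum>l<N. Y k l * z l)) = \<delta> * z j"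
proof -
  have "(\<Sum>k<N. Badj j k * (\<Sum>l<N. Y k l * z l)) = (\<Sum>l<N. (\<Sum>k<N. Badj j k * Y k l) * z l)"
    unfolding sum_distrib_left sum_distrib_right by (subst sum.swap) (simp add: mult.assoc)
  also have "\<dots> = (\<Sum>l<N. if l = j then \<delta> * z l else 0)"
    by (rule sum.cong) (use assms Badj_Y in auto)
  finally show ?thesis using assms by simp
qed

text \<open>If AV = 0 and CV = 1, then \<open>Y_sum\<close> gives YV = \<alpha>, and the adjugate of
  \<open>Y\<close> turns this into \<delta>V = U. Of the conditions on U / \<delta>, this combined
  one always holds; AU = 0 is what may fail.\<close>

lemma Y_U:
  assumes "j < N" shows "(\<Sum>l<N. Y j l * U l i) = \<delta> * of_int (\<alpha>i j i)"
proof -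
  have "(\<Sum>l<N. Y j l * U l i) = (\<Sum>k<N. (\<Sum>l<N. Y j l * Badj l k) * of_int (\<alpha>i k i))"
    unfolding U_def sum_distrib_left sum_distrib_right by (subst sum.swap) (simp add: mult.assoc)
  also have "\<dots> = (\<Sum>k<N. if k = j then \<delta> * of_int (\<alpha>i k i) else 0)"
    by (rule sum.cong) (use assms Y_Badj in auto)
  finally show ?thesis using assms by simp
qed

definition E0 :: bool where
  "E0 \<longleftrightarrow> (\<forall>k<length rs. \<forall>i<\<mu>. (\<Sum>j<N. A k j * U j i) = 0)"

text \<open>With AU = 0 the formula \<open>Y_U\<close> reads \<alpha>CU = \<delta>\<alpha>, and
  \<alpha> can be cancelled on the left because \<open>e_u\<close> provides a left inverse.\<close>

lemma C_U:
  assumes E0 and i: "i < \<mu>" and l: "l < \<mu>"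
  shows "(\<Sum>j<N. C l j * U j i) = (if l = i then \<delta> else 0)"
proof -
  define d where "d m = (\<Sum>j<N. C m j * U j i) - (if m = i then \<delta> else 0)" for m
  have d0: "(\<Sum>m<\<mu>. of_int (\<alpha>i j m) * d m) = 0" if j: "j < N" for j
  proof -
    have "(\<Sum>m<\<mu>. of_int (\<alpha>i j m) * (if m = i then \<delta> else 0)) = (\<Sum>m<\<mu>. if m = i then of_int (\<alpha>i j i) * \<delta> else 0)"
      by (rule sum.cong) auto
    also have "\<dots> = \<delta> * of_int (\<alpha>i j i)" using i by simp
    also have "\<dots> = (\<Sum>m<\<mu>. of_int (\<alpha>i j m) * (\<Sum>j<N. C m j * U j i))"
      using Y_U[OF j, of i] \<open>E0\<close> i by (simp add: Y_sum E0_def)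
    finally show ?thesis by (simp add: d_def right_diff_distrib sum_subtractf)
  qed
  have "d l = (\<Sum>m<\<mu>. if m = l then d m else 0)" using l by simp
  also have "\<dots> = (\<Sum>m<\<mu>. of_int (\<Sum>j<N. e (u l) j * \<alpha>i j m) * d m)"
    by (rule sum.cong) (use e_u l in auto)
  also have "\<dots> = (\<Sum>j<N. of_int (e (u l) j) * (\<Sum>m<\<mu>. of_int (\<alpha>i j m) * d m))"
    unfolding of_int_sum sum_distrib_left sum_distrib_right by (subst sum.swap) (simp add: mult.assoc)
  also have "\<dots> = 0" using d0 by simp
  finally show ?thesis by (simp add: d_def)
qed

definition minors_vanish :: bool where
  "minors_vanish \<longleftrightarrow> (\<forall>I K. I \<subseteq> {..<length rs} \<and> K \<subseteq> {..<N} \<and> card I = Suc (N - \<mu>) \<and> card K = Suc (N - \<mu>) \<longrightarrow>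
     Determinant.det (submatrix (mat (length rs) N (\<lambda>(k, j). A k j)) I K) = 0)"

text \<open>At most N - \<mu> rows of A matter. With the \<mu> rows of C they give at most N
  equations, so the system Az = 0, Cz = c e_i in z and the scalar c has a nonzero solution. Then
  \<delta>z is c times column i of U, and c cannot vanish.\<close>

lemma minors_vanish_imp_E0:
  assumes minors_vanish shows E0
proof -
  obtain s f where sf: "s \<le> N - \<mu>" "\<And>i. i < s \<Longrightarrow> f i < length rs"
    "\<And>z k. (\<And>i. i < s \<Longrightarrow> (\<Sum>j<N. A (f i) j * z j) = 0) \<Longrightarrow> k < length rs \<Longrightarrow> (\<Sum>j<N. A k j * z j) = 0"
    using minors_vanish_imp_row_relations[of "length rs" N "N - \<mu>" A] assms
    unfolding minors_vanish_def by blast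
  have "(\<Sum>j<N. A k j * U j i) = 0" if k: "k < length rs" and i: "i < \<mu>" for k i
  proof -
    \<comment> \<open>Unknown number N is the right-hand side: row i of C is equated to it, and the
      other rows of C to 0.\<close>
    define a where "a ev v = (if ev < s then (if v < N then A (f ev) v else 0)
        else (if v < N then C (ev - s) v else if ev - s = i then -1 else 0))" for ev v
    have "card {..<s + \<mu>} < card {..<Suc N}" using sf(1) \<mu>_le_N by simp
    from homogeneous_solution[OF _ _ this, of a] obtain z where
      z: "\<exists>v<Suc N. z v \<noteq> 0" "\<And>ev. ev < s + \<mu> \<Longrightarrow> (\<Sum>v<Suc N. a ev v * z v) = 0" by auto
    have "(\<Sum>v<N. A (f r) v * z v) = 0" if "r < s" for r
      using z(2)[of r] that by (simp add: a_def)
    then have Az: "(\<Sum>v<N. A k v * z v) = 0" if "k < length rs" for k using sf(3) that by blast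
    have Cz: "(\<Sum>v<N. C m v * z v) = (if m = i then z N else 0)" if "m < \<mu>" for m
      using z(2)[of "s + m"] that by (auto simp: a_def)
    have Yz: "(\<Sum>v<N. Y j v * z v) = of_int (\<alpha>i j i) * z N" for j
    proof -
      have "(\<Sum>m<\<mu>. of_int (\<alpha>i j m) * (\<Sum>v<N. C m v * z v)) = (\<Sum>m<\<mu>. if m = i then of_int (\<alpha>i j i) * z N else 0)"
        by (rule sum.cong) (auto simp: Cz)
      then show ?thesis using i by (simp add: Y_sum Az)
    qed
    have zj: "\<delta> * z j = z N * U j i" if "j < N" for j
    proof -
      have "\<delta> * z j = (\<Sum>k<N. Badj j k * (of_int (\<alpha>i k i) * z N))"
        unfolding Badj_solve[OF that, of z, symmetric] Yz ..
      also have "\<dots> = z N * U j i" by (simp add: U_def sum_distrib_left mult_ac)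
      finally show ?thesis .
    qed
    have zN: "z N \<noteq> 0"
    proof
      assume "z N = 0"
      then have "z j = 0" if "j < N" for j using zj[OF that] \<delta>_nonzero by simp
      then show False using z(1) \<open>z N = 0\<close> less_Suc_eq by auto
    qed
    have "z N * (\<Sum>j<N. A k j * U j i) = (\<Sum>j<N. A k j * (z N * U j i))"
      by (simp add: sum_distrib_left mult_ac)
    also have "\<dots> = (\<Sum>j<N. A k j * (\<delta> * z j))" by (rule sum.cong) (auto simp: zj)
    also have "\<dots> = \<delta> * (\<Sum>j<N. A k j * z j)" by (simp add: sum_distrib_left mult_ac)
    also have "\<dots> = 0" using Az k by simp
    finally show ?thesis using zN by simp
  qed
  then show ?thesis by (simp add: E0_def)
qed

text \<open>The columns of U lie in the kernel of A and are independent because CU = \<delta>. A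
  minor of size N - \<mu> + 1 leaves out \<mu> - 1 columns of A, so some nontrivial combination of
  the columns of U vanishes there and is a kernel vector of the submatrix.\<close>

lemma E0_imp_minors_vanish:
  assumes E0 shows minors_vanish
  unfolding minors_vanish_def
proof (intro allI impI, elim conjE)
  fix I K assume I: "I \<subseteq> {..<length rs}" and K: "K \<subseteq> {..<N}"
    and cI: "card I = Suc (N - \<mu>)" and cK: "card K = Suc (N - \<mu>)"
  have "card ({..<N} - K) < card {..<\<mu>}"
  proof -
    have "card K \<le> N" using card_mono[OF _ K] by simp
    moreover have "card ({..<N} - K) = N - card K" using K finite_subset by (subst card_Diff_subset) auto
    ultimately show ?thesis using cK \<mu>_le_N by simp
  qed
  from homogeneous_solution[OF _ _ this, of U] obtain y where
    y: "\<exists>i<\<mu>. y i \<noteq> 0" "\<And>j. j < N \<Longrightarrow> j \<notin> K \<Longrightarrow> (\<Sum>i<\<mu>. U j i * y i) = 0" by auto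
  define z where "z j = (\<Sum>i<\<mu>. U j i * y i)" for j
  have Mz: "(\<Sum>j<N. M j * z j) = (\<Sum>i<\<mu>. (\<Sum>j<N. M j * U j i) * y i)" for M
    unfolding z_def sum_distrib_left sum_distrib_right by (subst sum.swap) (simp add: mult.assoc)
  have "\<exists>j\<in>K. z j \<noteq> 0"
  proof (rule ccontr)
    assume "\<not> (\<exists>j\<in>K. z j \<noteq> 0)"
    then have z0: "z j = 0" if "j < N" for j using y(2) that by (auto simp: z_def)
    have "\<delta> * y l = 0" if l: "l < \<mu>" for l
    proof -
      have "0 = (\<Sum>j<N. C l j * z j)" using z0 by simp
      also have "\<dots> = (\<Sum>i<\<mu>. if i = l then \<delta> * y i else 0)"
        unfolding Mz by (rule sum.cong) (use C_U[OF assms] l in auto)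
      finally show ?thesis using l by simp
    qed
    then show False using y(1) \<delta>_nonzero by auto
  qed
  moreover have "(\<Sum>j\<in>K. A k j * z j) = 0" if k: "k \<in> I" for k
  proof -
    have "(\<Sum>j\<in>K. A k j * z j) = (\<Sum>j<N. A k j * z j)"
      by (rule sum.mono_neutral_left) (use K y(2) in \<open>auto simp: z_def\<close>)
    also have "\<dots> = 0" unfolding Mz using assms k I by (auto simp: E0_def intro!: sum.neutral)
    finally show ?thesis .
  qed
  ultimately show "Determinant.det (submatrix (mat (length rs) N (\<lambda>(k, j). A k j)) I K) = 0"
    using det_submatrix_eq_0_iff[OF I K, of A] cI cK by auto
qed

section \<open>The map from the free group given by the lifts\<close>

definition \<phi> :: "nat word \<Rightarrow> 'a" where "\<phi> = weval G x"

lemma \<phi>_hom: "group_hom F\<mu> G \<phi>"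
  unfolding \<phi>_def
  by (intro group_hom.intro group_hom_axioms.intro group_free_group p.H.is_group p.H.weval_hom)
    (auto intro: x_carrier)

lemma ab_\<phi>: "w \<in> carrier F\<mu> \<Longrightarrow> ab (\<phi> w) = wsum frag_of w"
proof -
  assume w: "w \<in> carrier F\<mu>"
  interpret \<phi>: group_hom F\<mu> G \<phi> by (rule \<phi>_hom)
  have "ab \<circ> \<phi> \<in> hom F\<mu> (free_Abelian_group {..<\<mu>})"
    by (rule Group.hom_compose[OF \<phi>.homh ab_hom])
  from hom_wsum[OF this w] have "ab (\<phi> w) = wsum (\<lambda>y. ab (\<phi> (gen y))) w" by simp
  also have "\<dots> = wsum frag_of w"
  proof -
    have "fst ` set v \<subseteq> {..<\<mu>} \<Longrightarrow> wsum (\<lambda>y. ab (\<phi> (gen y))) v = wsum frag_of v" for v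
    proof (induction v)
      case (Cons a v)
      then show ?case by (cases a) (auto simp: \<phi>_def p.H.weval_gen x_carrier ab_x)
    qed simp
    then show ?thesis using w by (simp add: carrier_free_group)
  qed
  finally show ?thesis .
qed

lemma \<phi>_dense:
  assumes y: "y \<in> carrier G"
  shows "\<exists>w\<in>carrier F\<mu>. y \<otimes>\<^bsub>G\<^esub> inv\<^bsub>G\<^esub> (\<phi> w) \<in> derived1 G"
proof -
  interpret \<phi>: group_hom F\<mu> G \<phi> by (rule \<phi>_hom)
  have "\<exists>w\<in>carrier F\<mu>. ab (\<phi> w) = v" if "keys v \<subseteq> {..<\<mu>}" for v
    using that
  proof (induction v rule: frag_induction)
    case zero
    show ?case by (intro bexI[of _ "\<one>\<^bsub>F\<mu>\<^esub>"]) auto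
  next
    case (one i)
    then show ?case
      by (intro bexI[of _ "gen i"]) (auto simp: \<phi>_def p.H.weval_gen x_carrier ab_x)
  next
    case (diff a b)
    then obtain v w where "v \<in> carrier F\<mu>" "ab (\<phi> v) = a" "w \<in> carrier F\<mu>" "ab (\<phi> w) = b" by blast
    then show ?case by (intro bexI[of _ "v \<otimes>\<^bsub>F\<mu>\<^esub> inv\<^bsub>F\<mu>\<^esub> w"]) (auto simp: ab_mult ab_inv)
  qed
  then obtain w where w: "w \<in> carrier F\<mu>" "ab (\<phi> w) = ab y" using ab_keys[OF y] by blast
  then have "ab (y \<otimes>\<^bsub>G\<^esub> inv\<^bsub>G\<^esub> (\<phi> w)) = 0" using y by (simp add: ab_mult ab_inv)
  then have "y \<otimes>\<^bsub>G\<^esub> inv\<^bsub>G\<^esub> (\<phi> w) \<in> derived1 G" using y w by (intro ab_kernel) auto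
  then show ?thesis using w by blast
qed

text \<open>AU = 0 says that the crossed homomorphisms with values U on the generators kill the
  relators, so they descend to G. Restricted to the free group they are \<delta> times the Fox
  derivatives, and \<open>aug_fil_unit_cancel\<close> removes \<delta>.\<close>

lemma E0_imp_inj:
  assumes E0 and q: "q \<ge> 1" and w: "w \<in> carrier F\<mu>" and \<phi>w: "\<phi> w \<in> lcs G q"
  shows "w \<in> lcs F\<mu> q"
proof (cases "q = 1")
  case True
  interpret F: group F\<mu> by (rule group_free_group)
  show ?thesis using True w by (simp add: F.lcs_1)
next
  case False
  then obtain n where n: "q = Suc n" "n \<ge> 1" using q by (cases q) auto
  \<comment> \<open>\<open>magnus\<close> carries families indexed by all naturals; components
    beyond \<mu> are set to 0, since AU = 0 is known only for i < \<mu>.\<close>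
  define t where "t j = (\<alpha> j, \<lambda>i. if i < \<mu> then U j i else 0)" for j
  have T: "weval magnus t v = (wsum \<alpha> v, \<lambda>i. \<Sum>j<N. dfox \<alpha> j v * (if i < \<mu> then U j i else 0))"
    if "v \<in> carrier FN" for v
    using weval_magnus[of "{..<N}" v \<alpha> "\<lambda>j i. if i < \<mu> then U j i else 0"] that
    by (simp add: t_def[abs_def] carrier_free_group)
  have th: "group_hom FN magnus (weval magnus t)"
    by (intro group_hom.intro group_hom_axioms.intro p.G.is_group group_magnus T.weval_hom) auto
  have "weval magnus t r = \<one>\<^bsub>magnus\<^esub>" if r: "r \<in> set rs" for r
  proof -
    obtain k where k: "k < length rs" "r = rs ! k" using r by (auto simp: in_set_conv_nth)
    have "(\<Sum>j<N. dfox \<alpha> j r * (if i < \<mu> then U j i else 0)) = 0" for i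
      using \<open>E0\<close> k by (cases "i < \<mu>") (auto simp: E0_def A_def)
    then show ?thesis
      using T[of r] relator_wsum[OF k(1)] relator_carrier[OF k(1)] k by simp
  qed
  from factor[OF th this] obtain \<rho> where \<rho>: "group_hom G magnus \<rho>"
    "\<And>v. v \<in> carrier FN \<Longrightarrow> \<rho> (p v) = weval magnus t v" by blast
  interpret \<rho>: group_hom G magnus \<rho> by (rule \<rho>(1))
  have \<rho>x: "\<rho> (x l) = (frag_of l, \<lambda>i. if i = l then \<delta> else 0)" if l: "l < \<mu>" for l
  proof -
    have "\<rho> (x l) = (wsum \<alpha> (u l), \<lambda>i. \<Sum>j<N. dfox \<alpha> j (u l) * (if i < \<mu> then U j i else 0))"
      using \<rho>(2)[OF u[OF l]] pu[OF l] T[OF u[OF l]] by simp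
    moreover have "wsum \<alpha> (u l) = frag_of l" using ab_p[OF u[OF l]] pu[OF l] ab_x[OF l] by simp
    moreover have "(\<Sum>j<N. dfox \<alpha> j (u l) * (if i < \<mu> then U j i else 0)) = (if i = l then \<delta> else 0)" for i
      using C_U[OF \<open>E0\<close>, of i l] l by (cases "i < \<mu>") (auto simp: C_def)
    ultimately show ?thesis by simp
  qed
  have wS: "fst ` set w \<subseteq> {..<\<mu>}" using w by (simp add: carrier_free_group)
  have "\<rho> (\<phi> w) = weval magnus (\<rho> \<circ> x) w"
    unfolding \<phi>_def by (rule \<rho>.hom_weval) (use wS x_carrier in auto)
  also have "\<dots> = weval magnus (\<lambda>l. (frag_of l, \<lambda>i. if i = l then \<delta> else 0)) w"
    by (rule T.weval_cong) (use wS \<rho>x in auto)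
  also have "\<dots> = (wsum frag_of w, \<lambda>i. \<Sum>l<\<mu>. dfox frag_of l w * (if i = l then \<delta> else 0))"
    by (rule weval_magnus) (use wS in auto)
  finally have \<rho>w: "\<rho> (\<phi> w) = (wsum frag_of w, \<lambda>i. \<Sum>l<\<mu>. dfox frag_of l w * (if i = l then \<delta> else 0))" .
  have "\<rho> (\<phi> w) \<in> magnus_fil n"
    using \<rho>.lcs_img[OF q \<phi>w] lcs_magnus[OF n(2)] n by auto
  then have mem: "(\<Sum>l<\<mu>. dfox frag_of l w * (if i = l then \<delta> else 0)) \<in> aug_fil n" for i
    unfolding \<rho>w magnus_fil_def by simp
  have eq: "(\<Sum>l<\<mu>. dfox frag_of l w * (if i = l then \<delta> else 0)) = \<delta> * dfox frag_of i w" if "i < \<mu>" for i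
  proof -
    have "(\<Sum>l<\<mu>. dfox frag_of l w * (if i = l then \<delta> else 0)) = (\<Sum>l<\<mu>. if l = i then \<delta> * dfox frag_of l w else 0)"
      by (rule sum.cong) auto
    then show ?thesis using that by simp
  qed
  have "\<delta> * dfox frag_of i w \<in> aug_fil n" if "i < \<mu>" for i using mem[of i] unfolding eq[OF that] .
  then have "dfox frag_of i w \<in> aug_fil n" if "i < \<mu>" for i
    using aug_fil_unit_cancel[OF \<delta>_aug] that by blast
  then show ?thesis using mem_lcs_if_dfox[OF w] n by simp
qed

text \<open>Modulo the (n+1)-st term \<phi> has an inverse, represented by \<sigma>. Differentiating
  \<sigma> on the relators and on the \<open>u i\<close> gives a matrix d with Ad \<equiv> 0 and Cd
  \<equiv> 1 modulo I^n. Hence Yd \<equiv> \<alpha>, then \<delta>d \<equiv> U, and AU lies in I^n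
  for all n.\<close>

lemma inj_imp_E0:
  assumes inj: "\<And>q w. q \<ge> 1 \<Longrightarrow> w \<in> carrier F\<mu> \<Longrightarrow> \<phi> w \<in> lcs G q \<Longrightarrow> w \<in> lcs F\<mu> q"
  shows E0
proof -
  interpret \<phi>: group_hom F\<mu> G \<phi> by (rule \<phi>_hom)
  have "(\<Sum>j<N. A k j * U j i) \<in> aug_fil n" if k: "k < length rs" and i: "i < \<mu>" and n1: "n \<ge> 1" for k i n
  proof -
    let ?NG = "lcs G (Suc n)" and ?NF = "lcs F\<mu> (Suc n)"
    interpret N: normal ?NG G by (rule p.H.lcs_normal)
    interpret \<pi>: group_hom G "G Mod ?NG" "\<lambda>g. ?NG #>\<^bsub>G\<^esub> g" by (rule N.group_hom_coset)
    have "\<exists>w\<in>carrier F\<mu>. p (gen j) \<otimes>\<^bsub>G\<^esub> inv\<^bsub>G\<^esub> (\<phi> w) \<in> ?NG" if "j < N" for j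
      by (rule \<phi>.lcs_dense[OF \<phi>_dense]) (use that in auto)
    then obtain w where w: "\<And>j. j < N \<Longrightarrow> w j \<in> carrier F\<mu>"
      "\<And>j. j < N \<Longrightarrow> p (gen j) \<otimes>\<^bsub>G\<^esub> inv\<^bsub>G\<^esub> (\<phi> (w j)) \<in> ?NG" by metis
    define \<sigma> where "\<sigma> = weval F\<mu> w"
    interpret \<sigma>: group_hom FN F\<mu> \<sigma>
      unfolding \<sigma>_def
      by (intro group_hom.intro group_hom_axioms.intro p.G.is_group \<phi>.G.is_group \<phi>.G.weval_hom) (use w in auto)
    have cong: "?NG #>\<^bsub>G\<^esub> \<phi> (\<sigma> v) = ?NG #>\<^bsub>G\<^esub> p v" if v: "v \<in> carrier FN" for v
    proof -
      have vS: "fst ` set v \<subseteq> {..<N}" using v by (simp add: carrier_free_group)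
      have "?NG #>\<^bsub>G\<^esub> p v = weval (G Mod ?NG) (\<lambda>j. ?NG #>\<^bsub>G\<^esub> p (gen j)) v"
        using hom_free_group_weval[OF Group.hom_compose[OF p.homh \<pi>.homh] \<pi>.H.is_group v] by (simp add: o_def)
      also have "\<dots> = weval (G Mod ?NG) (\<lambda>j. ?NG #>\<^bsub>G\<^esub> \<phi> (w j)) v"
      proof (rule \<pi>.H.weval_cong)
        fix j assume "j \<in> fst ` set v"
        then have "j < N" using vS by auto
        then show "?NG #>\<^bsub>G\<^esub> p (gen j) = ?NG #>\<^bsub>G\<^esub> \<phi> (w j)" using w by (simp add: N.coset_eq_iff)
      qed
      also have "\<dots> = weval (G Mod ?NG) (\<lambda>j. ?NG #>\<^bsub>G\<^esub> \<phi> (\<sigma> (gen j))) v"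
        by (rule \<pi>.H.weval_cong) (use w vS in \<open>auto simp: \<sigma>_def \<phi>.G.weval_gen\<close>)
      also have "\<dots> = ?NG #>\<^bsub>G\<^esub> \<phi> (\<sigma> v)"
        using hom_free_group_weval[OF Group.hom_compose[OF Group.hom_compose[OF \<sigma>.homh \<phi>.homh] \<pi>.homh] \<pi>.H.is_group v]
        by (simp add: o_def)
      finally show ?thesis by simp
    qed
    have \<sigma>_mem: "\<sigma> v \<otimes>\<^bsub>F\<mu>\<^esub> inv\<^bsub>F\<mu>\<^esub> v' \<in> ?NF" if v: "v \<in> carrier FN" "v' \<in> carrier F\<mu>" "p v = \<phi> v'" for v v'
    proof -
      have "\<phi> (\<sigma> v) \<otimes>\<^bsub>G\<^esub> inv\<^bsub>G\<^esub> (p v) \<in> ?NG" using cong[OF v(1)] v(1) by (simp add: N.coset_eq_iff)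
      then show ?thesis using v by (intro inj) auto
    qed
    define d where "d j i = dfox frag_of i (w j)" for j i
    have \<sigma>_dfox: "dfox frag_of i (\<sigma> v) = (\<Sum>j<N. dfox \<alpha> j v * d j i)" if v: "v \<in> carrier FN" and i: "i < \<mu>" for v i
    proof -
      define \<tau> where "\<tau> = weval magnus (\<lambda>l. (frag_of l, \<lambda>m::nat. if l = i then 1 else (0::laurent)))"
      have \<tau>: "\<tau> y = (wsum frag_of y, \<lambda>m. dfox frag_of i y)" if "y \<in> carrier F\<mu>" for y
        unfolding \<tau>_def by (rule weval_magnus_1[of _ "{..<\<mu>}"]) (use that i in \<open>auto simp: carrier_free_group\<close>)
      interpret \<tau>: group_hom F\<mu> magnus \<tau>
        unfolding \<tau>_def
        by (intro group_hom.intro group_hom_axioms.intro \<phi>.G.is_group group_magnus T.weval_hom) auto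
      have vS: "fst ` set v \<subseteq> {..<N}" using v by (simp add: carrier_free_group)
      \<comment> \<open>The chain rule needs \<open>w j\<close> to have the exponent of generator j;
        this holds because n \<ge> 1 puts the error into the derived subgroup.\<close>
      have ww: "wsum frag_of (w j) = \<alpha> j" if j: "j < N" for j
      proof -
        have "p (gen j) \<otimes>\<^bsub>G\<^esub> inv\<^bsub>G\<^esub> (\<phi> (w j)) \<in> derived1 G"
          using w(2)[OF j] p.H.lcs_subset_derived1[of "Suc n"] n1 by auto
        then have "ab (p (gen j) \<otimes>\<^bsub>G\<^esub> inv\<^bsub>G\<^esub> (\<phi> (w j))) = 0" by (rule derived1_ab)
        then show ?thesis using w(1)[OF j] j by (simp add: ab_mult ab_inv \<alpha>_def ab_\<phi>)
      qed
      have "\<tau> (\<sigma> v) = weval magnus (\<tau> \<circ> w) v"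
        unfolding \<sigma>_def by (rule \<tau>.hom_weval) (use vS w in auto)
      also have "\<dots> = weval magnus (\<lambda>j. (\<alpha> j, \<lambda>m. d j i)) v"
        by (rule T.weval_cong) (use vS w \<tau> ww in \<open>auto simp: d_def\<close>)
      also have "\<dots> = (wsum \<alpha> v, \<lambda>m. \<Sum>j<N. dfox \<alpha> j v * d j i)"
        by (rule weval_magnus) (use vS in auto)
      finally show ?thesis using \<tau>[OF \<sigma>.hom_closed[OF v]] by (auto simp: fun_eq_iff)
    qed
    have NF_J: "dfox frag_of i y \<in> aug_fil n" "wsum (frag_of :: nat \<Rightarrow> _) y = 0" if "y \<in> ?NF" "i < \<mu>" for y i
      using dfox_lcs[of "{..<\<mu>}" i n y frag_of] that n1 by auto
    have Ad: "(\<Sum>j<N. A k j * d j i) \<in> aug_fil n" if k: "k < length rs" and i: "i < \<mu>" for k i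
    proof -
      have "p (rs ! k) = \<phi> \<one>\<^bsub>F\<mu>\<^esub>" using relator_one k by simp
      then have "\<sigma> (rs ! k) \<in> ?NF"
        using \<sigma>_mem[OF relator_carrier[OF k] \<phi>.G.one_closed] relator_carrier[OF k] by simp
      then have "dfox frag_of i (\<sigma> (rs ! k)) \<in> aug_fil n" using i by (rule NF_J(1))
      then show ?thesis unfolding \<sigma>_dfox[OF relator_carrier[OF k] i] A_def .
    qed
    have Cd: "(\<Sum>j<N. C l j * d j i) - (if l = i then 1 else 0) \<in> aug_fil n" if l: "l < \<mu>" and i: "i < \<mu>" for l i
    proof -
      let ?c = "\<sigma> (u l) \<otimes>\<^bsub>F\<mu>\<^esub> inv\<^bsub>F\<mu>\<^esub> (gen l)"
      have gl: "gen l \<in> carrier F\<mu>" using l by simp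
      have c: "?c \<in> ?NF"
        by (rule \<sigma>_mem) (use u[OF l] gl pu[OF l] l in \<open>auto simp: \<phi>_def p.H.weval_gen x_carrier\<close>)
      have "\<sigma> (u l) = ?c \<otimes>\<^bsub>F\<mu>\<^esub> gen l" using u[OF l] gl by (simp add: \<phi>.G.m_assoc)
      then have "dfox frag_of i (\<sigma> (u l)) = dfox frag_of i (?c \<otimes>\<^bsub>F\<mu>\<^esub> gen l)" by simp
      also have "\<dots> = dfox frag_of i ?c + frag_of (wsum frag_of ?c) * dfox frag_of i (gen l)"
        by (rule dfox_mult) (use u[OF l] gl i in auto)
      also have "\<dots> = dfox frag_of i ?c + (if l = i then 1 else 0)"
        using NF_J(2)[OF c i] by (simp add: frag_of_zero gen_def)
      finally have "(\<Sum>j<N. C l j * d j i) - (if l = i then 1 else 0) = dfox frag_of i ?c"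
        using \<sigma>_dfox[OF u[OF l] i] by (simp add: C_def)
      then show ?thesis using NF_J(1)[OF c i] by simp
    qed
    have Yd: "(\<Sum>l<N. Y j l * d l i) - of_int (\<alpha>i j i) \<in> aug_fil n" for j
    proof -
      have "of_int (\<alpha>i j i) = (\<Sum>m<\<mu>. if m = i then of_int (\<alpha>i j m) else 0 :: laurent)" using i by simp
      also have "\<dots> = (\<Sum>m<\<mu>. of_int (\<alpha>i j m) * (if m = i then 1 else 0))"
        by (rule sum.cong) auto
      finally have "(\<Sum>l<N. Y j l * d l i) - of_int (\<alpha>i j i)
        = (\<Sum>k<length rs. of_int (W j k) * (\<Sum>l<N. A k l * d l i))
          + (\<Sum>m<\<mu>. of_int (\<alpha>i j m) * ((\<Sum>l<N. C m l * d l i) - (if m = i then 1 else 0)))"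
        by (simp add: Y_sum right_diff_distrib sum_subtractf)
      also have "\<dots> \<in> aug_fil n"
        by (rule aug_fil_add; rule aug_fil_sum; rule aug_fil_mult) (use Ad Cd i in auto)
      finally show ?thesis .
    qed
    have dU: "\<delta> * d j i - U j i \<in> aug_fil n" if j: "j < N" for j
    proof -
      have "\<delta> * d j i - U j i = (\<Sum>k<N. Badj j k * ((\<Sum>l<N. Y k l * d l i) - of_int (\<alpha>i k i)))"
        using Badj_solve[OF j, of "\<lambda>l. d l i"] by (simp add: U_def right_diff_distrib sum_subtractf)
      also have "\<dots> \<in> aug_fil n" by (intro aug_fil_sum aug_fil_mult Yd)
      finally show ?thesis .
    qed
    have "(\<Sum>j<N. A k j * U j i) = \<delta> * (\<Sum>j<N. A k j * d j i) - (\<Sum>j<N. A k j * (\<delta> * d j i - U j i))"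
      by (simp add: sum_distrib_left right_diff_distrib sum_subtractf mult_ac)
    also have "\<dots> \<in> aug_fil n"
      by (intro aug_fil_diff aug_fil_mult Ad aug_fil_sum dU k i) simp
    finally show ?thesis .
  qed
  then have "(\<Sum>j<N. A k j * U j i) \<in> aug_fil n" if "k < length rs" "i < \<mu>" for k i n
    using that by (cases "n \<ge> 1") (auto simp: not_le)
  then show ?thesis unfolding E0_def using aug_fil_Inter by blast
qed

lemma chen_iff_minors:
  "(\<forall>q\<ge>1. chen_group G q \<cong> chen_group F\<mu> q) \<longleftrightarrow> minors_vanish"
proof
  interpret \<phi>: group_hom F\<mu> G \<phi> by (rule \<phi>_hom)
  assume "\<forall>q\<ge>1. chen_group G q \<cong> chen_group F\<mu> q"
  then have "\<And>q w. q \<ge> 1 \<Longrightarrow> w \<in> carrier F\<mu> \<Longrightarrow> \<phi> w \<in> lcs G q \<Longrightarrow> w \<in> lcs F\<mu> q"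
    using chen_iso_imp_inj[OF \<phi>_hom \<phi>_dense] by blast
  then show minors_vanish by (intro E0_imp_minors_vanish inj_imp_E0)
next
  interpret \<phi>: group_hom F\<mu> G \<phi> by (rule \<phi>_hom)
  assume minors_vanish
  then have E0 by (rule minors_vanish_imp_E0)
  show "\<forall>q\<ge>1. chen_group G q \<cong> chen_group F\<mu> q"
  proof (intro allI impI)
    fix q :: nat assume q: "1 \<le> q"
    have "chen_group F\<mu> q \<cong> chen_group G q"
      by (rule \<phi>.chen_group_iso[OF \<phi>_dense]) (use E0_imp_inj[OF \<open>E0\<close>, of "Suc q"] q in auto)
    moreover have "group (chen_group F\<mu> q)"
      using group_hom.axioms(2)[OF \<phi>.G.chen_group_hom[OF q]] .
    ultimately show "chen_group G q \<cong> chen_group F\<mu> q" by (rule group.iso_sym[rotated])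
  qed
qed

end

section \<open>Link groups\<close>

text \<open>The combinatorial data of a link diagram: component \<open>i < \<mu>\<close> has \<open>n i\<close> undercrossings, with
  overcrossing arc \<open>ov i j\<close> and sign \<open>sg i j\<close>.\<close>

locale link =
  fixes \<mu> :: nat and n :: "nat \<Rightarrow> nat" and ov :: "nat \<Rightarrow> nat \<Rightarrow> nat \<times> nat" and sg :: "nat \<Rightarrow> nat \<Rightarrow> int"
    and b :: "nat \<Rightarrow> nat"
  assumes ov: "i < \<mu> \<Longrightarrow> j < n i \<Longrightarrow> ov i j \<in> {(i, j). i < \<mu> \<and> j < max 1 (n i)}"
    and b: "i < \<mu> \<Longrightarrow> b i < max 1 (n i)"
begin

definition arcset :: "(nat \<times> nat) set" where "arcset = {(i, j). i < \<mu> \<and> j < max 1 (n i)}"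

text \<open>Crossings, partial longitudes and relations are formulated in an arbitrary group, since
  they are evaluated in the free group on the arcs, in G, in F and in quotients.\<close>

definition crs :: "('c, 'd) monoid_scheme \<Rightarrow> (nat \<times> nat \<Rightarrow> 'c) \<Rightarrow> nat \<Rightarrow> nat \<Rightarrow> 'c" where
  "crs H a i j = a (ov i j) [^]\<^bsub>H\<^esub> sg i j"

fun part :: "('c, 'd) monoid_scheme \<Rightarrow> (nat \<times> nat \<Rightarrow> 'c) \<Rightarrow> nat \<Rightarrow> nat \<Rightarrow> 'c" where
  "part H a i 0 = \<one>\<^bsub>H\<^esub>"
| "part H a i (Suc k) = part H a i k \<otimes>\<^bsub>H\<^esub> crs H a i ((b i + k) mod n i)"

definition wirt :: "('c, 'd) monoid_scheme \<Rightarrow> (nat \<times> nat \<Rightarrow> 'c) \<Rightarrow> bool" where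
  "wirt H a \<longleftrightarrow> (\<forall>i<\<mu>. \<forall>j<n i.
     inv\<^bsub>H\<^esub> (crs H a i j) \<otimes>\<^bsub>H\<^esub> a (i, j) \<otimes>\<^bsub>H\<^esub> crs H a i j = a (i, (j + 1) mod n i))"

lemma base_arc: "i < \<mu> \<Longrightarrow> (i, b i) \<in> arcset"
  using b by (simp add: arcset_def)

lemma ov_arc: "i < \<mu> \<Longrightarrow> j < n i \<Longrightarrow> ov i j \<in> arcset"
  using ov by (simp add: arcset_def)

lemma crs_carrier:
  assumes "group H" "\<And>c. c \<in> arcset \<Longrightarrow> a c \<in> carrier H" "i < \<mu>" "j < n i"
  shows "crs H a i j \<in> carrier H"
  unfolding crs_def by (intro group.int_pow_closed assms ov_arc)

lemma part_carrier:
  assumes "group H" "\<And>c. c \<in> arcset \<Longrightarrow> a c \<in> carrier H" "i < \<mu>" "k = 0 \<or> 0 < n i"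
  shows "part H a i k \<in> carrier H"
proof -
  interpret H: group H by fact
  show ?thesis using assms(4)
    by (induction k) (auto intro!: crs_carrier assms)
qed

lemma hom_crs:
  assumes "group_hom H K h" "\<And>c. c \<in> arcset \<Longrightarrow> a c \<in> carrier H" "i < \<mu>" "j < n i"
  shows "h (crs H a i j) = crs K (h \<circ> a) i j"
proof -
  interpret group_hom H K h by fact
  show ?thesis using assms(2)[OF ov_arc[OF assms(3,4)]]
    by (simp add: crs_def hom_int_pow)
qed

lemma hom_part:
  assumes "group_hom H K h" "\<And>c. c \<in> arcset \<Longrightarrow> a c \<in> carrier H" "i < \<mu>" "k = 0 \<or> 0 < n i"
  shows "h (part H a i k) = part K (h \<circ> a) i k"
proof -
  interpret group_hom H K h by fact
  show ?thesis using assms(4)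
  proof (induction k)
    case (Suc k)
    then have n: "0 < n i" by simp
    have "part H a i k \<in> carrier H" "crs H a i ((b i + k) mod n i) \<in> carrier H"
      using n by (auto intro!: part_carrier crs_carrier assms G.is_group)
    then show ?case using Suc n
      by (simp add: hom_crs[OF assms(1-3)] o_def)
  qed simp
qed

lemma crs_cong:
  "(\<And>c. c \<in> arcset \<Longrightarrow> a c = a' c) \<Longrightarrow> i < \<mu> \<Longrightarrow> j < n i \<Longrightarrow> crs H a i j = crs H a' i j"
  by (simp add: crs_def ov_arc)

lemma part_cong:
  assumes "\<And>c. c \<in> arcset \<Longrightarrow> a c = a' c" "i < \<mu>" "k = 0 \<or> 0 < n i"
  shows "part H a i k = part H a' i k"
  using assms(3)
proof (induction k)
  case (Suc k)
  then show ?case using crs_cong[of a a' i "(b i + k) mod n i" H] assms by simp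
qed simp

text \<open>Along the component each undercrossing conjugates by one more overcrossing letter; the
  accumulated conjugator is the partial longitude.\<close>

lemma wirt_conj:
  assumes H: "group H" and w: "wirt H a" and a: "\<And>c. c \<in> arcset \<Longrightarrow> a c \<in> carrier H"
    and i: "i < \<mu>" and n: "0 < n i"
  shows "a (i, (b i + k) mod n i) = inv\<^bsub>H\<^esub> (part H a i k) \<otimes>\<^bsub>H\<^esub> a (i, b i) \<otimes>\<^bsub>H\<^esub> part H a i k"
proof -
  interpret H: group H by fact
  have c: "crs H a i (m mod n i) \<in> carrier H" "part H a i k \<in> carrier H" for m k
    using n by (auto intro!: crs_carrier part_carrier H a i)
  have bi: "a (i, b i) \<in> carrier H" using a base_arc[OF i] by blast
  show ?thesis
  proof (induction k)
    case 0
    have "b i mod n i = b i" using b[OF i] n by simp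
    then show ?case using bi by simp
  next
    case (Suc k)
    let ?c = "crs H a i ((b i + k) mod n i)"
    have "a (i, (b i + Suc k) mod n i) = a (i, ((b i + k) mod n i + 1) mod n i)"
      by (simp add: mod_Suc_eq)
    also have "\<dots> = inv\<^bsub>H\<^esub> ?c \<otimes>\<^bsub>H\<^esub> a (i, (b i + k) mod n i) \<otimes>\<^bsub>H\<^esub> ?c"
      using w i n unfolding wirt_def by simp
    finally show ?case using c bi by (simp add: Suc.IH H.group_nf)
  qed
qed

lemma arc_index:
  assumes "i < \<mu>" "j < n i"
  obtains k where "k < n i" "j = (b i + k) mod n i"
proof -
  have bi: "b i < n i" using b[OF assms(1)] assms(2) by auto
  show thesis
  proof (cases "b i \<le> j")
    case True
    then show ?thesis using that[of "j - b i"] assms bi by simp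
  next
    case False
    have "(b i + (n i + j - b i)) mod n i = j" using assms bi by simp
    then show ?thesis using that[of "n i + j - b i"] assms bi False by simp
  qed
qed

end

lemma lcs_mod:
  assumes "group G" "q \<ge> 1"
  shows "lcs (G Mod lcs G q) q = {\<one>\<^bsub>G Mod lcs G q\<^esub>}"
proof -
  interpret group G by fact
  let ?N = "lcs G q"
  interpret N: normal ?N G by (rule lcs_normal)
  interpret \<pi>: group_hom G "G Mod ?N" "\<lambda>g. ?N #>\<^bsub>G\<^esub> g" by (rule N.group_hom_coset)
  have "lcs (G Mod ?N) q \<subseteq> (\<lambda>g. ?N #>\<^bsub>G\<^esub> g) ` ?N"
    by (rule \<pi>.lcs_img_surj[OF assms(2)]) (simp add: carrier_FactGroup)
  also have "\<dots> \<subseteq> {?N}" by (auto simp: N.rcos_const)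
  finally show ?thesis using subgroup.one_closed[OF \<pi>.H.lcs_subgroup[of q]] by auto
qed

lemma (in group_hom) int_pow_mod:
  assumes N: "N \<lhd> H" and "x \<in> carrier G" "y \<in> carrier G" "h x \<otimes>\<^bsub>H\<^esub> inv\<^bsub>H\<^esub> (h y) \<in> N"
  shows "h (x [^]\<^bsub>G\<^esub> (k::int)) \<otimes>\<^bsub>H\<^esub> inv\<^bsub>H\<^esub> (h (y [^]\<^bsub>G\<^esub> k)) \<in> N"
proof -
  interpret N: normal N H by fact
  interpret \<pi>: group_hom H "H Mod N" "\<lambda>g. N #>\<^bsub>H\<^esub> g" by (rule N.group_hom_coset)
  have "N #>\<^bsub>H\<^esub> h x = N #>\<^bsub>H\<^esub> h y" using assms by (simp add: N.coset_eq_iff)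
  then have "N #>\<^bsub>H\<^esub> h (x [^]\<^bsub>G\<^esub> k) = N #>\<^bsub>H\<^esub> h (y [^]\<^bsub>G\<^esub> k)"
    using assms by (simp add: hom_int_pow \<pi>.hom_int_pow)
  then show ?thesis using assms by (simp add: N.coset_eq_iff)
qed

text \<open>The universal property is needed only for the nilpotent quotients of the free group on the
  meridians, which fixes the type of \<open>H\<close>.\<close>

locale link_grp = link \<mu> n ov sg b + group G
  for \<mu> n ov sg b and G :: "('a, 'm) monoid_scheme" (structure) +
  fixes a :: "nat \<times> nat \<Rightarrow> 'a"
  assumes a: "c \<in> arcset \<Longrightarrow> a c \<in> carrier G"
    and wirt: "wirt G a"
    and generated: "g \<in> carrier G \<Longrightarrow> \<exists>w. fst ` set w \<subseteq> arcset \<and> g = weval G a w"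
    and universal: "group H \<Longrightarrow> (\<And>c. c \<in> arcset \<Longrightarrow> a' c \<in> carrier H) \<Longrightarrow> wirt H a' \<Longrightarrow>
      \<exists>h. group_hom G (H :: nat word set monoid) h \<and> (\<forall>c\<in>arcset. h (a c) = a' c)"
begin

abbreviation "F \<equiv> free_group {..<\<mu>}"

definition \<phi> :: "nat word \<Rightarrow> 'a" where "\<phi> = weval G (\<lambda>i. a (i, b i))"

sublocale \<phi>: group_hom F G \<phi>
  unfolding \<phi>_def
  by (intro group_hom.intro group_hom_axioms.intro group_free_group is_group weval_hom)
    (auto intro: a base_arc)

lemma \<phi>_gen: "i < \<mu> \<Longrightarrow> \<phi> (gen i) = a (i, b i)"
  unfolding \<phi>_def by (rule weval_gen) (auto intro: a base_arc)

lemma arc_conj: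
  assumes "i < \<mu>" "(i, j) \<in> arcset"
  shows "\<exists>g\<in>carrier G. a (i, j) = inv g \<otimes> a (i, b i) \<otimes> g"
proof (cases "n i = 0")
  case True
  then have "j = b i" using assms b[of i] by (auto simp: arcset_def)
  then show ?thesis using a[OF assms(2)] by (intro bexI[of _ "\<one>"]) auto
next
  case False
  then have "j < n i" using assms by (auto simp: arcset_def)
  then obtain k where "k < n i" "j = (b i + k) mod n i" using arc_index[OF assms(1)] by blast
  then have "a (i, j) = inv (part G a i k) \<otimes> a (i, b i) \<otimes> part G a i k"
    using wirt_conj[OF is_group wirt a assms(1), of k] False by simp
  moreover have "part G a i k \<in> carrier G"
    by (rule part_carrier[OF is_group a assms(1)]) (use False in simp_all)
  ultimately show ?thesis by blast
qed

text \<open>Arcs of one component are conjugate. Therefore the meridians generate G modulo its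
  derived subgroup, as \<open>\<phi>_dense\<close> needs.\<close>

lemma arc_meridian_mod:
  assumes "i < \<mu>" "(i, j) \<in> arcset"
  shows "a (i, j) \<otimes> inv (a (i, b i)) \<in> derived1 G"
proof -
  obtain g where g: "g \<in> carrier G" "a (i, j) = inv g \<otimes> a (i, b i) \<otimes> g" using arc_conj[OF assms] by blast
  have m: "a (i, b i) \<in> carrier G" by (intro a base_arc assms)
  have "a (i, j) \<otimes> inv (a (i, b i)) = gcomm G (inv g) (a (i, b i))"
    using g m by (simp add: gcomm_def)
  then show ?thesis using g m by (simp add: derived1_gcomm)
qed

lemma weval_mod_derived:
  assumes "fst ` set w \<subseteq> arcset"
  shows "weval G a w \<otimes> inv (\<phi> (weval F (\<lambda>c. gen (fst c)) w)) \<in> derived1 G"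
proof -
  interpret D: normal "derived1 G" G by (rule derived_self_is_normal)
  interpret \<pi>: group_hom G "G Mod derived1 G" "\<lambda>g. derived1 G #> g" by (rule D.group_hom_coset)
  have fc: "gen (fst c) \<in> carrier F" if "c \<in> arcset" for c using that by (auto simp: arcset_def)
  have wF: "weval F (\<lambda>c. gen (fst c)) w \<in> carrier F" using assms fc by (intro \<phi>.G.weval_closed) auto
  have wG: "weval G a w \<in> carrier G" using assms a by (intro weval_closed) auto
  have "derived1 G #> weval G a w = weval (G Mod derived1 G) ((\<lambda>g. derived1 G #> g) \<circ> a) w"
    by (rule \<pi>.hom_weval) (use assms a in auto)
  also have "\<dots> = weval (G Mod derived1 G) ((\<lambda>g. derived1 G #> g) \<circ> (\<phi> \<circ> (\<lambda>c. gen (fst c)))) w"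
  proof (rule \<pi>.H.weval_cong)
    fix c assume "c \<in> fst ` set w"
    then have c: "c \<in> arcset" using assms by blast
    obtain i j where ij: "c = (i, j)" "i < \<mu>" using c by (auto simp: arcset_def)
    have "a (i, b i) \<in> carrier G" by (intro a base_arc ij)
    then have "derived1 G #> a (i, j) = derived1 G #> a (i, b i)"
      using arc_meridian_mod[of i j] c ij a[OF c] by (simp add: D.coset_eq_iff)
    then show "((\<lambda>g. derived1 G #> g) \<circ> a) c = ((\<lambda>g. derived1 G #> g) \<circ> (\<phi> \<circ> (\<lambda>c. gen (fst c)))) c"
      using ij by (simp add: \<phi>_gen)
  qed
  also have "\<dots> = derived1 G #> weval G (\<phi> \<circ> (\<lambda>c. gen (fst c))) w"
    by (rule \<pi>.hom_weval[symmetric]) (use assms fc in auto)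
  also have "weval G (\<phi> \<circ> (\<lambda>c. gen (fst c))) w = \<phi> (weval F (\<lambda>c. gen (fst c)) w)"
    by (rule \<phi>.hom_weval[symmetric]) (use assms fc in auto)
  finally show ?thesis using wF wG by (simp add: D.coset_eq_iff)
qed

lemma \<phi>_dense:
  assumes "y \<in> carrier G"
  shows "\<exists>w\<in>carrier F. y \<otimes> inv (\<phi> w) \<in> derived1 G"
proof -
  obtain w where w: "fst ` set w \<subseteq> arcset" "y = weval G a w" using generated[OF assms] by blast
  have "weval F (\<lambda>c. gen (fst c)) w \<in> carrier F"
    using w by (intro \<phi>.G.weval_closed) (auto simp: arcset_def)
  then show ?thesis using weval_mod_derived[OF w(1)] w(2) by blast
qed

text \<open>In the application \<open>ex i\<close> is the exponent sum of component \<open>i\<close> in \<open>part G a i (n i)\<close>.\<close>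

definition lng :: "(nat \<Rightarrow> int) \<Rightarrow> nat \<Rightarrow> 'a" where
  "lng ex i = part G a i (n i) \<otimes> a (i, b i) [^] (- ex i)"

lemma part_n_carrier: "i < \<mu> \<Longrightarrow> part G a i (n i) \<in> carrier G"
  by (rule part_carrier[OF is_group a]) auto

lemma lng_carrier: "i < \<mu> \<Longrightarrow> lng ex i \<in> carrier G"
  unfolding lng_def using part_n_carrier a base_arc by simp

text \<open>After a full turn \<open>wirt_conj\<close> returns to the base arc; without
  undercrossings the product is empty.\<close>

lemma part_n_commutes:
  assumes "i < \<mu>"
  shows "part G a i (n i) \<otimes> a (i, b i) = a (i, b i) \<otimes> part G a i (n i)"
proof (cases "n i = 0")
  case True
  then show ?thesis using a[OF base_arc[OF assms]] by simp
next
  case False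
  let ?p = "part G a i (n i)"
  have m: "a (i, b i) \<in> carrier G" by (intro a base_arc assms)
  have p: "?p \<in> carrier G" by (rule part_n_carrier[OF assms])
  have "b i mod n i = b i" using b[OF assms] False by simp
  then have "a (i, b i) = inv ?p \<otimes> a (i, b i) \<otimes> ?p"
    using wirt_conj[OF is_group wirt a assms, of "n i"] False by simp
  then have "?p \<otimes> a (i, b i) = ?p \<otimes> (inv ?p \<otimes> a (i, b i) \<otimes> ?p)" by simp
  then show ?thesis using m p by (simp add: m_assoc l_cancel_inv)
qed

lemma lng_commutes:
  assumes "i < \<mu>"
  shows "a (i, b i) \<otimes> lng ex i = lng ex i \<otimes> a (i, b i)"
proof -
  let ?m = "a (i, b i)"
  have m: "?m \<in> carrier G" by (intro a base_arc assms)
  have p: "part G a i (n i) \<in> carrier G" by (rule part_n_carrier[OF assms])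
  have c: "?m [^] (- ex i) \<otimes> ?m = ?m \<otimes> ?m [^] (- ex i)"
    using int_pow_mult[OF m, of "- ex i" 1] int_pow_mult[OF m, of 1 "- ex i"] m by (simp add: add.commute)
  show ?thesis
    unfolding lng_def using m p part_n_commutes[OF assms] c
    by (metis int_pow_closed m_assoc)
qed

text \<open>The chain of relations in \<open>F / F\<^sub>q\<^sub>+\<^sub>1F''\<close> is Milnor's: the lifts \<open>a1\<close> of the arcs are
  conjugates of the generators by lifted partial longitudes.\<close>

lemma lng_imp_inj:
  assumes lng: "\<And>i. i < \<mu> \<Longrightarrow> lng ex i \<in> G_infinity G"
    and "q \<ge> 1" "w \<in> carrier F" "\<phi> w \<in> lcs G q"
  shows "w \<in> lcs F q"
  using assms(2-4)
proof (induction q arbitrary: w rule: dec_induct)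
  case base
  then show ?case by (simp add: \<phi>.G.lcs_1)
next
  case (step q)
  let ?NG = "lcs G q" and ?NF = "lcs F q"
  let ?N = "lcs F (Suc q)"
  have IH: "v \<in> ?NF" if "v \<in> carrier F" "\<phi> v \<in> ?NG" for v using step.IH that by blast
  interpret N: normal ?N F by (rule \<phi>.G.lcs_normal)
  interpret NG: normal ?NG G by (rule lcs_normal)
  define Q where "Q = F Mod ?N"
  define \<pi> where "\<pi> v = ?N #>\<^bsub>F\<^esub> v" for v
  interpret \<pi>: group_hom F Q \<pi> using N.group_hom_coset by (simp add: Q_def \<pi>_def[abs_def])
  interpret \<kappa>: group_hom G "G Mod ?NG" "\<lambda>g. ?NG #> g" by (rule NG.group_hom_coset)
  have central: "\<pi> v \<otimes>\<^bsub>Q\<^esub> z = z \<otimes>\<^bsub>Q\<^esub> \<pi> v" if v: "v \<in> ?NF" and z: "z \<in> carrier Q" for v z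
  proof -
    obtain y where y: "y \<in> carrier F" "z = \<pi> y" using z by (auto simp: Q_def carrier_FactGroup \<pi>_def)
    have vc: "v \<in> carrier F" by (rule \<phi>.G.lcs_in_carrier[OF v])
    have "gcomm F y v \<in> ?N" using step.hyps(1) y v by (intro \<phi>.G.lcs_gcomm)
    then have "\<pi> (gcomm F y v) = \<one>\<^bsub>Q\<^esub>" by (simp add: \<pi>_def Q_def N.rcos_const)
    then show ?thesis using y vc by (simp add: \<pi>.hom_gcomm \<pi>.H.gcomm_eq_one_iff)
  qed
  have "\<exists>v\<in>carrier F. a c \<otimes> inv (\<phi> v) \<in> ?NG" if "c \<in> arcset" for c
    by (rule \<phi>.lcs_dense[OF \<phi>_dense]) (use that a step.hyps in auto)
  then obtain wa where wa: "\<And>c. c \<in> arcset \<Longrightarrow> wa c \<in> carrier F"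
    "\<And>c. c \<in> arcset \<Longrightarrow> a c \<otimes> inv (\<phi> (wa c)) \<in> ?NG" by metis
  have wa_coset: "?NG #> \<phi> (wa c) = ?NG #> a c" if "c \<in> arcset" for c
  proof -
    have "?NG #> a c = ?NG #> \<phi> (wa c)" using wa[OF that] a[OF that] by (simp add: NG.coset_eq_iff)
    then show ?thesis by simp
  qed
  have F_grp: "group F" by (rule group_free_group)
  define pv where "pv i k = part F wa i k" for i k
  have pv: "pv i k \<in> carrier F" if "i < \<mu>" "k = 0 \<or> 0 < n i" for i k
    unfolding pv_def by (rule part_carrier[OF F_grp wa(1) that])
  have pv_coset: "?NG #> \<phi> (pv i k) = ?NG #> part G a i k" if i: "i < \<mu>" "k = 0 \<or> 0 < n i" for i k
  proof -
    have gh: "group_hom F (G Mod ?NG) ((\<lambda>g. ?NG #> g) \<circ> \<phi>)"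
      by (intro group_hom.intro group_hom_axioms.intro F_grp \<kappa>.H.is_group Group.hom_compose[OF \<phi>.homh \<kappa>.homh])
    have "?NG #> \<phi> (pv i k) = part (G Mod ?NG) (((\<lambda>g. ?NG #> g) \<circ> \<phi>) \<circ> wa) i k"
      using hom_part[OF gh wa(1) that] by (simp add: pv_def)
    also have "\<dots> = part (G Mod ?NG) ((\<lambda>g. ?NG #> g) \<circ> a) i k"
      by (rule part_cong[OF _ that]) (use wa_coset in simp)
    also have "\<dots> = ?NG #> part G a i k"
      by (rule hom_part[OF \<kappa>.group_hom_axioms a that, symmetric])
    finally show ?thesis .
  qed
  \<comment> \<open>The number of undercrossings from the base arc to arc (i, j). It is 0 on a
    component without undercrossings, where the partial longitude is empty.\<close>
  define ind where "ind i j = (if n i = 0 then 0 else (SOME k. k < n i \<and> j = (b i + k) mod n i))" for i j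
  have ind: "ind i j < n i \<and> j = (b i + ind i j) mod n i" if ij: "i < \<mu>" "j < n i" for i j
  proof -
    obtain k where k: "k < n i" "j = (b i + k) mod n i" using arc_index[OF ij] by blast
    have "(SOME k. k < n i \<and> j = (b i + k) mod n i) < n i
        \<and> j = (b i + (SOME k. k < n i \<and> j = (b i + k) mod n i)) mod n i"
      by (rule someI[of _ k]) (use k in simp)
    then show ?thesis using that by (simp add: ind_def)
  qed
  have ind_ok: "ind i j = 0 \<or> 0 < n i" for i j by (auto simp: ind_def)
  have arc_part: "a (i, j) = inv (part G a i (ind i j)) \<otimes> a (i, b i) \<otimes> part G a i (ind i j)"
    if i: "i < \<mu>" and ij: "(i, j) \<in> arcset" for i j
  proof (cases "n i = 0")
    case True
    then have "j = b i" using b[OF i] ij by (auto simp: arcset_def)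
    then show ?thesis using True a[OF ij] by (simp add: ind_def)
  next
    case False
    then have j: "j < n i" using ij by (auto simp: arcset_def)
    then show ?thesis using wirt_conj[OF is_group wirt a i, of "ind i j"] ind[OF i j] False by simp
  qed
  define a1 where "a1 c = inv\<^bsub>F\<^esub> (pv (fst c) (ind (fst c) (snd c))) \<otimes>\<^bsub>F\<^esub> gen (fst c) \<otimes>\<^bsub>F\<^esub> pv (fst c) (ind (fst c) (snd c))" for c
  have gn: "gen i \<in> carrier F" if "i < \<mu>" for i using that by simp
  have arc_fst: "fst c < \<mu>" if "c \<in> arcset" for c using that by (auto simp: arcset_def)
  have a1: "a1 c \<in> carrier F" if "c \<in> arcset" for c
    unfolding a1_def using pv[OF arc_fst[OF that] ind_ok] gn[OF arc_fst[OF that]] by simp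
  \<comment> \<open>In G modulo the q-th term both lifts become the arc c; the induction hypothesis
    transfers this to F.\<close>
  have a1_wa: "a1 c \<otimes>\<^bsub>F\<^esub> inv\<^bsub>F\<^esub> (wa c) \<in> ?NF" if c: "c \<in> arcset" for c
  proof -
    obtain i j where ij: "c = (i, j)" "i < \<mu>" using c by (auto simp: arcset_def)
    let ?p = "part G a i (ind i j)"
    have p: "?p \<in> carrier G" by (rule part_carrier[OF is_group a ij(2) ind_ok])
    have m: "a (i, b i) \<in> carrier G" by (intro a base_arc ij)
    have "?NG #> \<phi> (a1 c) = inv\<^bsub>G Mod ?NG\<^esub> (?NG #> \<phi> (pv i (ind i j))) \<otimes>\<^bsub>G Mod ?NG\<^esub> (?NG #> a (i, b i))
        \<otimes>\<^bsub>G Mod ?NG\<^esub> (?NG #> \<phi> (pv i (ind i j)))"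
      using pv[OF ij(2) ind_ok] gn[OF ij(2)] m unfolding a1_def ij(1)
      by (simp add: \<phi>_gen[OF ij(2)] del: Coset.mult_FactGroup)
    also have "\<dots> = ?NG #> (inv ?p \<otimes> a (i, b i) \<otimes> ?p)"
      using p m unfolding pv_coset[OF ij(2) ind_ok] by (simp del: Coset.mult_FactGroup)
    also have "\<dots> = ?NG #> \<phi> (wa c)"
      using arc_part[of i j] c ij wa_coset[OF c] by simp
    finally have "\<phi> (a1 c \<otimes>\<^bsub>F\<^esub> inv\<^bsub>F\<^esub> (wa c)) \<in> ?NG"
      using a1[OF c] wa(1)[OF c] by (simp add: NG.coset_eq_iff)
    then show ?thesis using a1[OF c] wa(1)[OF c] by (intro IH) auto
  qed
  have crs_ratio: "crs F a1 i j \<otimes>\<^bsub>F\<^esub> inv\<^bsub>F\<^esub> (crs F wa i j) \<in> ?NF" if ij: "i < \<mu>" "j < n i" for i j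
  proof -
    interpret id: group_hom F F "\<lambda>v. v" by (unfold_locales) (simp add: hom_def)
    show ?thesis unfolding crs_def
      by (rule id.int_pow_mod[OF \<phi>.G.lcs_normal a1 wa(1) a1_wa]) (intro ov_arc ij)+
  qed
  have crsc: "crs F a1 i j \<in> carrier F" "crs F wa i j \<in> carrier F" if "i < \<mu>" "j < n i" for i j
    by (rule crs_carrier[OF F_grp a1 that], assumption) (rule crs_carrier[OF F_grp wa(1) that])
  \<comment> \<open>The lifts \<open>a1\<close> and \<open>wa\<close> agree only modulo the q-th
    term, but that term is central in Q, so conjugation by a crossing is the same for both. Here one
    level of precision is gained.\<close>
  have conj_eq: "inv\<^bsub>Q\<^esub> (\<pi> (crs F a1 i j)) \<otimes>\<^bsub>Q\<^esub> z \<otimes>\<^bsub>Q\<^esub> \<pi> (crs F a1 i j)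
      = inv\<^bsub>Q\<^esub> (\<pi> (crs F wa i j)) \<otimes>\<^bsub>Q\<^esub> z \<otimes>\<^bsub>Q\<^esub> \<pi> (crs F wa i j)"
    if ij: "i < \<mu>" "j < n i" and z: "z \<in> carrier Q" for i j z
  proof -
    let ?r = "crs F a1 i j \<otimes>\<^bsub>F\<^esub> inv\<^bsub>F\<^esub> (crs F wa i j)"
    let ?c = "\<pi> (crs F wa i j)"
    have r: "\<pi> ?r \<in> carrier Q" "?c \<in> carrier Q" using crsc[OF ij] by auto
    have eq: "\<pi> (crs F a1 i j) = \<pi> ?r \<otimes>\<^bsub>Q\<^esub> ?c"
      using crsc[OF ij] by (simp add: \<pi>.H.m_assoc)
    have "inv\<^bsub>Q\<^esub> (\<pi> ?r \<otimes>\<^bsub>Q\<^esub> ?c) \<otimes>\<^bsub>Q\<^esub> z \<otimes>\<^bsub>Q\<^esub> (\<pi> ?r \<otimes>\<^bsub>Q\<^esub> ?c)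
        = inv\<^bsub>Q\<^esub> ?c \<otimes>\<^bsub>Q\<^esub> (inv\<^bsub>Q\<^esub> (\<pi> ?r) \<otimes>\<^bsub>Q\<^esub> (z \<otimes>\<^bsub>Q\<^esub> \<pi> ?r)) \<otimes>\<^bsub>Q\<^esub> ?c"
      using r z by (simp only: \<pi>.H.m_assoc \<pi>.H.inv_mult_group \<pi>.H.m_closed \<pi>.H.inv_closed)
    also have "z \<otimes>\<^bsub>Q\<^esub> \<pi> ?r = \<pi> ?r \<otimes>\<^bsub>Q\<^esub> z"
      using central[OF crs_ratio[OF ij] z] by simp
    also have "inv\<^bsub>Q\<^esub> (\<pi> ?r) \<otimes>\<^bsub>Q\<^esub> (\<pi> ?r \<otimes>\<^bsub>Q\<^esub> z) = z" using r z by (simp only: \<pi>.H.l_cancel_inv')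
    finally show ?thesis unfolding eq .
  qed
  \<comment> \<open>The lifted longitude maps into the q-th term of G by the hypothesis on
    \<open>lng\<close>, so by induction it lies in the q-th term of F and is central in Q. The
    correcting power of \<open>gen i\<close> commutes with \<open>gen i\<close> anyway.\<close>
  have long: "\<pi> (gen i) = inv\<^bsub>Q\<^esub> (\<pi> (pv i (n i))) \<otimes>\<^bsub>Q\<^esub> \<pi> (gen i) \<otimes>\<^bsub>Q\<^esub> \<pi> (pv i (n i))" if i: "i < \<mu>" for i
  proof -
    let ?y = "pv i (n i) \<otimes>\<^bsub>F\<^esub> gen i [^]\<^bsub>F\<^esub> (- ex i)"
    have p: "pv i (n i) \<in> carrier F" by (rule pv[OF i]) auto
    have yc: "?y \<in> carrier F" using p gn[OF i] by simp
    have m: "a (i, b i) \<in> carrier G" by (intro a base_arc i)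
    have pc: "part G a i (n i) \<in> carrier G" by (rule part_n_carrier[OF i])
    have pv_n: "?NG #> \<phi> (pv i (n i)) = ?NG #> part G a i (n i)" by (rule pv_coset[OF i]) auto
    have "?NG #> \<phi> ?y = (?NG #> \<phi> (pv i (n i))) \<otimes>\<^bsub>G Mod ?NG\<^esub> (?NG #> (a (i, b i) [^] (- ex i)))"
      using p gn[OF i] m by (simp add: \<phi>.hom_int_pow \<phi>_gen[OF i] del: Coset.mult_FactGroup)
    also have "\<dots> = ?NG #> lng ex i"
      using pc m pv_n unfolding lng_def
      by (simp del: Coset.mult_FactGroup)
    finally have "?NG #> \<phi> ?y = ?NG #> lng ex i" .
    moreover have "lng ex i \<in> ?NG" using lng[OF i] step.hyps(1) by (auto simp: G_infinity_def)
    ultimately have "\<phi> ?y \<in> ?NG"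
      using yc coset_lcs_self[of "\<phi> ?y" q] coset_lcs_self[of "lng ex i" q] lng_carrier[OF i] by simp
    then have "?y \<in> ?NF" using yc by (intro IH)
    then have "\<pi> ?y \<otimes>\<^bsub>Q\<^esub> \<pi> (gen i) = \<pi> (gen i) \<otimes>\<^bsub>Q\<^esub> \<pi> ?y"
      by (rule central) (use gn[OF i] in simp)
    moreover define x where "x = \<pi> (gen i)"
    moreover define t where "t = \<pi> (pv i (n i))"
    ultimately have e: "t \<otimes>\<^bsub>Q\<^esub> x [^]\<^bsub>Q\<^esub> (- ex i) \<otimes>\<^bsub>Q\<^esub> x = x \<otimes>\<^bsub>Q\<^esub> (t \<otimes>\<^bsub>Q\<^esub> x [^]\<^bsub>Q\<^esub> (- ex i))"
      using p gn[OF i] by (simp add: \<pi>.hom_int_pow)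
    have xt: "x \<in> carrier Q" "t \<in> carrier Q" using p gn[OF i] by (auto simp: x_def t_def)
    let ?z = "x [^]\<^bsub>Q\<^esub> (- ex i)"
    have zc: "?z \<in> carrier Q" using xt by simp
    have "?z \<otimes>\<^bsub>Q\<^esub> x = x \<otimes>\<^bsub>Q\<^esub> ?z"
      using \<pi>.H.int_pow_mult[OF xt(1), of "- ex i" 1] \<pi>.H.int_pow_mult[OF xt(1), of 1 "- ex i"] xt
      by (simp add: add.commute)
    then have "(t \<otimes>\<^bsub>Q\<^esub> x) \<otimes>\<^bsub>Q\<^esub> ?z = (x \<otimes>\<^bsub>Q\<^esub> t) \<otimes>\<^bsub>Q\<^esub> ?z"
      using e xt zc by (simp add: \<pi>.H.m_assoc)
    then have "t \<otimes>\<^bsub>Q\<^esub> x = x \<otimes>\<^bsub>Q\<^esub> t" using xt zc by simp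
    then have "inv\<^bsub>Q\<^esub> t \<otimes>\<^bsub>Q\<^esub> x \<otimes>\<^bsub>Q\<^esub> t = x" using xt
      by (metis \<pi>.H.inv_closed \<pi>.H.l_cancel_inv' \<pi>.H.m_assoc)
    then show ?thesis by (simp add: x_def t_def)
  qed
  have \<pi>a1: "\<pi> (a1 (i, j)) = inv\<^bsub>Q\<^esub> (\<pi> (pv i (ind i j))) \<otimes>\<^bsub>Q\<^esub> \<pi> (gen i) \<otimes>\<^bsub>Q\<^esub> \<pi> (pv i (ind i j))"
    if "i < \<mu>" for i j
    using pv[OF that ind_ok] gn[OF that] by (simp add: a1_def)
  \<comment> \<open>At k = n i the arc has wrapped around to the base arc. This is the one relation
    that does not hold by construction; \<open>long\<close> closes it up.\<close>
  have ind_step: "\<pi> (a1 (i, (b i + k) mod n i)) = inv\<^bsub>Q\<^esub> (\<pi> (pv i k)) \<otimes>\<^bsub>Q\<^esub> \<pi> (gen i) \<otimes>\<^bsub>Q\<^esub> \<pi> (pv i k)"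
    if i: "i < \<mu>" and k: "k \<le> n i" and n0: "0 < n i" for i k
  proof -
    have bi: "b i < n i" using b[OF i] n0 by simp
    define j where "j = (b i + k) mod n i"
    have j: "j < n i" using n0 by (simp add: j_def)
    have e: "(b i + ind i j) mod n i = (b i + k) mod n i" using ind[OF i j] by (simp add: j_def)
    have "k = ind i j \<or> (k = n i \<and> ind i j = 0)"
    proof (cases "k = n i")
      case True
      then have "(b i + ind i j) mod n i = b i" using e bi by simp
      moreover have "ind i j < n i" using ind[OF i j] by simp
      ultimately have "ind i j = 0"
        using bi by (cases "b i + ind i j < n i") (auto simp: mod_if split: if_splits)
      then show ?thesis using True by simp
    next
      case False
      then have "k < n i" using k by simp
      moreover have "ind i j < n i" using ind[OF i j] by simp
      ultimately have "k = ind i j"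
        using e bi by (auto simp: mod_if split: if_splits)
      then show ?thesis by simp
    qed
    then show ?thesis
    proof
      assume "k = ind i j"
      then show ?thesis using \<pi>a1[OF i, of j] by (simp add: j_def)
    next
      assume kn: "k = n i \<and> ind i j = 0"
      have "\<pi> (a1 (i, j)) = \<pi> (gen i)"
        using \<pi>a1[OF i, of j] kn gn[OF i] by (simp add: pv_def)
      then show ?thesis using long[OF i] kn by (simp add: j_def)
    qed
  qed
  have "wirt Q (\<pi> \<circ> a1)"
    unfolding wirt_def
  proof (intro allI impI)
    fix i j assume i: "i < \<mu>" and j: "j < n i"
    have n0: "0 < n i" using j by simp
    obtain k where k: "k < n i" "j = (b i + k) mod n i" using arc_index[OF i j] by blast
    have pk: "pv i k \<in> carrier F" by (rule pv[OF i]) (use n0 in simp)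
    let ?c = "crs F wa i j"
    have Suc: "pv i (Suc k) = pv i k \<otimes>\<^bsub>F\<^esub> ?c" by (simp add: pv_def k)
    have arcj: "(i, j) \<in> arcset" using i j by (auto simp: arcset_def)
    have "crs Q (\<pi> \<circ> a1) i j = \<pi> (crs F a1 i j)"
      using hom_crs[OF \<pi>.group_hom_axioms a1 i j] by simp
    then have "inv\<^bsub>Q\<^esub> (crs Q (\<pi> \<circ> a1) i j) \<otimes>\<^bsub>Q\<^esub> (\<pi> \<circ> a1) (i, j) \<otimes>\<^bsub>Q\<^esub> crs Q (\<pi> \<circ> a1) i j
        = inv\<^bsub>Q\<^esub> (\<pi> ?c) \<otimes>\<^bsub>Q\<^esub> \<pi> (a1 (i, j)) \<otimes>\<^bsub>Q\<^esub> \<pi> ?c"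
      using conj_eq[OF i j, of "\<pi> (a1 (i, j))"] a1[OF arcj] by simp
    also have "\<pi> (a1 (i, j)) = inv\<^bsub>Q\<^esub> (\<pi> (pv i k)) \<otimes>\<^bsub>Q\<^esub> \<pi> (gen i) \<otimes>\<^bsub>Q\<^esub> \<pi> (pv i k)"
      using ind_step[OF i _ n0, of k] k by simp
    also have "inv\<^bsub>Q\<^esub> (\<pi> ?c) \<otimes>\<^bsub>Q\<^esub> \<dots> \<otimes>\<^bsub>Q\<^esub> \<pi> ?c
        = inv\<^bsub>Q\<^esub> (\<pi> (pv i (Suc k))) \<otimes>\<^bsub>Q\<^esub> \<pi> (gen i) \<otimes>\<^bsub>Q\<^esub> \<pi> (pv i (Suc k))"
      using crsc(2)[OF i j] pk gn[OF i] unfolding Suc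
      by (simp add: \<pi>.H.m_assoc \<pi>.H.inv_mult_group)
    also have "\<dots> = \<pi> (a1 (i, (b i + Suc k) mod n i))"
      using ind_step[OF i _ n0, of "Suc k"] k by simp
    also have "(b i + Suc k) mod n i = (j + 1) mod n i" using k by (simp add: mod_Suc_eq)
    finally show "inv\<^bsub>Q\<^esub> (crs Q (\<pi> \<circ> a1) i j) \<otimes>\<^bsub>Q\<^esub> (\<pi> \<circ> a1) (i, j) \<otimes>\<^bsub>Q\<^esub> crs Q (\<pi> \<circ> a1) i j
        = (\<pi> \<circ> a1) (i, (j + 1) mod n i)" by (simp add: o_def)
  qed
  moreover have "(\<pi> \<circ> a1) c \<in> carrier Q" if "c \<in> arcset" for c using a1[OF that] by simp
  ultimately obtain \<Psi> where \<Psi>: "group_hom G Q \<Psi>" "\<forall>c\<in>arcset. \<Psi> (a c) = (\<pi> \<circ> a1) c"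
    using universal[OF \<pi>.H.is_group] by blast
  interpret \<Psi>: group_hom G Q \<Psi> by (rule \<Psi>(1))
  have \<Psi>m: "\<Psi> (a (i, b i)) = \<pi> (gen i)" if i: "i < \<mu>" for i
  proof (cases "n i = 0")
    case True
    then have "ind i (b i) = 0" by (simp add: ind_def)
    then show ?thesis using \<Psi>(2) base_arc[OF i] \<pi>a1[OF i, of "b i"] gn[OF i] by (simp add: pv_def)
  next
    case False
    then have "(b i + 0) mod n i = b i" using b[OF i] by simp
    then show ?thesis using \<Psi>(2) base_arc[OF i] ind_step[OF i, of 0] False gn[OF i] by (simp add: pv_def)
  qed
  \<comment> \<open>So \<Psi> is a left inverse of \<phi> modulo the (q+1)-st term; it kills that
    term of G, because the one of Q is trivial.\<close>
  have "\<Psi> (\<phi> w) = \<pi> w"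
  proof -
    have wS: "fst ` set w \<subseteq> {..<\<mu>}" using step.prems by (simp add: carrier_free_group)
    have "\<Psi> (\<phi> w) = weval Q (\<Psi> \<circ> (\<lambda>i. a (i, b i))) w"
      unfolding \<phi>_def by (rule \<Psi>.hom_weval) (use wS a base_arc in auto)
    also have "\<dots> = weval Q (\<pi> \<circ> gen) w"
      by (rule \<pi>.H.weval_cong) (use wS \<Psi>m in auto)
    also have "\<dots> = \<pi> w" by (rule hom_free_group_weval[OF \<pi>.homh \<pi>.H.is_group step.prems(1), symmetric])
    finally show ?thesis .
  qed
  moreover have "\<Psi> (\<phi> w) \<in> lcs Q (Suc q)"
    using step.prems(2) by (intro \<Psi>.lcs_img) auto
  ultimately have "\<pi> w = \<one>\<^bsub>Q\<^esub>" using lcs_mod[OF F_grp, of "Suc q"] by (simp add: Q_def)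
  then show ?case using \<phi>.G.coset_lcs_self[OF step.prems(1), of "Suc q"] by (simp add: \<pi>_def Q_def)
qed

text \<open>Let w approximate the longitude modulo the (q+2)-nd term. By injectivity so deep lies
  the commutator of \<open>gen i\<close> with w, whose j-th derivative is (t_i - 1) times that of w,
  plus 1 - t^w if j = i. For j \<noteq> i this puts the derivatives of w in I^q, so w has exponent 0
  in generator j. Exponent i vanishes by the normalization; then t^w = 1, and the case j = i follows
  as well.\<close>

lemma inj_imp_lng:
  assumes inj: "\<And>q w. q \<ge> 1 \<Longrightarrow> w \<in> carrier F \<Longrightarrow> \<phi> w \<in> lcs G q \<Longrightarrow> w \<in> lcs F q"
    and i: "i < \<mu>"
    and lw: "fst ` set lw \<subseteq> arcset" "weval G a lw = lng ex i"
      "lookup (wsum (\<lambda>c. frag_of (fst c)) lw) i = 0"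
  shows "lng ex i \<in> G_infinity G"
proof -
  let ?l = "lng ex i"
  have lc: "?l \<in> carrier G" by (rule lng_carrier[OF i])
  have gi: "gen i \<in> carrier F" using i by simp
  have "?l \<in> lcs G (Suc q)" if q: "q \<ge> 1" for q
  proof -
    let ?NG = "lcs G (Suc (Suc q))" and ?NF = "lcs F (Suc (Suc q))"
    obtain w where w: "w \<in> carrier F" "?l \<otimes> inv (\<phi> w) \<in> ?NG"
      using \<phi>.lcs_dense[OF \<phi>_dense _ lc, of "Suc (Suc q)"] by auto
    interpret NG: normal ?NG G by (rule lcs_normal)
    interpret \<kappa>: group_hom G "G Mod ?NG" "\<lambda>g. ?NG #> g" by (rule NG.group_hom_coset)
    have wS: "fst ` set w \<subseteq> {..<\<mu>}" using w by (simp add: carrier_free_group)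
    have l\<phi>: "?NG #> ?l = ?NG #> \<phi> w" using w lc by (simp add: NG.coset_eq_iff)
    have m: "a (i, b i) \<in> carrier G" by (intro a base_arc i)
    have "?NG #> \<phi> (gcomm F (gen i) w) = gcomm (G Mod ?NG) (?NG #> a (i, b i)) (?NG #> \<phi> w)"
      using w gi m by (simp add: \<phi>.hom_gcomm \<kappa>.hom_gcomm \<phi>_gen[OF i])
    also have "\<dots> = ?NG #> gcomm G (a (i, b i)) ?l"
      using m lc by (simp add: \<kappa>.hom_gcomm l\<phi>)
    also have "gcomm G (a (i, b i)) ?l = \<one>"
      using m lc lng_commutes[OF i] by (simp add: gcomm_eq_one_iff)
    finally have "\<phi> (gcomm F (gen i) w) \<in> ?NG"
      using coset_lcs_self[of "\<phi> (gcomm F (gen i) w)" "Suc (Suc q)"] w gi by (simp add: coset_mult_one[OF NG.subset])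
    then have gc: "gcomm F (gen i) w \<in> ?NF" using w gi by (intro inj) auto
    \<comment> \<open>The normalization of the longitude enters here. Modulo the derived subgroup of
      G, w agrees with the word obtained from lw by replacing arcs by meridians, and injectivity for
      q = 2 compares their exponents.\<close>
    have wsum_w: "lookup (wsum frag_of w) i = 0"
    proof -
      let ?lf = "weval F (\<lambda>c. gen (fst c)) lw"
      have lf: "?lf \<in> carrier F"
        using lw by (intro \<phi>.G.weval_closed) (auto simp: arcset_def)
      have 1: "?l \<otimes> inv (\<phi> ?lf) \<in> derived1 G" using weval_mod_derived[OF lw(1)] lw(2) by simp
      have 2: "?l \<otimes> inv (\<phi> w) \<in> derived1 G" using w(2) lcs_subset_derived1[of "Suc (Suc q)"] by auto
      interpret D: normal "derived1 G" G by (rule derived_self_is_normal)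
      have "derived1 G #> \<phi> w = derived1 G #> \<phi> ?lf"
        using 1 2 lc w lf D.coset_eq_iff[of ?l "\<phi> w"] D.coset_eq_iff[of ?l "\<phi> ?lf"] by simp
      then have "\<phi> w \<otimes> inv (\<phi> ?lf) \<in> derived1 G" using w lf by (simp add: D.coset_eq_iff)
      then have "w \<otimes>\<^bsub>F\<^esub> inv\<^bsub>F\<^esub> ?lf \<in> lcs F (Suc (Suc 0))"
        using w lf by (intro inj) (auto simp: lcs_2)
      then have z: "wsum (frag_of :: nat \<Rightarrow> _) (w \<otimes>\<^bsub>F\<^esub> inv\<^bsub>F\<^esub> ?lf) = 0"
        using dfox_lcs(2)[of "{..<\<mu>}" i "Suc 0" _ frag_of] i by simp
      have hw: "group_hom F (free_Abelian_group {..<\<mu>}) (weval (free_Abelian_group {..<\<mu>}) frag_of)"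
        by (intro group_hom.intro group_hom_axioms.intro group_free_group group.weval_hom) auto
      interpret hw: group_hom F "free_Abelian_group {..<\<mu>}" "weval (free_Abelian_group {..<\<mu>}) frag_of"
        by (rule hw)
      have ws: "weval (free_Abelian_group {..<\<mu>}) frag_of v = wsum frag_of v" if "v \<in> carrier F" for v
        by (rule weval_free_Abelian_group) (use that in \<open>auto simp: carrier_free_group\<close>)
      have "weval (free_Abelian_group {..<\<mu>}) frag_of w = weval (free_Abelian_group {..<\<mu>}) frag_of ?lf"
      proof -
        have "weval (free_Abelian_group {..<\<mu>}) frag_of (w \<otimes>\<^bsub>F\<^esub> inv\<^bsub>F\<^esub> ?lf) = \<one>\<^bsub>free_Abelian_group {..<\<mu>}\<^esub>"
          using z ws[of "w \<otimes>\<^bsub>F\<^esub> inv\<^bsub>F\<^esub> ?lf"] w lf by simp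
        then have "weval (free_Abelian_group {..<\<mu>}) frag_of w \<otimes>\<^bsub>free_Abelian_group {..<\<mu>}\<^esub>
            inv\<^bsub>free_Abelian_group {..<\<mu>}\<^esub> (weval (free_Abelian_group {..<\<mu>}) frag_of ?lf) = \<one>\<^bsub>free_Abelian_group {..<\<mu>}\<^esub>"
          using w lf by (simp only: hw.hom_mult hw.hom_inv \<phi>.G.inv_closed)
        then show ?thesis
          using w lf by (metis hw.H.inv_equality hw.H.inv_inv hw.H.inv_closed hw.hom_closed)
      qed
      also have "\<dots> = weval (free_Abelian_group {..<\<mu>}) (weval (free_Abelian_group {..<\<mu>}) frag_of \<circ> (\<lambda>c. gen (fst c))) lw"
        by (rule hw.hom_weval) (use lw in \<open>auto simp: arcset_def\<close>)
      also have "\<dots> = weval (free_Abelian_group {..<\<mu>}) (\<lambda>c. frag_of (fst c)) lw"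
        by (rule hw.H.weval_cong) (use lw in \<open>auto simp: arcset_def hw.H.weval_gen\<close>)
      also have "\<dots> = wsum (\<lambda>c. frag_of (fst c)) lw"
        by (rule weval_free_Abelian_group) (use lw in \<open>auto simp: arcset_def\<close>)
      finally show ?thesis using lw(3) ws[OF w(1)] by simp
    qed
    define \<tau> where "\<tau> j = weval magnus (\<lambda>l. (frag_of l, \<lambda>m::nat. if l = j then 1 else (0::laurent)))" for j :: nat
    have \<tau>: "\<tau> j y = (wsum frag_of y, \<lambda>m. dfox frag_of j y)" if "y \<in> carrier F" "j < \<mu>" for y j
      unfolding \<tau>_def by (rule weval_magnus_1[of _ "{..<\<mu>}"]) (use that in \<open>auto simp: carrier_free_group\<close>)
    have X: "(tvar i - 1) * dfox frag_of j w - (if j = i then frag_of (wsum frag_of w) - 1 else 0) \<in> aug_fil (Suc q)"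
      if j: "j < \<mu>" for j
    proof -
      interpret \<tau>: group_hom F magnus "\<tau> j"
        unfolding \<tau>_def
        by (intro group_hom.intro group_hom_axioms.intro \<phi>.G.is_group group_magnus T.weval_hom) auto
      have "dfox frag_of j (gcomm F (gen i) w) \<in> aug_fil (Suc q)"
        using dfox_lcs(1)[of "{..<\<mu>}" j "Suc q" _ frag_of] gc j by simp
      moreover have "\<tau> j (gcomm F (gen i) w) = gcomm magnus (\<tau> j (gen i)) (\<tau> j w)"
        by (rule \<tau>.hom_gcomm) (use gi w in auto)
      then have "(\<lambda>m::nat. dfox frag_of j (gcomm F (gen i) w))
          = (\<lambda>m. (1 - frag_of (wsum frag_of w)) * dfox frag_of j (gen i) + (tvar i - 1) * dfox frag_of j w)"
        using gi w j \<phi>.G.lcs_in_carrier[OF gc] by (simp add: \<tau> gcomm_magnus gen_def)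
      from fun_cong[OF this] have "dfox frag_of j (gcomm F (gen i) w)
          = (1 - frag_of (wsum frag_of w)) * dfox frag_of j (gen i) + (tvar i - 1) * dfox frag_of j w" .
      moreover have "dfox frag_of j (gen i) = (if j = i then 1 else 0)" by (auto simp: gen_def)
      ultimately show ?thesis by (auto simp: algebra_simps)
    qed
    have dj: "dfox frag_of j w \<in> aug_fil q" if "j < \<mu>" "j \<noteq> i" for j
      using X[OF that(1)] that(2) aug_fil_X_cancel[of i "dfox frag_of j w" q] by simp
    have "wsum frag_of w = 0"
    proof (rule poly_mapping_eqI)
      fix l
      show "lookup (wsum frag_of w) l = lookup 0 l"
      proof (cases "l < \<mu> \<and> l \<noteq> i")
        case True
        then have "Dm {#} (dfox frag_of l w) = 0" using dj[of l] q by (simp add: aug_fil_def)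
        then show ?thesis using lookup_wsum_frag_of[OF wS, of l frag_of] True by simp
      next
        case False
        show ?thesis
        proof (cases "l = i")
          case True
          then show ?thesis using wsum_w by simp
        next
          case False
          then have "\<not> l < \<mu>" using \<open>\<not> (l < \<mu> \<and> l \<noteq> i)\<close> by simp
          then have "(\<Sum>j<\<mu>. Dm {#} (dfox frag_of j w) * (if l = j then 1 else 0)) = 0"
            by (intro sum.neutral) auto
          then show ?thesis by (simp add: wsum_dfox[OF _ wS, of _ frag_of] lookup_sum)
        qed
      qed
    qed
    then have "(tvar i - 1) * dfox frag_of i w \<in> aug_fil (Suc q)"
      using X[OF i] by (simp add: frag_of_zero)
    then have "dfox frag_of i w \<in> aug_fil q" by (rule aug_fil_X_cancel)
    then have "dfox frag_of j w \<in> aug_fil q" if "j < \<mu>" for j using dj that by (cases "j = i") auto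
    then have wN: "w \<in> lcs F (Suc q)" by (intro mem_lcs_if_dfox w)
    have "\<phi> w \<in> lcs G (Suc q)" by (rule \<phi>.lcs_img[OF _ wN]) simp
    moreover have "?l \<otimes> inv (\<phi> w) \<in> lcs G (Suc q)"
      using w(2) lcs_Suc_subset[of "Suc q"] by auto
    ultimately have "?l \<otimes> inv (\<phi> w) \<otimes> \<phi> w \<in> lcs G (Suc q)"
      using subgroup.m_closed[OF lcs_subgroup] by blast
    then show ?thesis using lc w by (simp add: m_assoc)
  qed
  then have "?l \<in> lcs G q" if "q \<ge> 1" for q
  proof (cases "q = 1")
    case True
    then show ?thesis using lc by (simp add: lcs_1)
  next
    case False
    then have "q = Suc (q - 1)" "q - 1 \<ge> 1" using that by auto
    then show ?thesis using \<open>\<And>q. q \<ge> 1 \<Longrightarrow> ?l \<in> lcs G (Suc q)\<close> by metis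
  qed
  then show ?thesis by (auto simp: G_infinity_def)
qed

end

section \<open>Elementary ideals and link diagrams\<close>

lemma presentation_of_iso:
  assumes R: "R \<subseteq> carrier (free_group X)" and G: "group G" and h: "h \<in> iso (presented_group X R) G"
  shows "presentation X R G (\<lambda>w. h (word_class X R w))"
proof -
  interpret F: group "free_group X" by (rule group_free_group)
  let ?N = "normal_closure (free_group X) R"
  interpret N: normal ?N "free_group X" by (rule F.normal_closure_normal[OF R])
  interpret \<pi>: group_hom "free_group X" "presented_group X R" "word_class X R"
    using N.group_hom_coset by (simp add: presented_group_def word_class_def[abs_def])
  interpret h: group_hom "presented_group X R" G h
    using h G by (intro group_hom.intro group_hom_axioms.intro \<pi>.H.is_group) (auto simp: iso_def)
  have inj: "inj_on h (carrier (presented_group X R))" and surj: "h ` carrier (presented_group X R) = carrier G"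
    using h by (auto simp: iso_def bij_betw_def)
  have sp: "word_class X R ` carrier (free_group X) = carrier (presented_group X R)"
    by (simp add: presented_group_def carrier_FactGroup word_class_def)
  have ker: "h (word_class X R w) = \<one>\<^bsub>G\<^esub> \<longleftrightarrow> w \<in> ?N" if w: "w \<in> carrier (free_group X)" for w
  proof -
    have "h (word_class X R w) = \<one>\<^bsub>G\<^esub> \<longleftrightarrow> word_class X R w = \<one>\<^bsub>presented_group X R\<^esub>"
      using inj_onD[OF inj, of "word_class X R w" "\<one>\<^bsub>presented_group X R\<^esub>"] w by auto
    also have "\<dots> \<longleftrightarrow> ?N #>\<^bsub>free_group X\<^esub> w = ?N #>\<^bsub>free_group X\<^esub> \<one>\<^bsub>free_group X\<^esub>"
      by (simp add: word_class_def presented_group_def F.coset_mult_one[OF N.subset])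
    also have "\<dots> \<longleftrightarrow> w \<in> ?N" using w by (simp add: N.coset_eq_iff)
    finally show ?thesis .
  qed
  show ?thesis
  proof (intro presentation.intro presentation_axioms.intro R ker)
    show "group_hom (free_group X) G (\<lambda>w. h (word_class X R w))"
      using Group.hom_compose[OF \<pi>.homh h.homh]
      by (intro group_hom.intro group_hom_axioms.intro F.is_group G) (simp add: o_def)
    show "(\<lambda>w. h (word_class X R w)) ` carrier (free_group X) = carrier G"
      using surj sp by (metis image_image)
  qed
qed

lemma free_group_cancel_cons:
  assumes "fst a \<in> X" "w \<in> carrier (free_group X)"
  shows "cancel_cons a w = [a] \<otimes>\<^bsub>free_group X\<^esub> w" "[a] \<in> carrier (free_group X)"
    "cancel_cons a w \<in> carrier (free_group X)"
proof -
  interpret F: group "free_group X" by (rule group_free_group)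
  show 1: "cancel_cons a w = [a] \<otimes>\<^bsub>free_group X\<^esub> w" by (simp add: mult_free_group)
  show 2: "[a] \<in> carrier (free_group X)" using assms by (simp add: carrier_free_group reduced_Cons)
  show "cancel_cons a w \<in> carrier (free_group X)" unfolding 1 using 2 assms(2) by simp
qed

text \<open>A homomorphism on the free group is multiplicative only on reduced words over X, so
  \<open>group_ring_map_fox\<close> has to know that no other words occur in the derivative.\<close>

lemma keys_fox:
  assumes "w \<in> carrier (free_group X)"
  shows "keys (fox j w) \<subseteq> carrier (free_group X)"
  using assms
proof (induction w)
  case (Cons a w)
  have w: "w \<in> carrier (free_group X)" "fst a \<in> X" using free_group_Cons[OF Cons.prems] by auto
  have nil: "[] \<in> carrier (free_group X)" by (simp add: carrier_free_group)
  have 1: "keys (fox_letter j a) \<subseteq> carrier (free_group X)"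
    using w(2) nil by (cases a) (auto simp: carrier_free_group reduced_Cons)
  have "keys (group_ring_map (cancel_cons a) (fox j w))
      \<subseteq> (\<Union>v\<in>keys (fox j w). keys (frag_of (cancel_cons a v)))"
    unfolding group_ring_map_def by (rule keys_frag_extend)
  also have "\<dots> \<subseteq> carrier (free_group X)"
    using Cons.IH[OF w(1)] free_group_cancel_cons(3)[OF w(2)] by auto
  finally show ?case using 1 keys_add[of "fox_letter j a" "group_ring_map (cancel_cons a) (fox j w)"] by auto
qed simp

lemma group_ring_map_fox:
  assumes f: "f \<in> hom (free_group X) (free_Abelian_group S)" and w: "w \<in> carrier (free_group X)"
  shows "group_ring_map f (fox j w) = dfox (\<lambda>y. f (gen y)) j w"
  using w
proof (induction w)
  case (Cons a w)
  obtain y e where a: "a = (y, e)" by (cases a)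
  have w: "w \<in> carrier (free_group X)" "y \<in> X" using free_group_Cons[OF Cons.prems] a by auto
  have fw: "f v = wsum (\<lambda>y. f (gen y)) v" if "v \<in> carrier (free_group X)" for v
    using hom_wsum[OF f that] .
  have fa: "f [a] = (if e then f (gen y) else - f (gen y))"
    using fw[OF free_group_cancel_cons(2)[of a X w]] w by (simp add: a)
  have "group_ring_map f (group_ring_map (cancel_cons a) p) = frag_of (f [a]) * group_ring_map f p"
    if "keys p \<subseteq> carrier (free_group X)" for p
    using that
  proof (induction p rule: frag_induction)
    case (one v)
    have "f (cancel_cons a v) = f [a] + f v"
      using f free_group_cancel_cons[of a X v] one w a by (simp add: hom_def)
    then show ?case by (simp add: frag_of_mult)
  qed (auto simp: group_ring_map_diff right_diff_distrib)
  from this[OF keys_fox[OF w(1)]]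
  have "group_ring_map f (group_ring_map (cancel_cons a) (fox j w)) = frag_of (f [a]) * dfox (\<lambda>y. f (gen y)) j w"
    using Cons.IH[OF w(1)] by simp
  moreover have "group_ring_map f (fox_letter j a) = (if y \<noteq> j then 0 else if e then 1 else - frag_of (- f (gen y)))"
  proof -
    have "f [] = 0" using fw[of "[]"] by (simp add: carrier_free_group)
    then show ?thesis using fa by (auto simp: a group_ring_map_uminus frag_of_zero)
  qed
  ultimately show ?case by (simp add: a fa[unfolded a] group_ring_map_add)
qed simp

lemma ring_laurent_ring: "ring (laurent_ring \<mu>)"
proof -
  let ?S = "carrier (free_Abelian_group {..<\<mu>})"
  have mult: "keys (p * q) \<subseteq> ?S"
    if "keys p \<subseteq> ?S" "keys q \<subseteq> ?S" for p q :: laurent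
  proof
    fix v assume "v \<in> keys (p * q)"
    then obtain a b where "a \<in> keys p" "b \<in> keys q" "v = a + b"
      using keys_mult[of p q] by auto
    moreover then have "a \<in> ?S" "b \<in> ?S" using that by blast+
    ultimately show "v \<in> ?S" using keys_add[of a b] by auto
  qed
  have add: "keys (p + q) \<subseteq> ?S"
    if "keys p \<subseteq> ?S" "keys q \<subseteq> ?S" for p q :: laurent
    using that keys_add[of p q] by blast
  have one: "keys (1 :: laurent) \<subseteq> ?S"
    using keys_frag_of[of "0 :: nat \<Rightarrow>\<^sub>0 int"] unfolding frag_of_zero by simp
  show ?thesis
  proof (rule ringI)
    show "abelian_group (laurent_ring \<mu>)"
    proof (rule abelian_groupI)
      fix p assume "p \<in> carrier (laurent_ring \<mu>)"
      then show "\<exists>q\<in>carrier (laurent_ring \<mu>). q \<oplus>\<^bsub>laurent_ring \<mu>\<^esub> p = \<zero>\<^bsub>laurent_ring \<mu>\<^esub>"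
        by (intro bexI[of _ "- p"]) (auto simp: laurent_ring_def)
    qed (use add in \<open>auto simp: laurent_ring_def add_ac\<close>)
    show "monoid (laurent_ring \<mu>)"
      by (rule monoidI) (use mult one in \<open>auto simp: laurent_ring_def mult.assoc\<close>)
  qed (auto simp: laurent_ring_def algebra_simps)
qed

lemma genideal_laurent_eq_zero: "genideal (laurent_ring \<mu>) S = {0} \<longleftrightarrow> S \<subseteq> {0}"
proof
  assume "genideal (laurent_ring \<mu>) S = {0}"
  moreover have "S \<subseteq> genideal (laurent_ring \<mu>) S" unfolding genideal_def by blast
  ultimately show "S \<subseteq> {0}" by simp
next
  assume S: "S \<subseteq> {0}"
  have z: "\<zero>\<^bsub>laurent_ring \<mu>\<^esub> = 0" by (simp add: laurent_ring_def)
  have "ideal {0} (laurent_ring \<mu>)" using ring.zeroideal[OF ring_laurent_ring, of \<mu>] by (simp add: z)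
  then have "genideal (laurent_ring \<mu>) S \<subseteq> {0}" using S unfolding genideal_def by blast
  moreover have "0 \<in> I" if "ideal I (laurent_ring \<mu>)" for I
    using additive_subgroup.zero_closed[OF ideal.axioms(1)[OF that]] by (simp add: z)
  then have "0 \<in> genideal (laurent_ring \<mu>) S" unfolding genideal_def by blast
  ultimately show "genideal (laurent_ring \<mu>) S = {0}" by blast
qed

lemma (in alexander) elementary_ideal_zero_iff:
  assumes M: "alexander_matrix G \<psi> N rs \<theta> = mat (length rs) N (\<lambda>(k, j). A k j)"
  shows "elementary_ideal G \<mu> \<psi> N rs \<theta> (int \<mu> - 1) = {0} \<longleftrightarrow> minors_vanish"
proof -
  \<comment> \<open>This excludes the unit ideal. For \<mu> = 0 the minors would have size N + 1,
    more than the number of columns, and both sides hold vacuously.\<close>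
  have neg: "\<not> int N \<le> int \<mu> - 1" using \<mu>_le_N by simp
  have card: "int c = int N - (int \<mu> - 1) \<longleftrightarrow> c = Suc (N - \<mu>)" for c
    using \<mu>_le_N by auto
  show ?thesis
    unfolding elementary_ideal_def if_not_P[OF neg] genideal_laurent_eq_zero M card minors_vanish_def
    by auto
qed

lemma exponent_sum_wsum: "exponent_sum i w = lookup (wsum (\<lambda>c. frag_of (fst c)) w) i"
proof (induction w)
  case Nil
  then show ?case by (simp add: exponent_sum_def)
next
  case (Cons a w)
  then show ?case by (cases a) (auto simp: exponent_sum_def lookup_add)
qed

section \<open>Diagrams and their link groups\<close>

locale diagram =
  fixes D :: virtual_diagram and b :: "nat \<Rightarrow> nat"
  assumes D: "virtual_link_diagram D"
    and b_arc: "i < ncomp D \<Longrightarrow> (i, b i) \<in> arcs D"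
begin

abbreviation "ovd i j \<equiv> arc_of D (over D (undercrossing D i j))"

abbreviation "sgd i j \<equiv> crossing_sign D (undercrossing D i j)"

lemma finite_under_times: "finite (under_times D i)"
proof -
  have "finite {p. \<exists>q. cross_at D p q}" and "unders D \<subseteq> {p. \<exists>q. cross_at D p q}"
    using D unfolding virtual_link_diagram_def by blast+
  then have "finite (unders D)" by (rule finite_subset[rotated])
  then have "finite (snd ` unders D)" by simp
  moreover have "under_times D i \<subseteq> snd ` unders D" by (force simp: under_times_def)
  ultimately show ?thesis by (rule finite_subset[rotated])
qed

lemma ov_in_arcs:
  assumes "i < ncomp D" "j < n_under D i"
  shows "ovd i j \<in> arcs D"
proof -
  let ?p = "undercrossing D i j"
  have "sorted_list_of_set (under_times D i) ! j \<in> set (sorted_list_of_set (under_times D i))"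
    using assms by (intro nth_mem) (simp add: n_under_def)
  then have "?p \<in> unders D"
    using finite_under_times[of i] by (simp add: undercrossing_def under_times_def)
  then obtain q where q: "cross_at D ?p q" using D unfolding virtual_link_diagram_def by blast
  moreover have "\<And>r. cross_at D ?p r \<Longrightarrow> r = q"
    using D q unfolding virtual_link_diagram_def by blast
  ultimately have o: "over D ?p = q" unfolding over_def by (intro the_equality)
  have "fst q < ncomp D" using q by (auto simp: cross_at_def passages_def)
  \<comment> \<open>If the overcrossing component has no undercrossings, \<open>mod 0\<close>
    changes nothing, and the count is 0, the index of its only arc.\<close>
  moreover have "card {u \<in> under_times D (fst q). u < snd q} mod n_under D (fst q) < max 1 (n_under D (fst q))"
  proof (cases "n_under D (fst q) = 0")
    case True
    then have "under_times D (fst q) = {}" using finite_under_times[of "fst q"] by (simp add: n_under_def)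
    then show ?thesis by simp
  next
    case False
    then show ?thesis by (simp add: less_max_iff_disj)
  qed
  ultimately show ?thesis unfolding arc_of_def o arcs_def by simp
qed

sublocale link "ncomp D" "n_under D" ovd sgd b
  by unfold_locales (use ov_in_arcs b_arc in \<open>auto simp: arcs_def\<close>)

lemma arcset_eq: "arcset = arcs D"
  by (simp add: arcset_def arcs_def)

abbreviation "FA \<equiv> free_group (arcs D)"

lemma gen_arc: "c \<in> arcset \<Longrightarrow> gen c \<in> carrier FA"
  by (simp add: arcset_eq)

lemma over_letter_crs: "over_letter D i j = crs FA gen i j"
  by (simp add: over_letter_def crs_def Let_def)

text \<open>\<open>longitude_word\<close> folds from the right whereas \<open>part\<close> grows at
  its right end; the general start value v reconciles the two.\<close>

lemma foldr_part:
  assumes "i < ncomp D" "k = 0 \<or> 0 < n_under D i" "v \<in> carrier FA"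
  shows "foldr (\<lambda>r v. over_letter D i ((b i + r) mod n_under D i) \<otimes>\<^bsub>FA\<^esub> v) [0..<k] v
    = part FA gen i k \<otimes>\<^bsub>FA\<^esub> v"
proof -
  interpret F: group FA by (rule group_free_group)
  show ?thesis using assms(2,3)
  proof (induction k arbitrary: v)
    case (Suc k)
    then have n: "0 < n_under D i" by simp
    have c: "crs FA gen i ((b i + k) mod n_under D i) \<in> carrier FA" "part FA gen i k \<in> carrier FA"
      using n by (auto intro!: crs_carrier part_carrier F.is_group gen_arc assms(1))
    then show ?case using Suc n by (simp add: over_letter_crs F.m_assoc)
  qed simp
qed

lemma longitude_word_part:
  assumes "i < ncomp D"
  shows "longitude_word D i (b i) = part FA gen i (n_under D i) \<otimes>\<^bsub>FA\<^esub>
    gen (i, b i) [^]\<^bsub>FA\<^esub> (- exponent_sum i (part FA gen i (n_under D i)))"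
proof -
  interpret F: group FA by (rule group_free_group)
  have "part FA gen i (n_under D i) \<in> carrier FA"
    by (rule part_carrier[OF F.is_group gen_arc assms]) auto
  moreover have "n_under D i = 0 \<or> 0 < n_under D i" by auto
  ultimately show ?thesis
    using foldr_part[OF assms, of "n_under D i" "\<one>\<^bsub>FA\<^esub>"] by (simp add: longitude_word_def Let_def)
qed

lemma longitude_word_carrier:
  assumes "i < ncomp D" shows "longitude_word D i (b i) \<in> carrier FA"
proof -
  interpret F: group FA by (rule group_free_group)
  have "part FA gen i (n_under D i) \<in> carrier FA"
    by (rule part_carrier[OF F.is_group gen_arc assms]) auto
  then show ?thesis using gen_arc[OF base_arc[OF assms]] by (simp add: longitude_word_part[OF assms])
qed

text \<open>Products in the free group cancel letters, so the exponents are computed through the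
  homomorphism that sends each arc to its component.\<close>

lemma exponent_sum_longitude:
  assumes i: "i < ncomp D" shows "exponent_sum i (longitude_word D i (b i)) = 0"
proof -
  let ?Z = "free_Abelian_group (UNIV :: nat set)" and ?f = "\<lambda>c :: nat \<times> nat. frag_of (fst c)"
  interpret F: group FA by (rule group_free_group)
  interpret Z: group ?Z by simp
  interpret f: group_hom FA ?Z "weval ?Z ?f"
    by (intro group_hom.intro group_hom_axioms.intro F.is_group Z.is_group Z.weval_hom) auto
  have f: "weval ?Z ?f w = wsum ?f w" for w by (rule weval_free_Abelian_group) simp
  let ?p = "part FA gen i (n_under D i)"
  have p: "?p \<in> carrier FA" by (rule part_carrier[OF F.is_group gen_arc i]) auto
  have g: "gen (i, b i) \<in> carrier FA" by (rule gen_arc[OF base_arc[OF i]])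
  have "wsum ?f (longitude_word D i (b i)) = weval ?Z ?f ?p \<otimes>\<^bsub>?Z\<^esub> weval ?Z ?f (gen (i, b i)) [^]\<^bsub>?Z\<^esub> (- exponent_sum i ?p)"
    unfolding f[symmetric] longitude_word_part[OF i] using p g by (simp add: f.hom_int_pow)
  also have "weval ?Z ?f (gen (i, b i)) = frag_of i" unfolding f by (simp add: gen_def)
  finally show ?thesis by (simp add: exponent_sum_wsum f lookup_add)
qed

end

lemma (in presentation) generated:
  assumes "g \<in> carrier G"
  shows "\<exists>w. fst ` set w \<subseteq> X \<and> g = weval G (\<lambda>c. p (gen c)) w"
proof -
  obtain w where w: "w \<in> carrier FX" "g = p w" using surj assms by auto
  have "p w = weval G (p \<circ> gen) w" by (rule hom_free_group_weval[OF p.homh p.H.is_group w(1)])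
  then show ?thesis using w by (auto simp: carrier_free_group o_def)
qed

locale link_presentation = diagram D b +
  P: presentation "arcs D" "link_relators D" G p for D b and G :: "('a, 'm) monoid_scheme" and p
begin

abbreviation "ga c \<equiv> p (gen c)"

lemma relator_crs: "link_relator D i j = inv\<^bsub>FA\<^esub> (crs FA gen i j) \<otimes>\<^bsub>FA\<^esub> gen (i, j) \<otimes>\<^bsub>FA\<^esub> crs FA gen i j
    \<otimes>\<^bsub>FA\<^esub> inv\<^bsub>FA\<^esub> (gen (i, (j + 1) mod n_under D i))"
  by (simp add: link_relator_def over_letter_crs Let_def)

lemma hom_relator:
  assumes "group_hom FA H f" "i < ncomp D" "j < n_under D i"
  shows "f (link_relator D i j) = \<one>\<^bsub>H\<^esub> \<longleftrightarrow>
    inv\<^bsub>H\<^esub> (crs H (f \<circ> gen) i j) \<otimes>\<^bsub>H\<^esub> f (gen (i, j)) \<otimes>\<^bsub>H\<^esub> crs H (f \<circ> gen) i j = f (gen (i, (j + 1) mod n_under D i))"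
proof -
  interpret f: group_hom FA H f by fact
  have c: "crs FA gen i j \<in> carrier FA" by (rule crs_carrier[OF group_free_group gen_arc assms(2,3)])
  have g: "gen (i, j) \<in> carrier FA" "gen (i, (j + 1) mod n_under D i) \<in> carrier FA"
    using assms by (auto simp: arcs_def)
  let ?y = "inv\<^bsub>H\<^esub> (crs H (f \<circ> gen) i j) \<otimes>\<^bsub>H\<^esub> f (gen (i, j)) \<otimes>\<^bsub>H\<^esub> crs H (f \<circ> gen) i j"
  have y: "?y \<in> carrier H" using c g f.hom_closed[OF c] hom_crs[OF assms(1) gen_arc assms(2,3)] by simp
  have "f (link_relator D i j) = ?y \<otimes>\<^bsub>H\<^esub> inv\<^bsub>H\<^esub> (f (gen (i, (j + 1) mod n_under D i)))"
    unfolding relator_crs using c g hom_crs[OF assms(1) gen_arc assms(2,3)] by simp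
  moreover have "?y \<otimes>\<^bsub>H\<^esub> inv\<^bsub>H\<^esub> z = \<one>\<^bsub>H\<^esub> \<longleftrightarrow> ?y = z" if "z \<in> carrier H" for z
    using y that f.H.inv_solve_right'[of "\<one>\<^bsub>H\<^esub>" ?y z] by auto
  ultimately show ?thesis using f.hom_closed[OF g(2)] by simp
qed

sublocale L: link_grp "ncomp D" "n_under D" ovd sgd b G ga
proof (intro link_grp.intro link_grp_axioms.intro link_axioms P.p.H.is_group)
  show "ga c \<in> carrier G" if "c \<in> arcset" for c using gen_arc[OF that] by simp
  show "wirt G ga"
    unfolding wirt_def
  proof (intro allI impI)
    fix i j assume ij: "i < ncomp D" "j < n_under D i"
    then have "link_relator D i j \<in> link_relators D" by (auto simp: link_relators_def)
    then show "inv\<^bsub>G\<^esub> (crs G ga i j) \<otimes>\<^bsub>G\<^esub> ga (i, j) \<otimes>\<^bsub>G\<^esub> crs G ga i j = ga (i, (j + 1) mod n_under D i)"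
      using P.relator_one hom_relator[OF P.p.group_hom_axioms ij] by (simp add: o_def)
  qed
  show "\<exists>w. fst ` set w \<subseteq> arcset \<and> g = weval G ga w" if "g \<in> carrier G" for g
    using P.generated[OF that] by (simp add: arcset_eq)
  fix H :: "nat word set monoid" and a'
  assume H: "group H" and a': "\<And>c. c \<in> arcset \<Longrightarrow> a' c \<in> carrier H" and w: "wirt H a'"
  interpret H: group H by fact
  have f: "group_hom FA H (weval H a')"
    by (intro group_hom.intro group_hom_axioms.intro group_free_group H H.weval_hom) (use a' in \<open>auto simp: arcset_eq\<close>)
  have fg: "weval H a' (gen c) = a' c" if "c \<in> arcset" for c by (rule H.weval_gen[of a', OF a'[OF that]])
  have "weval H a' r = \<one>\<^bsub>H\<^esub>" if r: "r \<in> link_relators D" for r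
  proof -
    obtain i j where ij: "i < ncomp D" "j < n_under D i" "r = link_relator D i j"
      using r by (auto simp: link_relators_def)
    have arcs: "(i, j) \<in> arcset" "(i, (j + 1) mod n_under D i) \<in> arcset" using ij by (auto simp: arcset_def)
    have "crs H (weval H a' \<circ> gen) i j = crs H a' i j"
      by (rule crs_cong[OF _ ij(1,2)]) (simp add: fg)
    then show ?thesis
      using w ij hom_relator[OF f ij(1,2)] fg[OF arcs(1)] fg[OF arcs(2)] by (simp add: wirt_def)
  qed
  then obtain g where "group_hom G H g" "\<And>v. v \<in> carrier FA \<Longrightarrow> g (p v) = weval H a' v"
    using P.factor[OF f] by blast
  then show "\<exists>h. group_hom G H h \<and> (\<forall>c\<in>arcset. h (ga c) = a' c)"
    using gen_arc fg by (intro exI[of _ g]) auto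
qed

lemma p_longitude:
  assumes i: "i < ncomp D"
  shows "p (longitude_word D i (b i)) = L.lng (\<lambda>i. exponent_sum i (part FA gen i (n_under D i))) i"
proof -
  have pc: "part FA gen i (n_under D i) \<in> carrier FA"
    by (rule part_carrier[OF group_free_group gen_arc i]) auto
  have "p (part FA gen i (n_under D i)) = part G (p \<circ> gen) i (n_under D i)"
    by (rule hom_part[OF P.p.group_hom_axioms gen_arc i]) auto
  then show ?thesis
    using pc gen_arc[OF base_arc[OF i]]
    by (simp add: longitude_word_part[OF i] L.lng_def P.p.hom_int_pow o_def)
qed

text \<open>Both conditions are compared with the injectivity, in every degree, of the map given by
  the meridians.\<close>

lemma longitudes_iff_chen:
  "(\<forall>i<ncomp D. p (longitude_word D i (b i)) \<in> G_infinity G) \<longleftrightarrow>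
    (\<forall>q\<ge>1. chen_group G q \<cong> chen_group (free_group {..<ncomp D}) q)"
proof
  assume lng: "\<forall>i<ncomp D. p (longitude_word D i (b i)) \<in> G_infinity G"
  have inj: "w \<in> lcs L.F q"
    if "q \<ge> 1" "w \<in> carrier L.F" "L.\<phi> w \<in> lcs G q" for q w
  proof (rule L.lng_imp_inj[OF _ that])
    fix i assume "i < ncomp D"
    then show "L.lng (\<lambda>i. exponent_sum i (part FA gen i (n_under D i))) i \<in> G_infinity G"
      using lng p_longitude by simp
  qed
  show "\<forall>q\<ge>1. chen_group G q \<cong> chen_group L.F q"
  proof (intro allI impI)
    fix q :: nat assume q: "1 \<le> q"
    have "chen_group L.F q \<cong> chen_group G q"
      by (rule L.\<phi>.chen_group_iso[OF L.\<phi>_dense]) (use inj[of "Suc q"] q in auto)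
    moreover have "group (chen_group L.F q)"
      using group_hom.axioms(2)[OF L.\<phi>.G.chen_group_hom[OF q]] .
    ultimately show "chen_group G q \<cong> chen_group L.F q" by (rule group.iso_sym[rotated])
  qed
next
  assume iso: "\<forall>q\<ge>1. chen_group G q \<cong> chen_group L.F q"
  have inj: "w \<in> lcs L.F q"
    if "q \<ge> 1" "w \<in> carrier L.F" "L.\<phi> w \<in> lcs G q" for q w
    using chen_iso_imp_inj[OF L.\<phi>.group_hom_axioms L.\<phi>_dense _ that] iso by blast
  show "\<forall>i<ncomp D. p (longitude_word D i (b i)) \<in> G_infinity G"
  proof (intro allI impI)
    fix i assume i: "i < ncomp D"
    let ?l = "longitude_word D i (b i)"
    have lc: "?l \<in> carrier FA" by (rule longitude_word_carrier[OF i])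
    have "p ?l = weval G ga ?l"
      using hom_free_group_weval[OF P.p.homh P.p.H.is_group lc] by (simp add: o_def)
    then show "p ?l \<in> G_infinity G"
      unfolding p_longitude[OF i]
      using lc exponent_sum_longitude[OF i]
      by (intro L.inj_imp_lng[OF inj i, where lw = ?l]) (auto simp: carrier_free_group arcset_eq exponent_sum_wsum)
  qed
qed

end

theorem theorem3p8:
  fixes G :: "('a, 'b) monoid_scheme"
    and \<mu> N :: nat
    and rs :: "nat word list"
    and \<theta> :: "nat word set \<Rightarrow> 'a"
    and \<psi> :: "'a set \<Rightarrow> (nat \<Rightarrow>\<^sub>0 int)"
  assumes "group G"
    and "finite_presentation G N rs \<theta>"
    and "\<psi> \<in> iso (G Mod derived1 G) (free_Abelian_group {..<\<mu>})"
  shows "(elementary_ideal G \<mu> \<psi> N rs \<theta> (int \<mu> - 1) = {0} \<longleftrightarrow>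
            (\<forall>q\<ge>1. chen_group G q \<cong> chen_group (free_group {..<\<mu>}) q)) \<and>
         (\<forall>D h b. virtual_link_diagram D \<longrightarrow> ncomp D = \<mu> \<longrightarrow> h \<in> iso (link_group D) G \<longrightarrow>
            (\<forall>i<\<mu>. (i, b i) \<in> arcs D) \<longrightarrow>
            (elementary_ideal G \<mu> \<psi> N rs \<theta> (int \<mu> - 1) = {0} \<longleftrightarrow>
               (\<forall>i<\<mu>. h (longitude D i (b i)) \<in> G_infinity G)))"
proof -
  interpret G: group G by fact
  let ?F = "free_group {..<N}"
  define p where "p w = \<theta> (word_class {..<N} (set rs) w)" for w
  have rs: "set rs \<subseteq> carrier ?F" and \<theta>: "\<theta> \<in> iso (presented_group {..<N} (set rs)) G"
    using assms(2) by (auto simp: finite_presentation_def)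
  interpret P: presentation "{..<N}" "set rs" G p
    using presentation_of_iso[OF rs assms(1) \<theta>] by (simp add: p_def[abs_def])
  interpret D1: normal "derived1 G" G by (rule G.derived_self_is_normal)
  interpret \<pi>: group_hom G "G Mod derived1 G" "\<lambda>g. derived1 G #>\<^bsub>G\<^esub> g" by (rule D1.group_hom_coset)
  define ab where "ab = abelianization G \<psi>"
  have ab_eq: "ab = \<psi> \<circ> (\<lambda>g. derived1 G #>\<^bsub>G\<^esub> g)" by (auto simp: ab_def abelianization_def fun_eq_iff)
  have \<psi>: "\<psi> \<in> hom (G Mod derived1 G) (free_Abelian_group {..<\<mu>})"
    "inj_on \<psi> (carrier (G Mod derived1 G))"
    "\<psi> ` carrier (G Mod derived1 G) = carrier (free_Abelian_group {..<\<mu>})"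
    using assms(3) by (auto simp: iso_def bij_betw_def)
  interpret \<psi>: group_hom "G Mod derived1 G" "free_Abelian_group {..<\<mu>}" \<psi>
    by (intro group_hom.intro group_hom_axioms.intro \<pi>.H.is_group \<psi>(1)) simp
  have ab_hom: "ab \<in> hom G (free_Abelian_group {..<\<mu>})"
    unfolding ab_eq by (rule Group.hom_compose[OF \<pi>.homh \<psi>(1)])
  have ab_kernel: "g \<in> derived1 G" if g: "g \<in> carrier G" "ab g = 0" for g
  proof -
    have "\<psi> (derived1 G #>\<^bsub>G\<^esub> g) = \<psi> \<one>\<^bsub>G Mod derived1 G\<^esub>"
      using g \<psi>.hom_one by (simp add: ab_eq)
    then have "derived1 G #>\<^bsub>G\<^esub> g = \<one>\<^bsub>G Mod derived1 G\<^esub>"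
      using inj_onD[OF \<psi>(2)] g \<pi>.hom_closed[of g] \<pi>.H.one_closed by blast
    then show ?thesis using g G.rcos_self[OF g(1) D1.subgroup_axioms] by simp
  qed
  have "\<exists>w. w \<in> carrier ?F \<and> ab (p w) = frag_of i" if i: "i < \<mu>" for i
  proof -
    have "frag_of i \<in> \<psi> ` carrier (G Mod derived1 G)" using i \<psi>(3) by simp
    then obtain g where "g \<in> carrier G" "ab g = frag_of i" by (auto simp: carrier_FactGroup ab_eq)
    moreover then obtain w where "w \<in> carrier ?F" "g = p w" using P.surj by auto
    ultimately show ?thesis by blast
  qed
  then obtain u where u: "\<And>i. i < \<mu> \<Longrightarrow> u i \<in> carrier ?F" "\<And>i. i < \<mu> \<Longrightarrow> ab (p (u i)) = frag_of i"
    by metis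
  interpret alexander N rs G p \<mu> ab "\<lambda>i. p (u i)" u
    by unfold_locales (use ab_hom ab_kernel u in auto)
  have "group_ring_map (\<lambda>w. ab (p w)) (fox j (rs ! k)) = A k j" if "k < length rs" for k j
  proof -
    have "(\<lambda>w. ab (p w)) \<in> hom ?F (free_Abelian_group {..<\<mu>})"
      using Group.hom_compose[OF P.p.homh ab_hom] by (simp add: o_def)
    then show ?thesis
      using group_ring_map_fox[of "\<lambda>w. ab (p w)" "{..<N}" "{..<\<mu>}" "rs ! k" j] relator_carrier[OF that]
      by (simp add: A_def \<alpha>_def[abs_def])
  qed
  then have "alexander_matrix G \<psi> N rs \<theta> = mat (length rs) N (\<lambda>(k, j). A k j)"
    unfolding alexander_matrix_def ab_def p_def by (intro cong_mat) auto
  from elementary_ideal_zero_iff[OF this]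
  have 1: "elementary_ideal G \<mu> \<psi> N rs \<theta> (int \<mu> - 1) = {0} \<longleftrightarrow>
      (\<forall>q\<ge>1. chen_group G q \<cong> chen_group (free_group {..<\<mu>}) q)"
    using chen_iff_minors by simp
  have 2: "(\<forall>i<\<mu>. h (longitude D i (b i)) \<in> G_infinity G) \<longleftrightarrow>
      (\<forall>q\<ge>1. chen_group G q \<cong> chen_group (free_group {..<\<mu>}) q)"
    if dg: "virtual_link_diagram D" "ncomp D = \<mu>" "h \<in> iso (link_group D) G" "\<forall>i<\<mu>. (i, b i) \<in> arcs D" for D h b
  proof -
    interpret diagram D b by unfold_locales (use dg in auto)
    have "link_relators D \<subseteq> carrier FA"
    proof
      fix r assume "r \<in> link_relators D"
      then obtain i j where ij: "i < ncomp D" "j < n_under D i" "r = link_relator D i j"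
        by (auto simp: link_relators_def)
      interpret F: group FA by (rule group_free_group)
      have c: "crs FA gen i j \<in> carrier FA" by (rule crs_carrier[OF F.is_group gen_arc ij(1,2)])
      have "gen (i, j) \<in> carrier FA" "gen (i, (j + 1) mod n_under D i) \<in> carrier FA"
        using ij by (auto simp: arcs_def)
      then show "r \<in> carrier FA"
        unfolding ij(3) link_relator_def over_letter_crs Let_def using c by simp
    qed
    from presentation_of_iso[OF this assms(1) dg(3)[unfolded link_group_def]]
    interpret LP: link_presentation D b G "\<lambda>w. h (word_class (arcs D) (link_relators D) w)"
      by (intro link_presentation.intro diagram_axioms)
    show ?thesis using LP.longitudes_iff_chen unfolding dg(2) longitude_def .
  qed
  show ?thesis
  proof (intro conjI allI impI)
    show "elementary_ideal G \<mu> \<psi> N rs \<theta> (int \<mu> - 1) = {0} \<longleftrightarrow>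
      (\<forall>q\<ge>1. chen_group G q \<cong> chen_group (free_group {..<\<mu>}) q)" by (rule 1)
    fix D h b
    assume "virtual_link_diagram D" "ncomp D = \<mu>" "h \<in> iso (link_group D) G" "\<forall>i<\<mu>. (i, b i) \<in> arcs D"
    from 2[OF this] show "elementary_ideal G \<mu> \<psi> N rs \<theta> (int \<mu> - 1) = {0} \<longleftrightarrow>
      (\<forall>i<\<mu>. h (longitude D i (b i)) \<in> G_infinity G)" unfolding 1 by (rule sym)
  qed
qed

end
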